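(* Let $m_0\le n_0$ be integers and let $A,B\in\widetilde\Xi([m_0,n_0])$ with $co(A)=ro(B)$. Then there exist matrices $X_1,\dots,X_s\in\widetilde\Xi([m_0,n_0])$, elements $P_1(v,v'),\dots,P_s(v,v')\in\mathcal Z_1$ and an integer $a_0\ge0$ such that $$[{}_a(A^{[m,n]})]\cdot[{}_a(B^{[m,n]})]=\sum_{i=1}^sP_i(v,v^{-a})[{}_a(X_i^{[m,n]})]$$ in $\mathcal K([m,n],\sigma(A)+a(n-m+1))$ for all $a\ge a_0$, $m\le m_0$ and $n\ge n_0$.
   Context: $v$ indeterminate, $\mathcal Z=\mathbb Z[v,v^{-1}]$. For integers $m\le n$, $\widetilde\Xi([m,n])$ is the set of integer matrices $(a_{ij})_{i,j\in[m,n]}$ with $a_{ij}\ge0$ for $i\ne j$; $\Xi([m,n],r)$ the set of nonnegative integer such matrices with entry sum $\sigma(A)=r$; $ro(A)=(\sum_ja_{ij})_i$, $co(A)=(\sum_ia_{ij})_j$. For $A\in\widetilde\Xi([m_0,n_0])$, $m\le m_0$, $n\ge n_0$ and $a\in\mathbb Z$, ${}_a(A^{[m,n]})$ denotes the $[m,n]\times[m,n]$ matrix obtained by extending $A$ by zeros and adding $aI_{[m,n]}$ (so for $a$ large it lies in $\Xi([m,n],\sigma(A)+a(n-m+1))$). $\mathcal K([m,n],r)$: for a finite field with $q$ elements and an $r$-dimensional space $V$ over it, an $[m,n]$-step flag is $V_m\subseteq\cdots\subseteq V_n=V$, with $V_{m-1}:=0$. The $GL(V)$-orbits $\mathcal O_A$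 on pairs of flags $((V_i),(V'_i))$ correspond bijectively to $A\in\Xi([m,n],r)$ via $a_{ij}=\dim(V_{i-1}+V_i\cap V'_j)-\dim(V_{i-1}+V_i\cap V'_{j-1})$. For $(f_1,f_2)\in\mathcal O_C$ the number of flags $f$ with $(f_1,f)\in\mathcal O_A$, $(f,f_2)\in\mathcal O_B$ equals $g_{A,B,C}|_{v^2=q}$ for a polynomial $g_{A,B,C}\in\mathbb Z[v^2]$ independent of $q$. $\mathcal K([m,n],r)$ is the associative $\mathcal Z$-algebra, free with basis $\{e_A\}_{A\in\Xi([m,n],r)}$, with $e_Ae_B=\sum_Cg_{A,B,C}e_C$; $[A]:=v^{-d_A}e_A$ with $d_A=\sum_{i\ge k,j<l}a_{ij}a_{kl}$. $\mathcal Z_1$ is the subring of $\mathbb Q(v)[v']$ ($v'$ a new indeterminate) generated by all $v^j$ ($j\in\mathbb Z$) and all $\prod_{i=1}^t\frac{v^{-2(a-i)}v'^2-1}{v^{-2i}-1}$ with $a\in\mathbb Z$, $t\ge1$. *)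

theory Defs
  imports "HOL-Algebra.Ring" "HOL-Computational_Algebra.Polynomial"
          "HOL-Computational_Algebra.Fraction_Field"
begin

type_synonym mat = "int \<Rightarrow> int \<Rightarrow> int"

definition tXi :: "int \<Rightarrow> int \<Rightarrow> mat set" where
  "tXi m n = {A. (\<forall>i j. (i \<notin> {m..n} \<or> j \<notin> {m..n}) \<longrightarrow> A i j = 0) \<and>
                 (\<forall>i\<in>{m..n}. \<forall>j\<in>{m..n}. i \<noteq> j \<longrightarrow> A i j \<ge> 0)}"

definition msum :: "int \<Rightarrow> int \<Rightarrow> mat \<Rightarrow> int" where
  "msum m n A = (\<Sum>i\<in>{m..n}. \<Sum>j\<in>{m..n}. A i j)"

definition Xi :: "int \<Rightarrow> int \<Rightarrow> int \<Rightarrow> mat set" where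
  "Xi m n r = {A \<in> tXi m n. (\<forall>i j. A i j \<ge> 0) \<and> msum m n A = r}"

definition ro :: "int \<Rightarrow> int \<Rightarrow> mat \<Rightarrow> int \<Rightarrow> int" where
  "ro m n A i = (\<Sum>j\<in>{m..n}. A i j)"

definition co :: "int \<Rightarrow> int \<Rightarrow> mat \<Rightarrow> int \<Rightarrow> int" where
  "co m n A j = (\<Sum>i\<in>{m..n}. A i j)"

definition ext :: "int \<Rightarrow> int \<Rightarrow> int \<Rightarrow> mat \<Rightarrow> mat" where
  "ext a m n A = (\<lambda>i j. if i \<in> {m..n} \<and> j \<in> {m..n} then A i j + (if i = j then a else 0) else 0)"

definition dA :: "int \<Rightarrow> int \<Rightarrow> mat \<Rightarrow> int" where
  "dA m n A = (\<Sum>i\<in>{m..n}. \<Sum>j\<in>{m..n}. \<Sum>k\<in>{m..n}. \<Sum>l\<in>{m..n}.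
                 if i \<ge> k \<and> j < l then A i j * A k l else 0)"

definition vecs :: "nat ring \<Rightarrow> nat \<Rightarrow> nat list set" where
  "vecs R r = {x. length x = r \<and> set x \<subseteq> carrier R}"

definition vadd :: "nat ring \<Rightarrow> nat list \<Rightarrow> nat list \<Rightarrow> nat list" where
  "vadd R x y = map2 (\<lambda>a b. a \<oplus>\<^bsub>R\<^esub> b) x y"

definition vsmul :: "nat ring \<Rightarrow> nat \<Rightarrow> nat list \<Rightarrow> nat list" where
  "vsmul R c x = map (\<lambda>a. c \<otimes>\<^bsub>R\<^esub> a) x"

definition vzero :: "nat ring \<Rightarrow> nat \<Rightarrow> nat list" where
  "vzero R r = replicate r \<zero>\<^bsub>R\<^esub>"

definition subspace :: "nat ring \<Rightarrow> nat \<Rightarrow> nat list set \<Rightarrow> bool" where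
  "subspace R r W \<longleftrightarrow> W \<subseteq> vecs R r \<and> vzero R r \<in> W \<and>
     (\<forall>x\<in>W. \<forall>y\<in>W. vadd R x y \<in> W) \<and> (\<forall>c\<in>carrier R. \<forall>x\<in>W. vsmul R c x \<in> W)"

definition sdim :: "nat ring \<Rightarrow> nat list set \<Rightarrow> nat" where
  "sdim R W = (THE k. card W = card (carrier R) ^ k)"

definition ssum :: "nat ring \<Rightarrow> nat list set \<Rightarrow> nat list set \<Rightarrow> nat list set" where
  "ssum R U W = {vadd R x y | x y. x \<in> U \<and> y \<in> W}"

definition is_flag :: "nat ring \<Rightarrow> nat \<Rightarrow> int \<Rightarrow> int \<Rightarrow> (int \<Rightarrow> nat list set) \<Rightarrow> bool" where
  "is_flag R r m n f \<longleftrightarrow> (\<forall>i\<in>{m..n}. subspace R r (f i)) \<and>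
     (\<forall>i. m \<le> i \<and> i < n \<longrightarrow> f i \<subseteq> f (i + 1)) \<and> f n = vecs R r \<and>
     (\<forall>i. i \<notin> {m..n} \<longrightarrow> f i = {})"

definition flagat :: "nat ring \<Rightarrow> nat \<Rightarrow> int \<Rightarrow> (int \<Rightarrow> nat list set) \<Rightarrow> int \<Rightarrow> nat list set" where
  "flagat R r m f i = (if i = m - 1 then {vzero R r} else f i)"

text \<open>The matrix A with (f, f') in O_A.\<close>
definition ftype :: "nat ring \<Rightarrow> nat \<Rightarrow> int \<Rightarrow> int \<Rightarrow> (int \<Rightarrow> nat list set) \<Rightarrow> (int \<Rightarrow> nat list set) \<Rightarrow> mat" where
  "ftype R r m n f f' = (\<lambda>i j. if i \<in> {m..n} \<and> j \<in> {m..n} then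
      int (sdim R (ssum R (flagat R r m f (i - 1)) (f i \<inter> flagat R r m f' j)))
    - int (sdim R (ssum R (flagat R r m f (i - 1)) (f i \<inter> flagat R r m f' (j - 1))))
    else 0)"

definition gpoly :: "int \<Rightarrow> int \<Rightarrow> mat \<Rightarrow> mat \<Rightarrow> mat \<Rightarrow> int poly" where
  "gpoly m n A B C = (let r = nat (msum m n C) in
     THE p. \<forall>R :: nat ring. field R \<and> finite (carrier R) \<longrightarrow>
        (\<forall>f1 f2. is_flag R r m n f1 \<and> is_flag R r m n f2 \<and> ftype R r m n f1 f2 = C \<longrightarrow>
           int (card {f. is_flag R r m n f \<and> ftype R r m n f1 f = A \<and> ftype R r m n f f2 = B})
             = poly p (int (card (carrier R)))))"

type_synonym rf = "int poly fract"

definition vv :: rf where "vv = Fract [:0, 1:] 1"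

text \<open>Elements of K([m,n],r) (tensored with Q(v)) are coefficient functions on Xi(m,n,r).\<close>
definition Kbasis :: "mat \<Rightarrow> mat \<Rightarrow> rf" where
  "Kbasis A = (\<lambda>C. if C = A then 1 else 0)"

definition Kprod :: "int \<Rightarrow> int \<Rightarrow> mat \<Rightarrow> mat \<Rightarrow> mat \<Rightarrow> rf" where
  "Kprod m n A B = (\<lambda>C. if C \<in> Xi m n (msum m n A) then
      vv powi (dA m n C - dA m n A - dA m n B) *
      poly (map_poly of_int (gpoly m n A B C)) (vv ^ 2)
    else 0)"

inductive_set Z1 :: "rf poly set" where
  gen_v: "[: vv powi j :] \<in> Z1"
| gen_q: "t \<ge> 1 \<Longrightarrow> (\<Prod>i\<in>{1..t}. smult (inverse (vv powi (-2 * i) - 1))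
            [: -1, 0, vv powi (-2 * (a - i)) :]) \<in> Z1"
| add: "p \<in> Z1 \<Longrightarrow> q \<in> Z1 \<Longrightarrow> p + q \<in> Z1"
| mult: "p \<in> Z1 \<Longrightarrow> q \<in> Z1 \<Longrightarrow> p * q \<in> Z1"
| uminus: "p \<in> Z1 \<Longrightarrow> - p \<in> Z1"

end

theory Submission
  imports Defs "HOL-Computational_Algebra.Primes"
begin

text \<open>
  A product \<open>e\<^sub>A e\<^sub>B\<close> is the convolution of the indicator functions of two orbits on pairs of flags, so
  everything can be computed over each finite field separately and uniformly in \<open>a\<close>, \<open>m\<close>, \<open>n\<close>.
  If \<open>E\<close> is elementary (a diagonal matrix plus \<open>t\<close> at one place next to the diagonal), two flags in
  relative position \<open>E\<close> differ in a single step, and \<open>e\<^sub>E e\<^sub>A\<close> is obtained by counting the subspaces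
  between two given ones that meet a filtration in prescribed dimensions. This gives products of
  Gaussian binomials; only the one attached to a diagonal entry depends on \<open>a\<close>, and after
  normalisation it is a generator of \<open>\<Z>\<^sub>1\<close>, because all exponents linear in \<open>a\<close> cancel.
  For general \<open>A\<close> use induction on \<open>\<Sum> (i - j)\<^sup>2 a\<^sub>i\<^sub>j\<close>: moving an extremal off-diagonal entry of \<open>A\<close>
  one step towards the diagonal yields \<open>A'\<close> and \<open>E\<close> such that \<open>e\<^sub>E\<close> times the basis element of
  \<open>A'\<close> is \<open>e\<^sub>A\<close> plus terms of smaller weight, so associativity of convolution reduces \<open>e\<^sub>A e\<^sub>B\<close> to
  products that are already known to be stable.
  The resulting polynomials are the structure constants, since flags of every relative position
  exist over all prime fields.
\<close>

section \<open>Vector spaces over a finite field\<close>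

text \<open>\<open>gpoly\<close> is a definite description, so structure constants cannot be
  manipulated before a counting polynomial is known to exist. Products are therefore finite sums
  over flags for one field at a time, where associativity is an exchange of summations; polynomials
  in the field size occur only as coefficients. Independence of \<open>m\<close> and
  \<open>n\<close>: an elementary step moves units between two rows inside \<open>[m0,n0]\<close>,
  and these rows of an extended matrix vanish outside \<open>[m0,n0]\<close>. Cancellation of
  \<open>a\<close>: \<open>d\<close> of the extension of \<open>X\<close> is
  \<open>d_X + a * sum |i - j| x_ij\<close>. Moving one unit to the neighbouring row changes this
  weight by 1 or -1, and the power of \<open>q\<close> in the count supplies the difference. The
  squares in the induction weight: with \<open>|i - j|\<close> a unit moved away from the diagonal
  gains 1 in any column, so several terms would tie; \<open>(i - j)^2\<close> grows by more in a
  column further out, which singles out \<open>A\<close>. Row sums are carried along with every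
  expansion, because left multiplication by \<open>e_E\<close> is controlled only for matrices whose
  row sums are the column sums of \<open>E\<close>.\<close>

locale coord_space = field R for R :: "nat ring" (structure) +
  fixes r :: nat
  assumes fin: "finite (carrier R)"
begin

abbreviation "V \<equiv> vecs R r"
abbreviation "z \<equiv> vzero R r"
abbreviation "q \<equiv> card (carrier R)"
abbreviation vplus (infixl "\<boxplus>" 65) where "x \<boxplus> y \<equiv> vadd R x y"
abbreviation vtimes (infixr "\<odot>" 75) where "c \<odot> x \<equiv> vsmul R c x"
abbreviation "dm W \<equiv> sdim R W"
abbreviation "subsp W \<equiv> subspace R r W"
abbreviation "vneg x \<equiv> (\<ominus> \<one>) \<odot> x"
abbreviation vsum (infixl "\<squnion>" 65) where "U \<squnion> W \<equiv> ssum R U W"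

lemma q_ge2: "q \<ge> 2"
proof -
  have "{\<zero>, \<one>} \<subseteq> carrier R" by auto
  then have "card {\<zero>, \<one>} \<le> q" using fin card_mono by blast
  then show ?thesis by simp
qed

section \<open>Coordinatewise vector arithmetic\<close>

lemma mem_V: "x \<in> V \<longleftrightarrow> length x = r \<and> (\<forall>i<r. x ! i \<in> carrier R)"
  by (auto simp: vecs_def subset_iff in_set_conv_nth)

lemma vadd_nth [simp]: "x \<in> V \<Longrightarrow> y \<in> V \<Longrightarrow> i < r \<Longrightarrow> (x \<boxplus> y) ! i = x ! i \<oplus> y ! i"
  by (simp add: vadd_def mem_V)

lemma vsmul_nth [simp]: "x \<in> V \<Longrightarrow> i < r \<Longrightarrow> (c \<odot> x) ! i = c \<otimes> x ! i"
  by (simp add: vsmul_def mem_V)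

lemma vzero_nth [simp]: "i < r \<Longrightarrow> z ! i = \<zero>"
  by (simp add: vzero_def)

lemma V_nth [simp]: "x \<in> V \<Longrightarrow> i < r \<Longrightarrow> x ! i \<in> carrier R"
  by (simp add: mem_V)

lemma vzero_closed [simp]: "z \<in> V"
  by (simp add: vzero_def mem_V)

lemma vadd_closed [simp]: "x \<in> V \<Longrightarrow> y \<in> V \<Longrightarrow> x \<boxplus> y \<in> V"
  by (simp add: mem_V vadd_def)

lemma vsmul_closed [simp]: "c \<in> carrier R \<Longrightarrow> x \<in> V \<Longrightarrow> c \<odot> x \<in> V"
  by (simp add: mem_V vsmul_def)

lemma V_eqI: "x \<in> V \<Longrightarrow> y \<in> V \<Longrightarrow> (\<And>i. i < r \<Longrightarrow> x ! i = y ! i) \<Longrightarrow> x = y"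
  by (simp add: mem_V nth_equalityI)

lemma vadd_comm: "x \<in> V \<Longrightarrow> y \<in> V \<Longrightarrow> x \<boxplus> y = y \<boxplus> x"
  by (rule V_eqI) (auto simp: a_comm)

lemma vadd_assoc: "x \<in> V \<Longrightarrow> y \<in> V \<Longrightarrow> w \<in> V \<Longrightarrow> (x \<boxplus> y) \<boxplus> w = x \<boxplus> (y \<boxplus> w)"
  by (rule V_eqI) (auto simp: a_assoc)

lemma vadd_zero [simp]: "x \<in> V \<Longrightarrow> x \<boxplus> z = x"
  by (rule V_eqI) auto

lemma zero_vadd [simp]: "x \<in> V \<Longrightarrow> z \<boxplus> x = x"
  by (rule V_eqI) auto

lemma vadd_neg [simp]: "x \<in> V \<Longrightarrow> x \<boxplus> vneg x = z"
  by (rule V_eqI) (auto simp: l_minus r_neg)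

lemma neg_vadd [simp]: "x \<in> V \<Longrightarrow> vneg x \<boxplus> x = z"
  by (rule V_eqI) (auto simp: l_minus l_neg)

lemma vadd_neg_cancel [simp]: "x \<in> V \<Longrightarrow> y \<in> V \<Longrightarrow> (x \<boxplus> y) \<boxplus> vneg y = x"
  by (simp add: vadd_assoc)

lemma vneg_add_cancel [simp]: "x \<in> V \<Longrightarrow> y \<in> V \<Longrightarrow> (x \<boxplus> vneg y) \<boxplus> y = x"
  by (simp add: vadd_assoc)

lemma vadd_swap:
  assumes "x \<in> V" "y \<in> V" "x' \<in> V" "y' \<in> V"
  shows "(x \<boxplus> y) \<boxplus> (x' \<boxplus> y') = (x \<boxplus> x') \<boxplus> (y \<boxplus> y')"
  by (rule V_eqI) (use assms in \<open>auto simp: a_ac\<close>)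

lemma vadd_diff_eq:
  assumes "x \<in> V" "y \<in> V" "u \<in> V" "w \<in> V" "x \<boxplus> y = u \<boxplus> w"
  shows "x \<boxplus> vneg u = w \<boxplus> vneg y"
proof (rule V_eqI)
  fix i assume i: "i < r"
  have "x ! i \<oplus> y ! i = u ! i \<oplus> w ! i" using arg_cong[OF assms(5), of "\<lambda>v. v ! i"] assms(1-4) i by simp
  moreover have "x ! i \<oplus> \<ominus> (u ! i) = (x ! i \<oplus> y ! i) \<oplus> (\<ominus> (y ! i) \<oplus> \<ominus> (u ! i))"
    and "(u ! i \<oplus> w ! i) \<oplus> (\<ominus> (y ! i) \<oplus> \<ominus> (u ! i)) = w ! i \<oplus> \<ominus> (y ! i)"
    using assms(1-4)[THEN V_nth[OF _ i]] by algebra+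
  ultimately have "x ! i \<oplus> \<ominus> (u ! i) = w ! i \<oplus> \<ominus> (y ! i)" by simp
  then show "(x \<boxplus> vneg u) ! i = (w \<boxplus> vneg y) ! i" using assms i by (simp add: l_minus)
qed (use assms in auto)

lemma vneg_diff:
  assumes "x \<in> V" "y \<in> V"
  shows "x \<boxplus> vneg (x \<boxplus> vneg y) = y"
proof (rule V_eqI)
  fix i assume i: "i < r"
  have "x ! i \<oplus> \<ominus> (x ! i \<oplus> \<ominus> (y ! i)) = y ! i"
    using assms[THEN V_nth[OF _ i]] by algebra
  then show "(x \<boxplus> vneg (x \<boxplus> vneg y)) ! i = y ! i" using assms i by (simp add: l_minus)
qed (use assms in auto)

lemma vsmul_add: "c \<in> carrier R \<Longrightarrow> x \<in> V \<Longrightarrow> y \<in> V \<Longrightarrow> c \<odot> (x \<boxplus> y) = c \<odot> x \<boxplus> c \<odot> y"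
  by (rule V_eqI) (auto simp: r_distr)

lemma add_vsmul: "c \<in> carrier R \<Longrightarrow> d \<in> carrier R \<Longrightarrow> x \<in> V \<Longrightarrow> (c \<oplus> d) \<odot> x = c \<odot> x \<boxplus> d \<odot> x"
  by (rule V_eqI) (auto simp: l_distr)

lemma vsmul_vsmul: "c \<in> carrier R \<Longrightarrow> d \<in> carrier R \<Longrightarrow> x \<in> V \<Longrightarrow> c \<odot> d \<odot> x = (c \<otimes> d) \<odot> x"
  by (rule V_eqI) (auto simp: m_assoc)

lemma one_vsmul [simp]: "x \<in> V \<Longrightarrow> \<one> \<odot> x = x"
  by (rule V_eqI) auto

lemma zero_vsmul [simp]: "x \<in> V \<Longrightarrow> \<zero> \<odot> x = z"
  by (rule V_eqI) auto

lemma vsmul_zero [simp]: "c \<in> carrier R \<Longrightarrow> c \<odot> z = z"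
  by (rule V_eqI) auto

lemma finite_V [simp]: "finite V"
proof -
  have "V = {xs. set xs \<subseteq> carrier R \<and> length xs = r}" by (auto simp: vecs_def)
  then show ?thesis using finite_lists_length_eq[OF fin] by simp
qed

section \<open>Subspaces, their sums and the modular law\<close>

lemma subspI:
  assumes "W \<subseteq> V" "z \<in> W" "\<And>x y. x \<in> W \<Longrightarrow> y \<in> W \<Longrightarrow> x \<boxplus> y \<in> W"
    "\<And>c x. c \<in> carrier R \<Longrightarrow> x \<in> W \<Longrightarrow> c \<odot> x \<in> W"
  shows "subsp W"
  using assms by (auto simp: subspace_def)

lemma subspD:
  assumes "subsp W"
  shows "W \<subseteq> V" "z \<in> W" "\<And>x y. x \<in> W \<Longrightarrow> y \<in> W \<Longrightarrow> x \<boxplus> y \<in> W"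
    "\<And>c x. c \<in> carrier R \<Longrightarrow> x \<in> W \<Longrightarrow> c \<odot> x \<in> W" "\<And>x. x \<in> W \<Longrightarrow> x \<in> V"
    "\<And>x. x \<in> W \<Longrightarrow> vneg x \<in> W"
  using assms by (auto simp: subspace_def)

lemma subsp_V [simp]: "subsp V"
  by (rule subspI) auto

lemma subsp_zero [simp]: "subsp {z}"
  by (rule subspI) auto

lemma subsp_Int [simp]: "subsp U \<Longrightarrow> subsp W \<Longrightarrow> subsp (U \<inter> W)"
  by (auto simp: subspace_def)

lemma finite_subsp: "subsp W \<Longrightarrow> finite W"
  using subspD(1) finite_V finite_subset by blast

lemma ssum_comm: "subsp U \<Longrightarrow> subsp W \<Longrightarrow> U \<squnion> W = W \<squnion> U"
proof -
  have "U \<squnion> W \<subseteq> W \<squnion> U" if "subsp U" "subsp W" for U W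
  proof
    fix x assume "x \<in> U \<squnion> W"
    then obtain u w where uw: "u \<in> U" "w \<in> W" "x = u \<boxplus> w" by (auto simp: ssum_def)
    then have "x = w \<boxplus> u" using vadd_comm[OF subspD(5)[OF that(1)] subspD(5)[OF that(2)]] by simp
    then show "x \<in> W \<squnion> U" using uw unfolding ssum_def by blast
  qed
  then show "subsp U \<Longrightarrow> subsp W \<Longrightarrow> U \<squnion> W = W \<squnion> U" by (simp add: subset_antisym)
qed

lemma subsp_ssum [simp]:
  assumes "subsp U" "subsp W"
  shows "subsp (U \<squnion> W)"
proof (rule subspI)
  note d = subspD[OF assms(1)] subspD[OF assms(2)]
  show "U \<squnion> W \<subseteq> V" using d by (auto simp: ssum_def)
  have "z = z \<boxplus> z" by simp
  then show "z \<in> U \<squnion> W" unfolding ssum_def using d by blast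
  show "x \<boxplus> y \<in> U \<squnion> W" if xy: "x \<in> U \<squnion> W" "y \<in> U \<squnion> W" for x y
  proof -
    obtain u w u' w' where uw: "u \<in> U" "w \<in> W" "u' \<in> U" "w' \<in> W" "x = u \<boxplus> w" "y = u' \<boxplus> w'"
      using xy by (auto simp: ssum_def)
    have "x \<boxplus> y = (u \<boxplus> u') \<boxplus> (w \<boxplus> w')" unfolding uw(5,6)
      by (rule vadd_swap[OF d(5)[OF uw(1)] d(11)[OF uw(2)] d(5)[OF uw(3)] d(11)[OF uw(4)]])
    moreover have "u \<boxplus> u' \<in> U" "w \<boxplus> w' \<in> W" using d(3)[OF uw(1,3)] d(9)[OF uw(2,4)] .
    ultimately show ?thesis unfolding ssum_def by blast
  qed
  show "c \<odot> x \<in> U \<squnion> W" if cx: "c \<in> carrier R" "x \<in> U \<squnion> W" for c x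
  proof -
    obtain u w where uw: "u \<in> U" "w \<in> W" "x = u \<boxplus> w"
      using cx(2) by (auto simp: ssum_def)
    have "c \<odot> x = c \<odot> u \<boxplus> c \<odot> w" unfolding uw(3)
      by (rule vsmul_add[OF cx(1) d(5)[OF uw(1)] d(11)[OF uw(2)]])
    moreover have "c \<odot> u \<in> U" "c \<odot> w \<in> W"
      using d(4)[OF cx(1) uw(1)] d(10)[OF cx(1) uw(2)] .
    ultimately show ?thesis unfolding ssum_def by blast
  qed
qed

lemma ssum_upper1: "subsp U \<Longrightarrow> subsp W \<Longrightarrow> U \<subseteq> U \<squnion> W"
proof
  fix x assume *: "subsp U" "subsp W" "x \<in> U"
  then have "x = x \<boxplus> z" using subspD by auto
  then show "x \<in> U \<squnion> W" using * subspD(2)[of W] unfolding ssum_def by blast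
qed

lemma ssum_upper2: "subsp U \<Longrightarrow> subsp W \<Longrightarrow> W \<subseteq> U \<squnion> W"
proof
  fix x assume *: "subsp U" "subsp W" "x \<in> W"
  then have "x = z \<boxplus> x" using subspD by auto
  then show "x \<in> U \<squnion> W" using * subspD(2)[of U] unfolding ssum_def by blast
qed

lemma ssum_least: "subsp S \<Longrightarrow> U \<subseteq> S \<Longrightarrow> W \<subseteq> S \<Longrightarrow> U \<squnion> W \<subseteq> S"
  using subspD(3) unfolding ssum_def by blast

lemma ssum_mono: "U \<subseteq> U' \<Longrightarrow> W \<subseteq> W' \<Longrightarrow> U \<squnion> W \<subseteq> U' \<squnion> W'"
  unfolding ssum_def by blast

lemma ssum_absorb: "subsp U \<Longrightarrow> subsp W \<Longrightarrow> W \<subseteq> U \<Longrightarrow> U \<squnion> W = U"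
  using ssum_least[of U U W] ssum_upper1[of U W] by blast

lemma modular_law:
  assumes "subsp U" "subsp W" "subsp S" "U \<subseteq> W"
  shows "(U \<squnion> S) \<inter> W = U \<squnion> (S \<inter> W)"
proof
  note d = subspD[OF assms(1)] subspD[OF assms(2)] subspD[OF assms(3)]
  show "(U \<squnion> S) \<inter> W \<subseteq> U \<squnion> (S \<inter> W)"
  proof
    fix x assume x: "x \<in> (U \<squnion> S) \<inter> W"
    then obtain u s where us: "u \<in> U" "s \<in> S" "x = u \<boxplus> s" by (auto simp: ssum_def)
    have "u \<in> V" "s \<in> V" "u \<in> W" using us d(5,17) assms(4) by auto
    then have "x \<boxplus> vneg u = s" using us vadd_comm[of u s] by simp
    moreover have "x \<boxplus> vneg u \<in> W" using x d(9)[OF _ d(12)] \<open>u \<in> W\<close> by simp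
    ultimately have "s \<in> W" by simp
    then show "x \<in> U \<squnion> (S \<inter> W)" using us unfolding ssum_def by blast
  qed
  show "U \<squnion> (S \<inter> W) \<subseteq> (U \<squnion> S) \<inter> W"
    using ssum_mono[of U U "S \<inter> W" S] ssum_least[of W U "S \<inter> W"] assms by blast
qed

text \<open>Each fibre of addition from \<open>U \<times> W\<close> onto
  \<open>U \<squnion> W\<close> is a translate of the set of pairs \<open>(y, vneg y)\<close> with
  \<open>y\<close> in \<open>U \<inter> W\<close>.\<close>

lemma card_ssum:
  assumes "subsp U" "subsp W"
  shows "card (U \<squnion> W) * card (U \<inter> W) = card U * card W"
proof -
  note d = subspD[OF assms(1)] subspD[OF assms(2)]
  have fin': "finite U" "finite W" "finite (U \<squnion> W)" using assms finite_subsp by auto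
  have fib: "card {p \<in> U \<times> W. fst p \<boxplus> snd p = x} = card (U \<inter> W)" if "x \<in> U \<squnion> W" for x
  proof -
    obtain u w where uw: "u \<in> U" "w \<in> W" "x = u \<boxplus> w" using \<open>x \<in> U \<squnion> W\<close> by (auto simp: ssum_def)
    have uwV: "u \<in> V" "w \<in> V" using uw d by auto
    have "bij_betw (\<lambda>y. (u \<boxplus> y, w \<boxplus> vneg y)) (U \<inter> W) {p \<in> U \<times> W. fst p \<boxplus> snd p = x}"
    proof (rule bij_betw_byWitness[where f' = "\<lambda>p. fst p \<boxplus> vneg u"])
      show "\<forall>y\<in>U \<inter> W. fst (u \<boxplus> y, w \<boxplus> vneg y) \<boxplus> vneg u = y"
        using d(5) uwV by (auto simp: vadd_comm[of u])
      have e: "w' = w \<boxplus> vneg (u' \<boxplus> vneg u)" if "u' \<in> V" "w' \<in> V" "u' \<boxplus> w' = u \<boxplus> w" for u' w'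
        using vadd_diff_eq[of u' w' u w] vneg_diff[of w w'] that uwV by simp
      show "\<forall>p\<in>{p \<in> U \<times> W. fst p \<boxplus> snd p = x}. (u \<boxplus> (fst p \<boxplus> vneg u), w \<boxplus> vneg (fst p \<boxplus> vneg u)) = p"
        using e d(5,11) uw uwV by (auto simp: vadd_comm[of u])
      show "(\<lambda>y. (u \<boxplus> y, w \<boxplus> vneg y)) ` (U \<inter> W) \<subseteq> {p \<in> U \<times> W. fst p \<boxplus> snd p = x}"
      proof clarsimp
        fix y assume y: "y \<in> U" "y \<in> W"
        have "(u \<boxplus> y) \<boxplus> (w \<boxplus> vneg y) = (u \<boxplus> w) \<boxplus> (y \<boxplus> vneg y)"
          using y d(5) uwV by (intro vadd_swap) auto
        then show "u \<boxplus> y \<in> U \<and> w \<boxplus> vneg y \<in> W \<and> u \<boxplus> y \<boxplus> (w \<boxplus> vneg y) = x"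
          using y d uw uwV by simp
      qed
      show "(\<lambda>p. fst p \<boxplus> vneg u) ` {p \<in> U \<times> W. fst p \<boxplus> snd p = x} \<subseteq> U \<inter> W"
      proof (rule image_subsetI)
        fix p assume p: "p \<in> {p \<in> U \<times> W. fst p \<boxplus> snd p = x}"
        obtain u' w' where pe: "p = (u', w')" by (cases p)
        have a: "u' \<in> U" "w' \<in> W" "u' \<boxplus> w' = x" using p pe by auto
        have "u' \<boxplus> vneg u = w \<boxplus> vneg w'"
          using vadd_diff_eq[OF d(5)[OF a(1)] d(11)[OF a(2)] uwV] a(3) uw(3) by simp
        moreover have "u' \<boxplus> vneg u \<in> U" using d(3)[OF a(1) d(6)[OF uw(1)]] .
        moreover have "w \<boxplus> vneg w' \<in> W" using d(9)[OF uw(2) d(12)[OF a(2)]] .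
        ultimately show "fst p \<boxplus> vneg u \<in> U \<inter> W" using pe by simp
      qed
    qed
    then show ?thesis by (simp add: bij_betw_same_card)
  qed
  have im: "(\<lambda>p. fst p \<boxplus> snd p) ` (U \<times> W) \<subseteq> U \<squnion> W" by (force simp: ssum_def)
  have "card (U \<times> W) = (\<Sum>x\<in>U \<squnion> W. card {p \<in> U \<times> W. fst p \<boxplus> snd p = x})"
    using sum.group[OF _ fin'(3) im, of "\<lambda>_. 1::nat"] fin' by simp
  also have "\<dots> = card (U \<squnion> W) * card (U \<inter> W)" using fib by simp
  finally show ?thesis by (simp add: card_cartesian_product)
qed

section \<open>Lines, and the dimension as an exponent of the field size\<close>

definition line :: "nat list \<Rightarrow> nat list set" where
  "line x = (\<lambda>c. c \<odot> x) ` carrier R"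

lemma subsp_line [simp]: "x \<in> V \<Longrightarrow> subsp (line x)"
proof (rule subspI)
  assume x: "x \<in> V"
  show "line x \<subseteq> V" using x by (auto simp: line_def)
  show "z \<in> line x" using x zero_vsmul[of x] unfolding line_def by (metis image_eqI zero_closed)
  show "u \<boxplus> w \<in> line x" if "u \<in> line x" "w \<in> line x" for u w
    using that x by (auto simp: line_def add_vsmul[symmetric])
  show "c \<odot> u \<in> line x" if "c \<in> carrier R" "u \<in> line x" for c u
    using that x by (auto simp: line_def vsmul_vsmul)
qed

lemma mem_line [simp]: "x \<in> V \<Longrightarrow> x \<in> line x"
  unfolding line_def by (metis image_eqI one_closed one_vsmul)

lemma vsmul_cancel:
  assumes "x \<in> V" "c \<in> carrier R" "c \<noteq> \<zero>"
  shows "inv c \<odot> c \<odot> x = x" "inv c \<in> carrier R"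
proof -
  have "c \<in> Units R" using assms field_Units by auto
  then show "inv c \<in> carrier R" by simp
  then show "inv c \<odot> c \<odot> x = x" using assms \<open>c \<in> Units R\<close> by (simp add: vsmul_vsmul)
qed

lemma line_Int:
  assumes "subsp U" "x \<in> V" "x \<notin> U"
  shows "U \<inter> line x = {z}"
proof -
  have "c \<odot> x = z" if "c \<in> carrier R" "c \<odot> x \<in> U" for c
    using vsmul_cancel[OF assms(2)] that assms subspD(4)[OF assms(1)] by (cases "c = \<zero>") force+
  moreover have "z \<in> U \<inter> line x" using assms subspD(2) subsp_line by blast
  ultimately show ?thesis by (auto simp: line_def)
qed

lemma card_line:
  assumes "x \<in> V" "x \<noteq> z"
  shows "card (line x) = q"
proof -
  have "inj_on (\<lambda>c. c \<odot> x) (carrier R)"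
  proof
    fix c d assume cd: "c \<in> carrier R" "d \<in> carrier R" "c \<odot> x = d \<odot> x"
    have "(c \<ominus> d) \<odot> x = c \<odot> x \<boxplus> (\<ominus> d) \<odot> x"
      using cd assms by (simp add: minus_eq add_vsmul)
    also have "\<dots> = (d \<oplus> \<ominus> d) \<odot> x" using cd assms by (simp add: add_vsmul)
    also have "\<dots> = z" using cd assms by (simp add: r_neg)
    finally have *: "(c \<ominus> d) \<odot> x = z" .
    have "c \<ominus> d = \<zero>"
    proof (rule ccontr)
      assume n: "c \<ominus> d \<noteq> \<zero>"
      have "c \<ominus> d \<in> carrier R" using cd by simp
      from vsmul_cancel[OF assms(1) this n] * assms(2) show False by simp
    qed
    then show "c = d" using cd minus_eq r_neg2 a_comm r_zero minus_equality by (metis a_inv_closed minus_minus)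
  qed
  then show ?thesis by (simp add: line_def card_image)
qed

lemma card_ssum_line:
  assumes "subsp U" "x \<in> V" "x \<notin> U"
  shows "card (U \<squnion> line x) = q * card U"
proof -
  have "x \<noteq> z" using assms subspD(2) by blast
  then show ?thesis
    using card_ssum[OF assms(1) subsp_line[OF assms(2)]] line_Int[OF assms] card_line assms by simp
qed

text \<open>Adjoining the line of a vector outside \<open>U\<close> multiplies the cardinality by
  \<open>q\<close>; this is repeated until \<open>W\<close> is reached. For \<open>U = {z}\<close>
  it shows that the exponent described in \<open>sdim\<close> exists, so dimensions are computed
  from cardinalities without bases.\<close>

lemma card_power_extend:
  assumes "subsp U" "subsp W" "U \<subseteq> W"
  shows "\<exists>k. card W = card U * q ^ k"
  using assms
proof (induction "card W - card U" arbitrary: U rule: less_induct)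
  case less
  show ?case
  proof (cases "U = W")
    case True
    then show ?thesis by (intro exI[of _ 0]) simp
  next
    case False
    then obtain x where x: "x \<in> W" "x \<notin> U" using less by blast
    have xV: "x \<in> V" using x less subspD by blast
    let ?U = "U \<squnion> line x"
    have s: "subsp ?U" using less xV by simp
    have "line x \<subseteq> W" using x(1) subspD(4)[OF less(3)] by (auto simp: line_def)
    then have sub: "?U \<subseteq> W" using ssum_least less by blast
    have xU: "x \<in> ?U" using ssum_upper2[of U "line x"] less xV by auto
    have "U \<subset> ?U" using ssum_upper1[of U "line x"] less xV x xU by auto
    then have "card U < card ?U" using psubset_card_mono s finite_subsp by blast
    moreover have "card ?U \<le> card W" using sub less finite_subsp card_mono by blast
    ultimately obtain k where "card W = card ?U * q ^ k" using less(1)[of ?U] s sub less by fastforce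
    then have "card W = card U * q ^ Suc k" using card_ssum_line[OF less(2) xV x(2)] by simp
    then show ?thesis by blast
  qed
qed

lemma q_power_inject: "q ^ i = q ^ j \<longleftrightarrow> i = j"
  using q_ge2 by (simp add: power_inject_exp)

lemma sdim_eqI: "card W = q ^ k \<Longrightarrow> dm W = k"
  unfolding sdim_def using q_power_inject by (intro the_equality) auto

lemma card_subsp:
  assumes "subsp W"
  shows "card W = q ^ dm W"
proof -
  obtain k where "card W = q ^ k" using card_power_extend[OF subsp_zero assms] subspD[OF assms] by auto
  then show ?thesis using sdim_eqI by simp
qed

lemma dim_zero [simp]: "dm {z} = 0"
  by (rule sdim_eqI) simp

lemma dim_V [simp]: "dm V = r"
proof (rule sdim_eqI)
  have "V = {xs. set xs \<subseteq> carrier R \<and> length xs = r}" by (auto simp: vecs_def)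
  then show "card V = q ^ r" using card_lists_length_eq[OF fin] by simp
qed

lemma dim_ssum:
  assumes "subsp U" "subsp W"
  shows "dm (U \<squnion> W) + dm (U \<inter> W) = dm U + dm W"
  using card_ssum[OF assms] assms by (simp add: card_subsp power_add[symmetric] q_power_inject)

lemma dim_mono:
  assumes "subsp U" "subsp W" "U \<subseteq> W"
  shows "dm U \<le> dm W"
proof -
  have "card U \<le> card W" using assms card_mono finite_subsp by blast
  then show ?thesis using assms q_ge2 by (simp add: card_subsp)
qed

lemma subsp_dim_eq:
  assumes "subsp U" "subsp W" "U \<subseteq> W" "dm U = dm W"
  shows "U = W"
  by (rule card_subset_eq[OF finite_subsp[OF assms(2)] assms(3)])
    (simp add: card_subsp[OF assms(1)] card_subsp[OF assms(2)] assms(4))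

lemma dim_ssum_line:
  assumes "subsp U" "x \<in> V" "x \<notin> U"
  shows "dm (U \<squnion> line x) = Suc (dm U)"
  by (rule sdim_eqI) (simp add: card_ssum_line[OF assms] card_subsp[OF assms(1)])

end

section \<open>Gaussian binomials and counting subspaces\<close>

definition qn :: "nat \<Rightarrow> int poly" where
  "qn n = [:0, 1:] ^ n - 1"

fun gb :: "nat \<Rightarrow> nat \<Rightarrow> int poly" where
  "gb n 0 = 1"
| "gb 0 (Suc k) = 0"
| "gb (Suc n) (Suc k) = gb n k + [:0, 1:] ^ Suc k * gb n (Suc k)"

text \<open>The factors \<open>q^i - 1\<close> are not divided by \<open>q - 1\<close>: numerator
  and denominator of a Gaussian binomial contain equally many of them.\<close>

definition qfact :: "nat \<Rightarrow> int poly" where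
  "qfact k = (\<Prod>i\<in>{1..k}. qn i)"

lemma qfact_0 [simp]: "qfact 0 = 1"
  by (simp add: qfact_def)

lemma qfact_Suc: "qfact (Suc k) = qfact k * qn (Suc k)"
  by (simp add: qfact_def mult.commute)

lemma qn_nonzero: "n \<ge> 1 \<Longrightarrow> qn n \<noteq> 0"
proof
  assume "n \<ge> 1" "qn n = 0"
  then have "poly (qn n) 2 = 0" by simp
  then have "(2::int) ^ n = 1" by (simp add: qn_def)
  then show False using \<open>n \<ge> 1\<close> by simp
qed

lemma qfact_nonzero [simp]: "qfact k \<noteq> 0"
  by (simp add: qfact_def qn_nonzero)

lemma gb_eq_0: "k > n \<Longrightarrow> gb n k = 0"
  by (induction n k rule: gb.induct) auto

text \<open>After clearing denominators the recursion of \<open>gb\<close> becomes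
  \<open>(q^(k+1) - 1) + q^(k+1) (q^(d+1) - 1) = q^(n+1) - 1\<close> with
  \<open>n = k + d + 1\<close>.\<close>

lemma gb_qfact: "k \<le> n \<Longrightarrow> gb n k * qfact k * qfact (n - k) = qfact n"
proof (induction n k rule: gb.induct)
  case (3 n k)
  show ?case
  proof (cases "k = n")
    case True
    then show ?thesis using 3 by (simp add: gb_eq_0 qfact_Suc)
  next
    case False
    then have kn: "k < n" "Suc k \<le> n" using 3 by auto
    then obtain d where d: "n = Suc (k + d)" by (metis add_Suc less_iff_Suc_add)
    have 1: "gb n k * qfact k * (qfact d * qn (Suc d)) = qfact n"
      using 3(1) kn d by (simp add: qfact_Suc)
    have 2: "gb n (Suc k) * (qfact k * qn (Suc k)) * qfact d = qfact n"
      using 3(2) kn d by (simp add: qfact_Suc)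
    have "gb (Suc n) (Suc k) * qfact (Suc k) * qfact (Suc n - Suc k) =
      (gb n k * qfact k * (qfact d * qn (Suc d))) * qn (Suc k) +
      [:0, 1:] ^ Suc k * qn (Suc d) * (gb n (Suc k) * (qfact k * qn (Suc k)) * qfact d)"
      using d by (simp add: qfact_Suc algebra_simps del: power_Suc)
    also have "\<dots> = qfact n * (qn (Suc k) + [:0, 1:] ^ Suc k * qn (Suc d))"
      unfolding 1 2 by (simp add: algebra_simps)
    also have "qn (Suc k) + [:0, 1:] ^ Suc k * qn (Suc d) = qn (Suc n)"
      by (simp add: qn_def d algebra_simps power_add)
    finally show ?thesis by (simp add: qfact_Suc)
  qed
qed auto

lemma gb_sym:
  assumes "k \<le> n"
  shows "gb n (n - k) = gb n k"
proof -
  have "gb n (n - k) * (qfact (n - k) * qfact k) = gb n k * (qfact (n - k) * qfact k)"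
    using gb_qfact[OF assms] gb_qfact[of "n - k" n] assms by (simp add: mult_ac)
  then show ?thesis by simp
qed

lemma gb_self [simp]: "gb n n = 1"
  using gb_sym[of 0 n] by simp

lemma gb_absorb: "qn (Suc k) * gb (Suc n) (Suc k) = qn (Suc n) * gb n k"
proof (cases "k \<le> n")
  case True
  have "qn (Suc k) * gb (Suc n) (Suc k) * (qfact k * qfact (n - k)) =
      qn (Suc n) * gb n k * (qfact k * qfact (n - k))"
    using gb_qfact[OF True] gb_qfact[of "Suc k" "Suc n"] True by (simp add: mult_ac qfact_Suc)
  then show ?thesis by simp
next
  case False
  then show ?thesis by (simp add: gb_eq_0)
qed

section \<open>Counting subspaces with prescribed intersections\<close>

context coord_space
begin

text \<open>Count the pairs \<open>(U, x)\<close> with \<open>x \<in> U - W\<close> in two ways.\<close>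

lemma card_subsp_fibre:
  assumes "subsp W" "subsp G'" "subsp G" "W \<subseteq> G'" "G' \<subseteq> G"
  shows "int (card {U. subsp U \<and> U \<subseteq> G \<and> U \<inter> G' = W \<and> dm U = dm W + s}) =
    poly (gb (dm G - dm G') s) (int q) * int q ^ (s * (dm G' - dm W))"
  using assms
proof (induction s arbitrary: W G')
  case 0
  have "{U. subsp U \<and> U \<subseteq> G \<and> U \<inter> G' = W \<and> dm U = dm W + 0} = {W}"
  proof -
    have "U = W" if "subsp U" "U \<inter> G' = W" "dm U = dm W" for U
      using subsp_dim_eq[of W U] that 0 by auto
    then show ?thesis using 0 by auto
  qed
  then show ?case by simp
next
  case (Suc s)
  define S where "S = {U. subsp U \<and> U \<subseteq> G \<and> U \<inter> G' = W \<and> dm U = dm W + Suc s}"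
  define w where "w = dm W"
  define g' where "g' = dm G'"
  define g where "g = dm G"
  have le: "w \<le> g'" "g' \<le> g" unfolding w_def g'_def g_def using Suc dim_mono by auto
  have finG: "finite G" using Suc finite_subsp by blast
  have finS: "finite S" by (rule finite_subset[of _ "Pow G"]) (auto simp: S_def finG)
  \<comment> \<open>With \<open>U\<close> fixed, the marked vector ranges over \<open>U - W\<close>,
    the part of \<open>U\<close> outside \<open>G'\<close>.\<close>
  have cU: "card (U - W) = q ^ (w + Suc s) - q ^ w" if "U \<in> S" for U
  proof -
    have "W \<subseteq> U" "subsp U" "dm U = w + Suc s" using that by (auto simp: S_def w_def)
    then show ?thesis using Suc(2) by (simp add: card_Diff_subset finite_subsp card_subsp w_def)
  qed
  have cx: "int (card {U \<in> S. x \<in> U}) =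
      poly (gb (g - Suc g') s) (int q) * int q ^ (s * (g' - w))" if x: "x \<in> G - G'" for x
  proof -
    have xV: "x \<in> V" and xW: "x \<notin> W" and xG: "x \<notin> G'" using x Suc subspD(5)[OF Suc(4)] by auto
    let ?W = "W \<squnion> line x" and ?G = "G' \<squnion> line x"
    have lx: "line x \<subseteq> A \<longleftrightarrow> x \<in> A" if "subsp A" for A
      using subspD(4)[OF that, of _ x] mem_line[OF xV] by (auto simp: line_def)
    \<comment> \<open>With \<open>x\<close> fixed, the modular law turns the condition
      \<open>U \<inter> G' = W\<close> into the same condition for \<open>?G\<close> and
      \<open>?W\<close>, both enlarged by the line of \<open>x\<close>. The dimension of
      \<open>U\<close> over \<open>?W\<close> is now \<open>s\<close>, so the induction hypothesis
      applies.\<close>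
    have "{U \<in> S. x \<in> U} = {U. subsp U \<and> U \<subseteq> G \<and> U \<inter> ?G = ?W \<and> dm U = dm ?W + s}"
    proof (intro Set.set_eqI iffI)
      fix U assume "U \<in> {U \<in> S. x \<in> U}"
      then have U: "subsp U" "U \<subseteq> G" "W = U \<inter> G'" "dm U = Suc (dm W + s)" "x \<in> U"
        by (auto simp: S_def)
      have "?G \<inter> U = (line x \<squnion> G') \<inter> U" using ssum_comm[OF Suc(3) subsp_line[OF xV]] by simp
      also have "\<dots> = line x \<squnion> (G' \<inter> U)"
        using modular_law[of "line x" U G'] U xV Suc lx by auto
      also have "\<dots> = ?W"
        using ssum_comm[OF subsp_line[OF xV] Suc(2)] U(3) by (simp add: Int_commute)
      finally show "U \<in> {U. subsp U \<and> U \<subseteq> G \<and> U \<inter> ?G = ?W \<and> dm U = dm ?W + s}"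
        using U dim_ssum_line[OF Suc(2) xV xW] by auto
    next
      fix U assume "U \<in> {U. subsp U \<and> U \<subseteq> G \<and> U \<inter> ?G = ?W \<and> dm U = dm ?W + s}"
      then have U: "subsp U" "U \<subseteq> G" "U \<inter> ?G = ?W" "dm U = dm ?W + s" by auto
      have WU: "W \<subseteq> U" "x \<in> U"
        using U(3) ssum_upper1[OF Suc(2) subsp_line[OF xV]]
          subsetD[OF ssum_upper2[OF Suc(2) subsp_line[OF xV]] mem_line[OF xV]] by auto
      have "U \<inter> G' = (U \<inter> ?G) \<inter> G'" using ssum_upper1[of G' "line x"] Suc(3) xV by auto
      also have "\<dots> = ?W \<inter> G'" using U(3) by simp
      also have "\<dots> = W \<squnion> (line x \<inter> G')" using modular_law[of W G' "line x"] Suc xV by simp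
      also have "line x \<inter> G' = {z}" using line_Int[OF Suc(3) xV xG] by auto
      also have "W \<squnion> {z} = W" using ssum_absorb[of W "{z}"] Suc subspD(2) by auto
      finally show "U \<in> {U \<in> S. x \<in> U}"
        using U WU dim_ssum_line[OF Suc(2) xV xW] by (simp add: S_def)
    qed
    moreover have "?W \<subseteq> ?G" using ssum_mono Suc by blast
    moreover have "?G \<subseteq> G" using ssum_least[of G G' "line x"] lx[of G] x Suc by auto
    ultimately show ?thesis
      using Suc.IH[of ?W ?G] Suc.prems xV dim_ssum_line[OF Suc(2) xV xW] dim_ssum_line[OF Suc(3) xV xG]
      by (simp add: g_def g'_def w_def)
  qed
  have UW: "U - W = {x \<in> G - G'. x \<in> U}" if "U \<in> S" for U using that by (auto simp: S_def)
  have "(\<Sum>U\<in>S. \<Sum>x | x \<in> G - G' \<and> x \<in> U. 1::nat) = (\<Sum>x\<in>G - G'. \<Sum>U | U \<in> S \<and> x \<in> U. 1)"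
    by (rule sum.swap_restrict) (use finS finG in auto)
  then have "(\<Sum>U\<in>S. card (U - W)) = (\<Sum>x\<in>G - G'. card {U \<in> S. x \<in> U})"
    using UW by simp
  then have "(\<Sum>U\<in>S. int (card (U - W))) = (\<Sum>x\<in>G - G'. int (card {U \<in> S. x \<in> U}))"
    by (simp flip: of_nat_sum)
  moreover have "card (G - G') = q ^ g - q ^ g'"
    using Suc by (simp add: card_Diff_subset finite_subsp card_subsp g_def g'_def)
  ultimately have main: "int (card S) * int (q ^ (w + Suc s) - q ^ w) =
     int (q ^ g - q ^ g') * (poly (gb (g - Suc g') s) (int q) * int q ^ (s * (g' - w)))"
    using cU cx by simp
  let ?q = "int q"
  have q1: "?q ^ Suc s > 1" using q_ge2 by (intro one_less_power) auto
  have qpos: "?q ^ w > 0" using q_ge2 by simp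
  have e1: "int (q ^ (w + Suc s) - q ^ w) = ?q ^ w * poly (qn (Suc s)) ?q"
    using q_ge2 by (simp add: qn_def of_nat_diff power_add algebra_simps power_increasing)
  obtain e where e: "g' = w + e" using le(1) le_Suc_ex by blast
  obtain d where d: "g = g' + d" using le(2) le_Suc_ex by blast
  have e2: "int (q ^ g - q ^ g') = ?q ^ w * ?q ^ e * poly (qn d) ?q"
    using q_ge2 by (simp add: qn_def of_nat_diff power_add algebra_simps power_increasing d e)
  have "int (card S) * (?q ^ w * poly (qn (Suc s)) ?q) =
     ?q ^ w * ?q ^ e * (poly (qn d) ?q * (poly (gb (d - 1) s) ?q * ?q ^ (s * e)))"
    using main unfolding e1 e2 by (simp add: d e)
  also have "poly (qn d) ?q * (poly (gb (d - 1) s) ?q * ?q ^ (s * e)) =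
     poly (qn (Suc s)) ?q * poly (gb d (Suc s)) ?q * ?q ^ (s * e)"
  \<comment> \<open>At \<open>d = 0\<close> the index \<open>d - 1\<close> is truncated, but both
    sides vanish: \<open>qn 0 = 0\<close> and \<open>gb 0 (Suc s) = 0\<close>.\<close>
  proof (cases d)
    case 0
    then show ?thesis by (simp add: qn_def)
  next
    case (Suc d')
    then show ?thesis using arg_cong[OF gb_absorb[of s d'], of "\<lambda>p. poly p ?q"] by simp
  qed
  finally have "(int (card S) - poly (gb d (Suc s)) ?q * ?q ^ (Suc s * e)) * (?q ^ w * poly (qn (Suc s)) ?q) = 0"
    by (simp add: algebra_simps power_add)
  moreover have "poly (qn (Suc s)) ?q \<noteq> 0" using q1 by (simp add: qn_def)
  ultimately have "int (card S) = poly (gb d (Suc s)) ?q * ?q ^ (Suc s * e)" using qpos q_ge2 by auto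
  then show ?case unfolding S_def[symmetric] using d e by (simp add: g_def g'_def w_def)
qed

text \<open>Intersecting with \<open>G k\<close> maps the subspaces for the chain up to
  \<open>k + 1\<close> to those for the chain up to \<open>k\<close>, and all fibres have the size
  given by \<open>card_subsp_fibre\<close>. The truncated difference
  \<open>dm (G j) - \<epsilon> j\<close> is harmless: if \<open>\<epsilon> j\<close> exceeds
  \<open>dm (G j)\<close>, an earlier binomial is already 0.\<close>

lemma card_subsp_chain:
  fixes G :: "nat \<Rightarrow> nat list set" and \<epsilon> :: "nat \<Rightarrow> nat"
  assumes "\<And>j. j \<le> k \<Longrightarrow> subsp (G j)" "\<And>j. j < k \<Longrightarrow> G j \<subseteq> G (Suc j)"
    and "\<epsilon> 0 = dm (G 0)" "\<And>j. j < k \<Longrightarrow> \<epsilon> j \<le> \<epsilon> (Suc j)"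
  shows "int (card {U. subsp U \<and> G 0 \<subseteq> U \<and> U \<subseteq> G k \<and> (\<forall>j\<le>k. dm (U \<inter> G j) = \<epsilon> j)}) =
    (\<Prod>j<k. poly (gb (dm (G (Suc j)) - dm (G j)) (\<epsilon> (Suc j) - \<epsilon> j)) (int q) *
       int q ^ ((\<epsilon> (Suc j) - \<epsilon> j) * (dm (G j) - \<epsilon> j)))"
  using assms
proof (induction k)
  case 0
  have "{U. subsp U \<and> G 0 \<subseteq> U \<and> U \<subseteq> G 0 \<and> (\<forall>j\<le>0. dm (U \<inter> G j) = \<epsilon> j)} = {G 0}"
    using 0 by auto
  then show ?case by simp
next
  case (Suc k)
  define S where "S k = {U. subsp U \<and> G 0 \<subseteq> U \<and> U \<subseteq> G k \<and> (\<forall>j\<le>k. dm (U \<inter> G j) = \<epsilon> j)}" for k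
  have mono: "i \<le> j \<Longrightarrow> j \<le> Suc k \<Longrightarrow> G i \<subseteq> G j" for i j
    by (induction rule: dec_induct) (use Suc.prems(2) in \<open>simp_all add: subset_iff Suc_le_eq\<close>)
  let ?c = "poly (gb (dm (G (Suc k)) - dm (G k)) (\<epsilon> (Suc k) - \<epsilon> k)) (int q) *
       int q ^ ((\<epsilon> (Suc k) - \<epsilon> k) * (dm (G k) - \<epsilon> k))"
  have sG: "subsp (G k)" "subsp (G (Suc k))" "subsp (G 0)" using Suc.prems(1) by auto
  have finS: "finite (S i)" if "i \<le> Suc k" for i
    by (rule finite_subset[of _ "Pow (G i)"]) (use Suc.prems(1)[OF that] finite_subsp in \<open>auto simp: S_def\<close>)
  have im: "(\<lambda>U. U \<inter> G k) ` S (Suc k) \<subseteq> S k"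
  proof (rule image_subsetI)
    fix U assume U: "U \<in> S (Suc k)"
    have "U \<inter> G k \<inter> G j = U \<inter> G j" if "j \<le> k" for j using mono[of j k] that by auto
    then show "U \<inter> G k \<in> S k" using U sG mono[of 0 k] by (auto simp: S_def)
  qed
  have fib: "int (card {U \<in> S (Suc k). U \<inter> G k = W}) = ?c" if W: "W \<in> S k" for W
  proof -
    have w: "subsp W" "G 0 \<subseteq> W" "W \<subseteq> G k" "dm W = \<epsilon> k" using W by (auto simp: S_def Int_absorb2)
    have "{U \<in> S (Suc k). U \<inter> G k = W} =
      {U. subsp U \<and> U \<subseteq> G (Suc k) \<and> U \<inter> G k = W \<and> dm U = dm W + (\<epsilon> (Suc k) - \<epsilon> k)}"
    proof (intro Set.set_eqI iffI)
      fix U assume "U \<in> {U \<in> S (Suc k). U \<inter> G k = W}"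
      then have U: "subsp U" "U \<subseteq> G (Suc k)" "U \<inter> G k = W" "dm (U \<inter> G (Suc k)) = \<epsilon> (Suc k)"
        by (auto simp: S_def)
      then show "U \<in> {U. subsp U \<and> U \<subseteq> G (Suc k) \<and> U \<inter> G k = W \<and> dm U = dm W + (\<epsilon> (Suc k) - \<epsilon> k)}"
        using w Suc.prems(4)[of k] by (simp add: Int_absorb2)
    next
      fix U assume "U \<in> {U. subsp U \<and> U \<subseteq> G (Suc k) \<and> U \<inter> G k = W \<and> dm U = dm W + (\<epsilon> (Suc k) - \<epsilon> k)}"
      then have U: "subsp U" "U \<subseteq> G (Suc k)" "U \<inter> G k = W" "dm U = \<epsilon> (Suc k)"
        using w Suc.prems(4)[of k] by auto
      have "dm (U \<inter> G j) = \<epsilon> j" if j: "j \<le> k" for j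
      proof -
        have "U \<inter> G j = W \<inter> G j" using U(3) mono[of j k] j by auto
        then show ?thesis using W j by (simp add: S_def)
      qed
      then have "\<forall>j\<le>Suc k. dm (U \<inter> G j) = \<epsilon> j" using U by (auto simp: le_Suc_eq Int_absorb2)
      then show "U \<in> {U \<in> S (Suc k). U \<inter> G k = W}" using U w by (auto simp: S_def)
    qed
    then show ?thesis
      using card_subsp_fibre[OF w(1) sG(1,2) w(3), of "\<epsilon> (Suc k) - \<epsilon> k"] mono[of k "Suc k"] w(4) by simp
  qed
  have "card (S (Suc k)) = (\<Sum>W\<in>S k. card {U \<in> S (Suc k). U \<inter> G k = W})"
    using sum.group[OF finS finS im, of "\<lambda>_. 1::nat"] by simp
  then have "int (card (S (Suc k))) = int (card (S k)) * ?c" using fib by (simp add: of_nat_sum)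
  then show ?case using Suc.IH Suc.prems unfolding S_def by simp
qed

text \<open>Reduce to a chain from \<open>P\<close> to \<open>Q\<close> via \<open>G j = P + Q \<inter> F j\<close>.\<close>

lemma card_subsp_between:
  fixes F :: "nat \<Rightarrow> nat list set" and \<delta> :: "nat \<Rightarrow> int"
  assumes sub: "subsp P" "subsp Q" "P \<subseteq> Q"
    and F: "\<And>j. j \<le> N \<Longrightarrow> subsp (F j)" "\<And>j. j < N \<Longrightarrow> F j \<subseteq> F (Suc j)" "F 0 = {z}" "F N = V"
    and "\<delta> 0 = 0"
  defines "p \<equiv> \<lambda>j. int (dm (P \<inter> F j))" and "qq \<equiv> \<lambda>j. int (dm (Q \<inter> F j))"
  defines "g \<equiv> \<lambda>j. (qq (Suc j) - p (Suc j)) - (qq j - p j)"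
    and "s \<equiv> \<lambda>j. (\<delta> (Suc j) - p (Suc j)) - (\<delta> j - p j)"
  shows "int (card {U. subsp U \<and> P \<subseteq> U \<and> U \<subseteq> Q \<and> (\<forall>j\<le>N. int (dm (U \<inter> F j)) = \<delta> j)}) =
    (if \<forall>j<N. s j \<ge> 0 then
      (\<Prod>j<N. poly (gb (nat (g j)) (nat (s j))) (int q) * int q ^ nat (s j * (qq j - \<delta> j))) else 0)"
proof -
  define G where "G j = P \<squnion> (Q \<inter> F j)" for j
  have sF: "F j \<subseteq> V" "z \<in> F j" if "j \<le> N" for j using F(1)[OF that] subspD by auto
  have sG: "subsp (G j)" if "j \<le> N" for j unfolding G_def using sub F that by simp
  have Gmono: "G j \<subseteq> G (Suc j)" if "j < N" for j
    unfolding G_def using F(2)[OF that] by (intro ssum_mono) auto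
  have Q0: "Q \<inter> F 0 = {z}" "P \<inter> F 0 = {z}" using F(3) subspD(2)[OF sub(1)] subspD(2)[OF sub(2)] by auto
  have G0: "G 0 = P" unfolding G_def Q0 using ssum_absorb[of P "{z}"] sub subspD(2) by auto
  have GN: "G N = Q" unfolding G_def F(4)
    using ssum_absorb[of Q P] ssum_comm[of P Q] sub subspD(1)[OF sub(2)] by (simp add: Int_absorb2)
  \<comment> \<open>By the modular law \<open>U \<inter> G j\<close> is the sum of \<open>P\<close>
    and \<open>U \<inter> F j\<close>. Prescribing the dimensions of \<open>U \<inter> F j\<close>
    is thus the same as prescribing those of \<open>U \<inter> G j\<close>.\<close>
  have UG: "int (dm (U \<inter> G j)) = int (dm P) + int (dm (U \<inter> F j)) - p j"
    if "subsp U" "P \<subseteq> U" "U \<subseteq> Q" "j \<le> N" for U j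
  proof -
    have "U \<inter> G j = P \<squnion> (Q \<inter> F j \<inter> U)"
      using modular_law[OF sub(1) that(1), of "Q \<inter> F j"] sub F(1)[OF that(4)] that unfolding G_def by auto
    also have "Q \<inter> F j \<inter> U = U \<inter> F j" using that by auto
    finally have "U \<inter> G j = P \<squnion> (U \<inter> F j)" .
    moreover have "P \<inter> (U \<inter> F j) = P \<inter> F j" using that by auto
    ultimately show ?thesis using dim_ssum[OF sub(1) subsp_Int[OF that(1) F(1)[OF that(4)]]]
      by (simp add: p_def)
  qed
  have dG: "int (dm (G j)) = int (dm P) + qq j - p j" if "j \<le> N" for j
  proof -
    have "G j \<subseteq> Q" using ssum_least sub by (auto simp: G_def)
    then show ?thesis using UG[OF sub(2,3) _ that] by (simp add: qq_def Int_absorb1)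
  qed
  define S where "S = {U. subsp U \<and> P \<subseteq> U \<and> U \<subseteq> Q \<and> (\<forall>j\<le>N. int (dm (U \<inter> F j)) = \<delta> j)}"
  show ?thesis
  proof (cases "\<forall>j<N. s j \<ge> 0")
    \<comment> \<open>For an admissible \<open>U\<close> the number \<open>s j\<close> is the
      increment of \<open>dm (U \<inter> G j)\<close>, so a negative \<open>s j\<close> leaves no
      \<open>U\<close>.\<close>
    case False
    have "s j \<ge> 0" if U: "U \<in> S" and j: "j < N" for U j
    proof -
      have "dm (U \<inter> G j) \<le> dm (U \<inter> G (Suc j))"
        using U sG j Gmono[OF j] by (intro dim_mono) (auto simp: S_def)
      then show ?thesis using UG[of U j] UG[of U "Suc j"] U j by (auto simp: S_def s_def)
    qed
    then have "S = {}" using False by blast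
    then show ?thesis using False unfolding S_def[symmetric] by auto
  next
    case True
    define e where "e j = int (dm P) + \<delta> j - p j" for j
    have e0: "e 0 = int (dm P)" using assms(8) Q0 by (simp add: e_def p_def)
    have emono: "e j \<le> e (Suc j)" if "j < N" for j using True that by (simp add: e_def s_def)
    have epos: "j \<le> N \<Longrightarrow> e j \<ge> 0" for j
      by (induction j) (use e0 emono in \<open>auto intro: order_trans simp: Suc_le_eq\<close>)
    have "S = {U. subsp U \<and> G 0 \<subseteq> U \<and> U \<subseteq> G N \<and> (\<forall>j\<le>N. dm (U \<inter> G j) = nat (e j))}"
    proof (intro Set.set_eqI iffI)
      fix U assume "U \<in> S"
      then have U: "subsp U" "P \<subseteq> U" "U \<subseteq> Q" "\<forall>j\<le>N. int (dm (U \<inter> F j)) = \<delta> j"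
        by (simp_all add: S_def)
      have "dm (U \<inter> G j) = nat (e j)" if "j \<le> N" for j
        using UG[OF U(1-3) that] U(4) that unfolding e_def by (metis nat_int)
      then show "U \<in> {U. subsp U \<and> G 0 \<subseteq> U \<and> U \<subseteq> G N \<and> (\<forall>j\<le>N. dm (U \<inter> G j) = nat (e j))}"
        using G0 GN U by auto
    next
      fix U assume "U \<in> {U. subsp U \<and> G 0 \<subseteq> U \<and> U \<subseteq> G N \<and> (\<forall>j\<le>N. dm (U \<inter> G j) = nat (e j))}"
      then have U: "subsp U" "P \<subseteq> U" "U \<subseteq> Q" "\<forall>j\<le>N. dm (U \<inter> G j) = nat (e j)"
        by (simp_all add: G0 GN)
      have "int (dm (U \<inter> F j)) = \<delta> j" if "j \<le> N" for j
        using U(4) UG[OF U(1-3) that] epos[OF that] that by (simp add: e_def)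
      then show "U \<in> S" using U by (simp add: S_def)
    qed
    moreover have "nat (e 0) = dm (G 0)" using e0 G0 by simp
    moreover have "nat (e j) \<le> nat (e (Suc j))" if "j < N" for j using emono[OF that] by simp
    ultimately have "int (card S) = (\<Prod>j<N. poly (gb (dm (G (Suc j)) - dm (G j)) (nat (e (Suc j)) - nat (e j))) (int q) *
       int q ^ ((nat (e (Suc j)) - nat (e j)) * (dm (G j) - nat (e j))))"
      using card_subsp_chain[of N G "\<lambda>j. nat (e j)"] sG Gmono by simp
    also have "\<dots> = (\<Prod>j<N. poly (gb (nat (g j)) (nat (s j))) (int q) * int q ^ nat (s j * (qq j - \<delta> j)))"
    proof (rule prod.cong[OF refl])
      fix j assume "j \<in> {..<N}"
      then have j: "j < N" "j \<le> N" "Suc j \<le> N" by auto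
      have 1: "dm (G (Suc j)) - dm (G j) = nat (g j)"
        using dG[OF j(2)] dG[OF j(3)] by (simp add: g_def)
      have 2: "nat (e (Suc j)) - nat (e j) = nat (s j)"
        using epos[OF j(2)] epos[OF j(3)] by (simp add: e_def s_def)
      have 3: "dm (G j) - nat (e j) = nat (qq j - \<delta> j)"
        using dG[OF j(2)] epos[OF j(2)] by (simp add: e_def)
      show "poly (gb (dm (G (Suc j)) - dm (G j)) (nat (e (Suc j)) - nat (e j))) (int q) *
       int q ^ ((nat (e (Suc j)) - nat (e j)) * (dm (G j) - nat (e j))) =
       poly (gb (nat (g j)) (nat (s j))) (int q) * int q ^ nat (s j * (qq j - \<delta> j))"
        unfolding 1 2 3 using True j(1) by (simp add: nat_mult_distrib)
    qed
    finally show ?thesis using True unfolding S_def[symmetric] by auto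
  qed
qed

end

section \<open>Relative position of flags\<close>

text \<open>For the type of a pair of flags this is the dimension of
  \<open>V_i \<inter> V'_j\<close> (\<open>cum_ftype\<close>). Orbits are compared through
  \<open>cum\<close>, and \<open>cum_entry\<close> recovers the matrix as a mixed second
  difference.\<close>

definition cum :: "int \<Rightarrow> mat \<Rightarrow> int \<Rightarrow> int \<Rightarrow> int" where
  "cum m A i j = (\<Sum>k\<in>{m..i}. \<Sum>l\<in>{m..j}. A k l)"

lemma sum_int_last:
  fixes h :: "int \<Rightarrow> 'a :: ab_group_add"
  assumes "m \<le> i"
  shows "sum h {m..i} = sum h {m..i - 1} + h i"
proof -
  have "{m..i} = insert i {m..i - 1}" using assms by auto
  then show ?thesis by (simp add: add.commute)
qed

lemma sum_int_telescope:
  fixes h :: "int \<Rightarrow> int"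
  assumes "m - 1 \<le> i"
  shows "(\<Sum>k\<in>{m..i}. h k - h (k - 1)) = h i - h (m - 1)"
  using assms
proof (induction rule: int_ge_induct)
  case (step i)
  then show ?case using sum_int_last[of m "i + 1" "\<lambda>k. h k - h (k - 1)"] by simp
qed simp

lemma cum_empty [simp]: "cum m A (m - 1) j = 0" "cum m A i (m - 1) = 0"
  by (simp_all add: cum_def)

lemma cum_row_step: "m \<le> i \<Longrightarrow> cum m A i j = cum m A (i - 1) j + (\<Sum>l\<in>{m..j}. A i l)"
  by (simp add: cum_def sum_int_last)

lemma cum_entry:
  assumes "m \<le> i" "m \<le> j"
  shows "A i j = cum m A i j - cum m A (i - 1) j - cum m A i (j - 1) + cum m A (i - 1) (j - 1)"
  using assms by (simp add: cum_row_step sum_int_last)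

definition elem :: "int \<Rightarrow> int \<Rightarrow> int \<Rightarrow> (int \<Rightarrow> int) \<Rightarrow> mat" where
  "elem x y t e = (\<lambda>i j. (if i = j then e i else 0) + (if i = x \<and> j = y then t else 0))"

lemma sum_int_delta:
  fixes i :: int
  shows "(\<Sum>l\<in>{m..j}. if i = l then c else 0) = (if m \<le> i \<and> i \<le> j then c else (0::int))"
  by (auto simp: sum.delta')

lemma cum_elem:
  assumes "m \<le> x" "m \<le> y"
  shows "cum m (elem x y t e) i j = (\<Sum>k\<in>{m..min i j}. e k) + (if x \<le> i \<and> y \<le> j then t else 0)"
proof -
  have row: "(\<Sum>l\<in>{m..j}. elem x y t e k l) =
    (if k \<le> j then e k else 0) + (if x = k then (if y \<le> j then t else 0) else 0)" if "m \<le> k" for k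
  proof -
    have "(\<Sum>l\<in>{m..j}. elem x y t e k l) =
      (\<Sum>l\<in>{m..j}. if k = l then e k else 0) + (\<Sum>l\<in>{m..j}. if y = l then (if x = k then t else 0) else 0)"
      unfolding sum.distrib[symmetric] by (rule sum.cong) (auto simp: elem_def)
    then show ?thesis using that assms unfolding sum_int_delta by auto
  qed
  have "cum m (elem x y t e) i j =
    (\<Sum>k\<in>{m..i}. if k \<le> j then e k else 0) + (\<Sum>k\<in>{m..i}. if x = k then (if y \<le> j then t else 0) else 0)"
    unfolding cum_def sum.distrib[symmetric] using row by (intro sum.cong) auto
  also have "(\<Sum>k\<in>{m..i}. if k \<le> j then e k else 0) = (\<Sum>k\<in>{m..i} \<inter> {k. k \<le> j}. e k)"
    by (simp add: sum.inter_restrict)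
  also have "{m..i} \<inter> {k. k \<le> j} = {m..min i j}" by auto
  finally show ?thesis unfolding sum_int_delta using assms by auto
qed

context coord_space
begin

definition pos :: "int \<Rightarrow> (int \<Rightarrow> nat list set) \<Rightarrow> (int \<Rightarrow> nat list set) \<Rightarrow> int \<Rightarrow> int \<Rightarrow> int" where
  "pos m f f' i j = int (dm (flagat R r m f i \<inter> flagat R r m f' j))"

lemma flagat_eq [simp]: "m \<le> i \<Longrightarrow> flagat R r m f i = f i"
  by (simp add: flagat_def)

lemma flagat_bot [simp]: "flagat R r m f (m - 1) = {z}"
  by (simp add: flagat_def)

lemma subsp_flagat:
  assumes "is_flag R r m n f" "m - 1 \<le> i" "i \<le> n"
  shows "subsp (flagat R r m f i)"
  using assms by (auto simp: flagat_def is_flag_def)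

lemma flagat_mono:
  assumes "is_flag R r m n f" "m - 1 \<le> i" "i \<le> j" "j \<le> n"
  shows "flagat R r m f i \<subseteq> flagat R r m f j"
  using assms(3,4)
proof (induction rule: int_ge_induct)
  case (step j)
  have "flagat R r m f j \<subseteq> flagat R r m f (j + 1)"
  proof (cases "j = m - 1")
    case True
    then have "j + 1 = m" by simp
    then show ?thesis using True subspD(2) subsp_flagat[OF assms(1), of "j + 1"] step assms by simp
  next
    case False
    then show ?thesis using assms step by (auto simp: is_flag_def)
  qed
  then show ?case using step by auto
qed simp

lemma flag_top: "is_flag R r m n f \<Longrightarrow> f n = V"
  by (simp add: is_flag_def)

lemma finite_flags: "finite {f. is_flag R r m n f}"
proof -
  have "{f. is_flag R r m n f} \<subseteq>
    {f. \<forall>i. (i \<in> {m..n} \<longrightarrow> f i \<in> Pow V) \<and> (i \<notin> {m..n} \<longrightarrow> f i = {})}"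
    unfolding is_flag_def subspace_def by blast
  moreover have "finite \<dots>" by (rule finite_set_of_finite_funs) auto
  ultimately show ?thesis by (rule finite_subset)
qed

context
  fixes m n f f'
  assumes mn: "m \<le> n" and fl: "is_flag R r m n f" "is_flag R r m n f'"
begin

lemma pos_bot [simp]: "m - 1 \<le> j \<Longrightarrow> j \<le> n \<Longrightarrow> pos m f f' (m - 1) j = 0"
  "m - 1 \<le> i \<Longrightarrow> i \<le> n \<Longrightarrow> pos m f f' i (m - 1) = 0"
  using subspD(2)[OF subsp_flagat[OF fl(2)]] subspD(2)[OF subsp_flagat[OF fl(1)]]
  by (auto simp: pos_def Int_absorb1 Int_absorb2)

lemma pos_top:
  assumes "m - 1 \<le> i" "i \<le> n"
  shows "pos m f f' i n = int (dm (flagat R r m f i))" "pos m f f' n i = int (dm (flagat R r m f' i))"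
  using subspD(1)[OF subsp_flagat[OF fl(1) assms]] subspD(1)[OF subsp_flagat[OF fl(2) assms]] mn
    flag_top[OF fl(1)] flag_top[OF fl(2)]
  by (auto simp: pos_def Int_absorb1 Int_absorb2)

text \<open>Since \<open>V_(i-1)\<close> lies in \<open>V_i\<close>, it meets
  \<open>V_i \<inter> V'_j\<close> in \<open>V_(i-1) \<inter> V'_j\<close>. The dimension formula
  therefore replaces the sums in \<open>ftype\<close> by intersections of members of the two
  flags.\<close>

lemma ftype_pos:
  assumes "i \<in> {m..n}" "j \<in> {m..n}"
  shows "ftype R r m n f f' i j =
    pos m f f' i j - pos m f f' (i - 1) j - pos m f f' i (j - 1) + pos m f f' (i - 1) (j - 1)"
proof -
  have "int (dm (flagat R r m f (i - 1) \<squnion> (f i \<inter> flagat R r m f' j))) =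
    int (dm (flagat R r m f (i - 1))) + pos m f f' i j - pos m f f' (i - 1) j"
    if "m - 1 \<le> j" "j \<le> n" for j
  proof -
    have s: "subsp (flagat R r m f (i - 1))" "subsp (flagat R r m f i)" "subsp (flagat R r m f' j)"
      using assms that subsp_flagat[OF fl(1)] subsp_flagat[OF fl(2)] by (auto simp del: flagat_eq)
    have "flagat R r m f (i - 1) \<subseteq> f i" using flagat_mono[OF fl(1), of "i - 1" i] assms by simp
    then have "flagat R r m f (i - 1) \<inter> (f i \<inter> flagat R r m f' j) = flagat R r m f (i - 1) \<inter> flagat R r m f' j"
      by auto
    then show ?thesis using dim_ssum[OF s(1) subsp_Int[OF s(2,3)]] assms by (simp add: pos_def)
  qed
  from this[of j] this[of "j - 1"] show ?thesis using assms by (simp add: ftype_def)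
qed

lemma ftype_nonneg: "ftype R r m n f f' i j \<ge> 0"
proof (cases "i \<in> {m..n} \<and> j \<in> {m..n}")
  case True
  have s: "subsp (flagat R r m f (i - 1))" "subsp (flagat R r m f i)" "subsp (flagat R r m f' j)"
      "subsp (flagat R r m f' (j - 1))"
    using True subsp_flagat[OF fl(1)] subsp_flagat[OF fl(2)] by (auto simp del: flagat_eq)
  have "flagat R r m f' (j - 1) \<subseteq> flagat R r m f' j" using flagat_mono[OF fl(2), of "j - 1" j] True by simp
  then have "dm (flagat R r m f (i - 1) \<squnion> (flagat R r m f i \<inter> flagat R r m f' (j - 1))) \<le>
    dm (flagat R r m f (i - 1) \<squnion> (flagat R r m f i \<inter> flagat R r m f' j))"
    using s by (intro dim_mono ssum_mono) auto
  then show ?thesis using True by (simp add: ftype_def)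
qed (auto simp: ftype_def)

lemma cum_ftype:
  assumes "m - 1 \<le> i" "i \<le> n" "m - 1 \<le> j" "j \<le> n"
  shows "cum m (ftype R r m n f f') i j = pos m f f' i j"
proof -
  have row: "(\<Sum>l\<in>{m..j}. ftype R r m n f f' k l) = pos m f f' k j - pos m f f' (k - 1) j" if "k \<in> {m..i}" for k
  proof -
    have "(\<Sum>l\<in>{m..j}. ftype R r m n f f' k l) =
      (\<Sum>l\<in>{m..j}. (pos m f f' k l - pos m f f' (k - 1) l) - (pos m f f' k (l - 1) - pos m f f' (k - 1) (l - 1)))"
      using that assms by (intro sum.cong) (auto simp: ftype_pos)
    also have "\<dots> = (pos m f f' k j - pos m f f' (k - 1) j) - (pos m f f' k (m - 1) - pos m f f' (k - 1) (m - 1))"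
      using assms(3) by (rule sum_int_telescope[where h = "\<lambda>l. pos m f f' k l - pos m f f' (k - 1) l"])
    finally show ?thesis using that assms by simp
  qed
  have "cum m (ftype R r m n f f') i j = (\<Sum>k\<in>{m..i}. pos m f f' k j - pos m f f' (k - 1) j)"
    unfolding cum_def using row by simp
  also have "\<dots> = pos m f f' i j - pos m f f' (m - 1) j" using assms by (intro sum_int_telescope)
  finally show ?thesis using assms by simp
qed

text \<open>Both families of numbers vanish in row and column \<open>m - 1\<close>, so agreement on
  \<open>{m..n}\<close> already determines all mixed second differences.\<close>

lemma ftype_eq_iff:
  assumes "\<And>i j. i \<notin> {m..n} \<or> j \<notin> {m..n} \<Longrightarrow> A i j = 0"
  shows "ftype R r m n f f' = A \<longleftrightarrow> (\<forall>i\<in>{m..n}. \<forall>j\<in>{m..n}. pos m f f' i j = cum m A i j)"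
proof
  assume "ftype R r m n f f' = A"
  then show "\<forall>i\<in>{m..n}. \<forall>j\<in>{m..n}. pos m f f' i j = cum m A i j" using cum_ftype by auto
next
  assume *: "\<forall>i\<in>{m..n}. \<forall>j\<in>{m..n}. pos m f f' i j = cum m A i j"
  have eq: "pos m f f' i j = cum m A i j" if "m - 1 \<le> i" "i \<le> n" "m - 1 \<le> j" "j \<le> n" for i j
    using * that by (cases "i = m - 1"; cases "j = m - 1") auto
  have "ftype R r m n f f' i j = A i j" for i j
  proof (cases "i \<in> {m..n} \<and> j \<in> {m..n}")
    case True
    then show ?thesis using cum_entry[of m i j A] eq by (simp add: ftype_pos)
  next
    case False
    then show ?thesis using assms[of i j] by (auto simp: ftype_def)
  qed
  then show "ftype R r m n f f' = A" by blast
qed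

end

end

section \<open>Counting flags next to an elementary orbit\<close>

text \<open>The column \<open>j\<close> lies beyond \<open>u\<close>, seen from the row \<open>x\<close> towards the neighbouring row \<open>y\<close>.\<close>

definition bef :: "int \<Rightarrow> int \<Rightarrow> int \<Rightarrow> int \<Rightarrow> bool" where
  "bef x y u j \<longleftrightarrow> (if x < y then u < j else j < u)"

context coord_space
begin

context
  fixes m n x y t e f1
  assumes xy: "x \<in> {m..n}" "y \<in> {m..n}" "y = x + 1 \<or> x = y + 1"
    and e0: "\<And>i. i \<notin> {m..n} \<Longrightarrow> e i = 0"
    and f1: "is_flag R r m n f1"
    and dims: "\<And>i. i \<in> {m..n} \<Longrightarrow> int (dm (f1 i)) = cum m (elem x y t e) i n"
begin

text \<open>Away from \<open>min x y\<close> the prescribed intersection has the dimension of both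
  members, which forces them to coincide. At \<open>min x y\<close> one inclusion remains: for
  \<open>y = x + 1\<close> the space \<open>f x\<close> lies in \<open>f1 x\<close> with quotient of
  dimension \<open>t\<close>, and for \<open>x = y + 1\<close> the space \<open>f y\<close> contains
  \<open>f1 y\<close> with quotient of dimension \<open>t\<close>. In both cases the free member
  lies between the members \<open>x - 1\<close> and \<open>x\<close> of \<open>f1\<close>.\<close>

lemma ftype_elem_iff:
  assumes f: "is_flag R r m n f"
  shows "ftype R r m n f1 f = elem x y t e \<longleftrightarrow>
    (\<forall>i\<in>{m..n}. i \<noteq> min x y \<longrightarrow> f i = f1 i) \<and> flagat R r m f1 (x - 1) \<subseteq> f (min x y) \<and>
    f (min x y) \<subseteq> f1 x \<and> int (dm (f (min x y))) = cum m (elem x y t e) n (min x y)"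
    (is "_ \<longleftrightarrow> ?R")
proof -
  let ?h = "min x y" and ?c = "cum m (elem x y t e)"
  have mn: "m \<le> n" using xy by auto
  have h: "m \<le> ?h" "?h \<le> n" "?h < n" "x \<le> n" "m \<le> x" "m \<le> y" using xy by auto
  have c: "?c i j = (\<Sum>k\<in>{m..min i j}. e k) + (if x \<le> i \<and> y \<le> j then t else 0)" for i j
    by (rule cum_elem) (use xy in auto)
  have sub1: "subsp (f1 i)" and subf: "subsp (f i)" if "i \<in> {m..n}" for i
    using f1 f that by (auto simp: is_flag_def)
  have supp: "elem x y t e i j = 0" if "i \<notin> {m..n} \<or> j \<notin> {m..n}" for i j
    using that e0 xy by (auto simp: elem_def)
  note iff = ftype_eq_iff[OF mn f1 f, of "elem x y t e", OF supp]
  have posE: "pos m f1 f i j = int (dm (f1 i \<inter> f j))" if "i \<in> {m..n}" "j \<in> {m..n}" for i j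
    using that by (simp add: pos_def)
  have mono1: "f1 i \<subseteq> f1 j" and monof: "f i \<subseteq> f j" if "m \<le> i" "i \<le> j" "j \<le> n" for i j
    using flagat_mono[OF f1, of i j] flagat_mono[OF f, of i j] that by auto
  show ?thesis
  proof
    assume "ftype R r m n f1 f = elem x y t e"
    then have P: "int (dm (f1 i \<inter> f j)) = ?c i j" if "i \<in> {m..n}" "j \<in> {m..n}" for i j
      using iff posE that by auto
    have fn: "f n = V" "f1 n = V" using f f1 by (auto simp: is_flag_def)
    have df: "int (dm (f i)) = ?c n i" if "i \<in> {m..n}" for i
      using P[of n i] that mn fn subspD(1)[OF subf[OF that]] by (simp add: Int_absorb1)
    have d1: "int (dm (f1 i)) = ?c i n" if "i \<in> {m..n}" for i using dims that by blast
    have le1: "f1 i \<subseteq> f i" if i: "i \<in> {m..n}" and eq: "?c i i = ?c i n" for i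
    proof -
      have "dm (f1 i \<inter> f i) = dm (f1 i)" using P[OF i i] d1[OF i] eq by simp
      then have "f1 i \<inter> f i = f1 i" using sub1[OF i] subf[OF i] by (intro subsp_dim_eq) auto
      then show ?thesis by blast
    qed
    have le2: "f i \<subseteq> f1 i" if i: "i \<in> {m..n}" and eq: "?c i i = ?c n i" for i
    proof -
      have "dm (f1 i \<inter> f i) = dm (f i)" using P[OF i i] df[OF i] eq by simp
      then have "f1 i \<inter> f i = f i" using sub1[OF i] subf[OF i] by (intro subsp_dim_eq) auto
      then show ?thesis by blast
    qed
    have eqf: "f i = f1 i" if "i \<in> {m..n}" "i \<noteq> ?h" for i
    proof -
      have "x \<le> i \<longleftrightarrow> y \<le> i" using that xy by auto
      moreover have "i \<le> n" using that by auto
      ultimately show ?thesis using le1[OF that(1)] le2[OF that(1)] by (auto simp: c min_def)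
    qed
    have "flagat R r m f1 (x - 1) \<subseteq> f ?h \<and> f ?h \<subseteq> f1 x"
    proof (cases "x < y")
      case True
      then have hx: "?h = x" "y = x + 1" using xy by auto
      have "?c x x = ?c n x" unfolding c using hx xy by (auto simp: min_def)
      then have 1: "f x \<subseteq> f1 x" using le2[of x] xy by blast
      have "flagat R r m f1 (x - 1) \<subseteq> f x"
      proof (cases "x = m")
        case True
        then show ?thesis using subspD(2)[OF subf[OF xy(1)]] by simp
      next
        case False
        then have "f1 (x - 1) = f (x - 1)" using eqf[of "x - 1"] h hx by simp
        then show ?thesis using False h monof[of "x - 1" x] by simp
      qed
      then show ?thesis using 1 hx by simp
    next
      case False
      then have hx: "?h = y" "x = y + 1" using xy by auto
      have "?c y y = ?c y n" unfolding c using hx xy by (auto simp: min_def)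
      then have 1: "f1 y \<subseteq> f y" using le1[of y] xy by blast
      have "f y \<subseteq> f x" using monof[of y x] hx h by simp
      then show ?thesis using 1 hx eqf[of x] xy by simp
    qed
    then show ?R using eqf df[of ?h] h by auto
  next
    assume R: ?R
    have "int (dm (f1 i \<inter> f j)) = ?c i j" if i: "i \<in> {m..n}" and j: "j \<in> {m..n}" for i j
    proof (cases "j = ?h")
      case False
      then have "f j = f1 j" using R j by auto
      then have "f1 i \<inter> f j = f1 (min i j)"
        using mono1[of i j] mono1[of j i] i j by (auto simp: min_def)
      moreover have "min i j \<in> {m..n}" using i j by auto
      ultimately have "int (dm (f1 i \<inter> f j)) = ?c (min i j) n" using dims by simp
      then show ?thesis using False i j xy by (auto simp: c min_def)
    next
      case jh: True
      have Q: "flagat R r m f1 (x - 1) \<subseteq> f ?h" "f ?h \<subseteq> f1 x" "int (dm (f ?h)) = ?c n ?h"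
        using R by auto
      show ?thesis
      proof (cases "x \<le> i")
        case True
        then have "f1 x \<subseteq> f1 i" using mono1[of x i] h i by simp
        then have "f1 i \<inter> f j = f ?h" using Q jh by auto
        then show ?thesis using Q(3) True jh h i by (auto simp: c min_def)
      next
        case False
        then have "f1 i \<subseteq> flagat R r m f1 (x - 1)" using mono1[of i "x - 1"] h i by simp
        then have "f1 i \<inter> f j = f1 i" using Q jh by auto
        then show ?thesis using dims[OF i] False xy jh i by (auto simp: c min_def)
      qed
    qed
    then show "ftype R r m n f1 f = elem x y t e" using iff posE by auto
  qed
qed

text \<open>Only the member with index \<open>min x y\<close> is free, so a flag can be replaced by
  one subspace \<open>U\<close>. The conditions on the other rows hold automatically by
  \<open>agree\<close>, because there \<open>f\<close> coincides with \<open>f1\<close>;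
  \<open>top\<close> converts the last condition on \<open>U\<close> into the dimension that the
  elementary type requires.\<close>

lemma conv_elem_bij:
  assumes f2: "is_flag R r m n f2" and C: "C = ftype R r m n f1 f2"
    and supp: "\<And>i j. i \<notin> {m..n} \<or> j \<notin> {m..n} \<Longrightarrow> A i j = 0"
    and agree: "\<And>i j. i \<in> {m..n} \<Longrightarrow> i \<noteq> min x y \<Longrightarrow> j \<in> {m..n} \<Longrightarrow> cum m A i j = cum m C i j"
    and top: "cum m A (min x y) n = cum m (elem x y t e) n (min x y)"
  shows "card {f. is_flag R r m n f \<and> ftype R r m n f1 f = elem x y t e \<and> ftype R r m n f f2 = A} =
    card {U. subsp U \<and> flagat R r m f1 (x - 1) \<subseteq> U \<and> U \<subseteq> f1 x \<and>
      (\<forall>j\<in>{m-1..n}. int (dm (U \<inter> flagat R r m f2 j)) = cum m A (min x y) j)}"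
    (is "card ?S = card ?T")
proof -
  let ?h = "min x y"
  have mn: "m \<le> n" using xy by auto
  have h: "m \<le> ?h" "?h \<le> n" "?h < n" using xy by auto
  have f2n: "f2 n = V" using f2 by (simp add: is_flag_def)
  have posh: "pos m f f2 i j = int (dm (f i \<inter> flagat R r m f2 j))" if "m \<le> i" for f i j
    using that by (simp add: pos_def)
  have type2: "ftype R r m n f f2 = A \<longleftrightarrow>
      (\<forall>j\<in>{m-1..n}. int (dm (f ?h \<inter> flagat R r m f2 j)) = cum m A ?h j)"
    if f: "is_flag R r m n f" and eq: "\<And>i. i \<in> {m..n} \<Longrightarrow> i \<noteq> ?h \<Longrightarrow> f i = f1 i" for f
  proof -
    have other: "pos m f f2 i j = cum m A i j" if ij: "i \<in> {m..n}" "i \<noteq> ?h" "j \<in> {m..n}" for i j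
    proof -
      have "m \<le> i" using ij by simp
      have "pos m f f2 i j = pos m f1 f2 i j"
        unfolding posh[OF \<open>m \<le> i\<close>] eq[OF ij(1,2)] by (rule refl)
      also have "\<dots> = cum m C i j" unfolding C using ij cum_ftype[OF mn f1 f2, of i j] by simp
      finally show ?thesis using agree[OF ij] by simp
    qed
    have "(\<forall>i\<in>{m..n}. \<forall>j\<in>{m..n}. pos m f f2 i j = cum m A i j) \<longleftrightarrow>
        (\<forall>j\<in>{m..n}. pos m f f2 ?h j = cum m A ?h j)" (is "?a \<longleftrightarrow> ?b")
    proof
      assume b: ?b
      show ?a
      proof (intro ballI)
        fix i j assume "i \<in> {m..n}" "j \<in> {m..n}"
        then show "pos m f f2 i j = cum m A i j" using other b by (cases "i = ?h") auto
      qed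
    next
      assume ?a
      then show ?b using h by auto
    qed
    then have "ftype R r m n f f2 = A \<longleftrightarrow> (\<forall>j\<in>{m..n}. pos m f f2 ?h j = cum m A ?h j)"
      using ftype_eq_iff[OF mn f f2, of A, OF supp] by blast
    moreover have "pos m f f2 ?h (m - 1) = cum m A ?h (m - 1)" using pos_bot[OF mn f f2] h by simp
    moreover have "{m-1..n} = insert (m - 1) {m..n}" using mn by auto
    ultimately show ?thesis unfolding posh[OF h(1), symmetric] by simp
  qed
  have "bij_betw (\<lambda>f. f ?h) ?S ?T"
  proof (rule bij_betw_byWitness[where f' = "\<lambda>U. f1(?h := U)"])
    show "\<forall>f\<in>?S. f1(?h := f ?h) = f"
    proof clarify
      fix f assume f: "is_flag R r m n f" "ftype R r m n f1 f = elem x y t e"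
      have "(f1(?h := f ?h)) i = f i" for i
        using ftype_elem_iff[OF f(1)] f f1 by (cases "i \<in> {m..n}") (auto simp: is_flag_def)
      then show "f1(?h := f ?h) = f" by blast
    qed
    show "\<forall>U\<in>?T. (f1(?h := U)) ?h = U" by simp
    show "(\<lambda>f. f ?h) ` ?S \<subseteq> ?T"
    proof (rule image_subsetI)
      fix f assume "f \<in> ?S"
      then have f: "is_flag R r m n f" "ftype R r m n f1 f = elem x y t e" "ftype R r m n f f2 = A" by auto
      have "subsp (f ?h)" using f(1) h by (simp add: is_flag_def)
      then show "f ?h \<in> ?T" using ftype_elem_iff[OF f(1)] f type2[OF f(1)] by auto
    qed
    show "(\<lambda>U. f1(?h := U)) ` ?T \<subseteq> ?S"
    proof (rule image_subsetI)
      fix U assume U: "U \<in> ?T"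
      let ?f = "f1(?h := U)"
      have step: "?f i \<subseteq> ?f (i + 1)" if i: "m \<le> i" "i < n" for i
      proof -
        have a: "f1 i \<subseteq> f1 (i + 1)" using f1 i by (simp add: is_flag_def)
        have "f1 i \<subseteq> U" if "i + 1 = ?h"
        proof -
          have "f1 i \<subseteq> flagat R r m f1 (x - 1)"
            using flagat_mono[OF f1, of i "x - 1"] i that xy by (auto simp: min_def split: if_splits)
          then show ?thesis using U by auto
        qed
        moreover have "U \<subseteq> f1 (i + 1)" if "i = ?h"
        proof -
          have "f1 x \<subseteq> f1 (i + 1)"
            using flagat_mono[OF f1, of x "i + 1"] i that xy by (auto simp: min_def split: if_splits)
          then show ?thesis using U by auto
        qed
        ultimately show ?thesis using a by auto
      qed
      have f: "is_flag R r m n ?f"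
        unfolding is_flag_def using step f1 U h by (auto simp: is_flag_def)
      have "n \<in> {m-1..n}" using mn by simp
      then have "int (dm (U \<inter> flagat R r m f2 n)) = cum m A ?h n" using U by blast
      then have "int (dm U) = cum m (elem x y t e) n ?h"
        using top f2n mn subspD(1)[of U] U by (simp add: Int_absorb2)
      then have "ftype R r m n f1 ?f = elem x y t e" unfolding ftype_elem_iff[OF f] using U by auto
      moreover have "ftype R r m n ?f f2 = A" using type2[OF f] U by simp
      ultimately show "?f \<in> ?S" using f by simp
    qed
  qed
  then show ?thesis by (rule bij_betw_same_card)
qed

text \<open>The flag \<open>f2\<close> filters \<open>f1 x\<close> modulo the preceding member of
  \<open>f1\<close> with increments \<open>C x j\<close>, and the free member of \<open>f\<close>
  gives a subspace with prescribed increments: \<open>A x j\<close> if \<open>y = x + 1\<close>, but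
  \<open>C x j - A x j\<close> if \<open>x = y + 1\<close>. Symmetry of the binomials and an
  exchange of indices in the exponent bring both cases to one formula.\<close>

lemma card_conv_elem:
  assumes f2: "is_flag R r m n f2" and C: "C = ftype R r m n f1 f2"
    and supp: "\<And>i j. i \<notin> {m..n} \<or> j \<notin> {m..n} \<Longrightarrow> A i j = 0"
    and nonneg: "\<And>i j. A i j \<ge> 0"
    and top: "\<And>i. i \<in> {m..n} \<Longrightarrow> cum m A i n = cum m (elem x y t e) n i"
  shows "int (card {f. is_flag R r m n f \<and> ftype R r m n f1 f = elem x y t e \<and> ftype R r m n f f2 = A}) =
    (if (\<forall>i\<in>{m..n}. i \<noteq> x \<longrightarrow> i \<noteq> y \<longrightarrow> (\<forall>j\<in>{m..n}. A i j = C i j)) \<and>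
        (\<forall>j\<in>{m..n}. A x j + A y j = C x j + C y j \<and> A x j \<le> C x j)
     then (\<Prod>j\<in>{m..n}. poly (gb (nat (C x j)) (nat (C x j - A x j))) (int q)) *
       int q ^ nat (\<Sum>u\<in>{m..n}. \<Sum>j\<in>{m..n}. if bef x y u j then (C x u - A x u) * A x j else 0)
     else 0)"
    (is "int (card ?S) = (if ?rows \<and> ?sums then ?val else 0)")
proof -
  let ?h = "min x y"
  have mn: "m \<le> n" using xy by auto
  have h: "m \<le> ?h" "?h \<le> n" "?h < n" "x \<in> {?h, ?h + 1}" "y \<in> {?h, ?h + 1}" "x \<noteq> y" using xy by auto
  have Cnn: "C i j \<ge> 0" for i j unfolding C by (rule ftype_nonneg[OF mn f1 f2])
  have cumC: "cum m C i j = pos m f1 f2 i j" if "m - 1 \<le> i" "i \<le> n" "m - 1 \<le> j" "j \<le> n" for i j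
    unfolding C using cum_ftype[OF mn f1 f2] that by blast
  let ?agree = "\<forall>i\<in>{m..n}. i \<noteq> ?h \<longrightarrow> (\<forall>j\<in>{m..n}. cum m A i j = cum m C i j)"
  let ?sum = "\<forall>j\<in>{m..n}. A x j + A y j = C x j + C y j"
  \<comment> \<open>Dropping the row \<open>min x y\<close> of \<open>cum\<close> merges the matrix
    rows \<open>x\<close> and \<open>y\<close>: their sum is still determined, but neither of them
    alone.\<close>
  have agree_iff: "?agree \<longleftrightarrow> ?rows \<and> ?sum"
  proof
    assume ag: ?agree
    have ag': "cum m A i j = cum m C i j" if "m - 1 \<le> i" "i \<le> n" "i \<noteq> ?h" "m - 1 \<le> j" "j \<le> n" for i j
      using ag that by (cases "i = m - 1"; cases "j = m - 1") auto
    have ?rows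
    proof (intro ballI impI)
      fix i j assume "i \<in> {m..n}" "i \<noteq> x" "i \<noteq> y" "j \<in> {m..n}"
      moreover from this have "i \<noteq> ?h" "i - 1 \<noteq> ?h" using h(4-6) by auto
      ultimately show "A i j = C i j" using cum_entry[of m i j A] cum_entry[of m i j C] ag' by simp
    qed
    moreover have ?sum
    proof
      fix j assume j: "j \<in> {m..n}"
      have "A x j + A y j = A ?h j + A (?h + 1) j" "C x j + C y j = C ?h j + C (?h + 1) j"
        using xy(3) by (auto simp: min_def)
      then show "A x j + A y j = C x j + C y j"
        using cum_entry[of m ?h j A] cum_entry[of m ?h j C] cum_entry[of m "?h + 1" j A]
          cum_entry[of m "?h + 1" j C] ag'[of "?h - 1" j] ag'[of "?h - 1" "j - 1"]
          ag'[of "?h + 1" j] ag'[of "?h + 1" "j - 1"] h(1-3) j by simp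
    qed
    ultimately show "?rows \<and> ?sum" by blast
  next
    assume rs: "?rows \<and> ?sum"
    show ?agree
    proof (intro ballI impI)
      fix i j assume i: "i \<in> {m..n}" "i \<noteq> ?h" and j: "j \<in> {m..n}"
      have "(\<Sum>k\<in>{m..i}. A k l - C k l) = 0" if l: "l \<in> {m..j}" for l
      proof -
        have "(\<Sum>k\<in>{m..i}. A k l - C k l) = (\<Sum>k\<in>{m..i} \<inter> {x, y}. A k l - C k l)"
          using rs i j l by (intro sum.mono_neutral_right) auto
        also have "\<dots> = 0"
        proof (cases "i < ?h")
          case True
          then have "{m..i} \<inter> {x, y} = {}" by auto
          then show ?thesis by simp
        next
          case False
          then have "{m..i} \<inter> {x, y} = {x, y}" using i h xy by auto
          moreover have "l \<in> {m..n}" using l j by auto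
          then have "A x l + A y l = C x l + C y l" using rs by blast
          ultimately show ?thesis using h(6) by simp
        qed
        finally show ?thesis .
      qed
      then have "(\<Sum>l\<in>{m..j}. \<Sum>k\<in>{m..i}. A k l - C k l) = 0" by simp
      then show "cum m A i j = cum m C i j"
        unfolding cum_def by (simp add: sum_subtractf sum.swap[of _ "{m..j}"])
    qed
  qed
  show ?thesis
  proof (cases ?agree)
    case False
    have "?S = {}"
    proof (rule ccontr)
      assume "?S \<noteq> {}"
      then obtain f where f: "is_flag R r m n f" "ftype R r m n f1 f = elem x y t e" "ftype R r m n f f2 = A" by auto
      have "cum m A i j = cum m C i j" if ij: "i \<in> {m..n}" "i \<noteq> ?h" "j \<in> {m..n}" for i j
      proof -
        have "f i = f1 i" using ftype_elem_iff[OF f(1)] f(2) ij by blast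
        then have "pos m f f2 i j = pos m f1 f2 i j" using ij by (simp add: pos_def)
        then show ?thesis using cum_ftype[OF mn f(1) f2, of i j] cumC[of i j] f(3) ij by simp
      qed
      then show False using False by blast
    qed
    moreover have "\<not> (?rows \<and> ?sums)" using False agree_iff by blast
    ultimately show ?thesis by (simp only: if_False card.empty of_nat_0)
  next
    case True
    then have rows: ?rows and sums: ?sum using agree_iff by auto
    have ag': "cum m A i j = cum m C i j" if "m - 1 \<le> i" "i \<le> n" "i \<noteq> ?h" "m - 1 \<le> j" "j \<le> n" for i j
      using True that by (cases "i = m - 1"; cases "j = m - 1") auto
    \<comment> \<open>The chain index \<open>k\<close> stands for the flag index
      \<open>m - 1 + k\<close>, so that \<open>F 0\<close> is the zero space and \<open>F N\<close>
      the whole space.\<close>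
    define N where "N = nat (n - m + 1)"
    define F where "F k = flagat R r m f2 (m - 1 + int k)" for k
    define \<delta> where "\<delta> k = cum m A ?h (m - 1 + int k)" for k
    \<comment> \<open>\<open>s u\<close> is the increment at column \<open>u\<close> of the subspace
      modulo the member \<open>x - 1\<close> of \<open>f1\<close>; \<open>w u\<close> is its
      codimension in \<open>f1 x\<close> after both are intersected with the member
      \<open>u - 1\<close> of \<open>f2\<close>.\<close>
    define s where "s u = (cum m A ?h u - cum m C (x - 1) u) - (cum m A ?h (u - 1) - cum m C (x - 1) (u - 1))" for u
    define w where "w u = cum m C x (u - 1) - cum m A ?h (u - 1)" for u
    have N: "m - 1 + int k \<le> n \<longleftrightarrow> k \<le> N" for k using mn by (auto simp: N_def)
    have intv: "(\<forall>j\<in>{m-1..n}. P j) \<longleftrightarrow> (\<forall>k\<le>N. P (m - 1 + int k))" for P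
    proof
      assume *: "\<forall>k\<le>N. P (m - 1 + int k)"
      show "\<forall>j\<in>{m-1..n}. P j"
      proof
        fix j assume "j \<in> {m-1..n}"
        then have "j = m - 1 + int (nat (j - m + 1))" "nat (j - m + 1) \<le> N" by (auto simp: N_def)
        then show "P j" using * by metis
      qed
    qed (use N in auto)
    have pq: "int (dm (flagat R r m f1 (x - 1) \<inter> F k)) = cum m C (x - 1) (m - 1 + int k)"
      "int (dm (f1 x \<inter> F k)) = cum m C x (m - 1 + int k)" if "k \<le> N" for k
      using cumC[of "x - 1" "m - 1 + int k"] cumC[of x "m - 1 + int k"] xy N that
      by (simp_all add: pos_def F_def)
    have subP: "subsp (flagat R r m f1 (x - 1))" "subsp (f1 x)" "flagat R r m f1 (x - 1) \<subseteq> f1 x"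
      using subsp_flagat[OF f1, of "x - 1"] subsp_flagat[OF f1, of x] flagat_mono[OF f1, of "x - 1" x] xy by simp_all
    have subF: "subsp (F k)" if "k \<le> N" for k
      unfolding F_def using subsp_flagat[OF f2, of "m - 1 + int k"] N[of k] that by simp
    have monoF: "F k \<subseteq> F (Suc k)" if "k < N" for k
      unfolding F_def using flagat_mono[OF f2, of "m - 1 + int k" "m - 1 + int (Suc k)"] N[of "Suc k"] that by simp
    have F0: "F 0 = {z}" by (simp add: F_def)
    have "m - 1 + int N = n" using mn by (simp add: N_def)
    then have FN: "F N = V" using mn f2 by (simp add: F_def is_flag_def)
    have cS: "card ?S = card {U. subsp U \<and> flagat R r m f1 (x - 1) \<subseteq> U \<and> U \<subseteq> f1 x \<and>
      (\<forall>j\<in>{m-1..n}. int (dm (U \<inter> flagat R r m f2 j)) = cum m A ?h j)}"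
      using True top h by (intro conv_elem_bij[OF f2 C supp]) auto
    have "int (card ?S) = int (card {U. subsp U \<and> flagat R r m f1 (x - 1) \<subseteq> U \<and> U \<subseteq> f1 x \<and>
      (\<forall>k\<le>N. int (dm (U \<inter> F k)) = \<delta> k)})"
      unfolding cS intv F_def \<delta>_def by (rule refl)
    also have "\<dots> = (if \<forall>k<N. s (m + int k) \<ge> 0 then
      (\<Prod>k<N. poly (gb (nat (C x (m + int k))) (nat (s (m + int k)))) (int q) *
         int q ^ nat (s (m + int k) * w (m + int k))) else 0)"
    proof -
      have idx: "m - 1 + int (Suc k) = m + int k" "m - 1 + int k = m + int k - 1" for k by auto
      have e1: "int (dm (f1 x \<inter> F (Suc k))) - int (dm (flagat R r m f1 (x - 1) \<inter> F (Suc k))) -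
          (int (dm (f1 x \<inter> F k)) - int (dm (flagat R r m f1 (x - 1) \<inter> F k))) = C x (m + int k)"
        and e2: "\<delta> (Suc k) - int (dm (flagat R r m f1 (x - 1) \<inter> F (Suc k))) -
          (\<delta> k - int (dm (flagat R r m f1 (x - 1) \<inter> F k))) = s (m + int k)"
        and e3: "int (dm (f1 x \<inter> F k)) - \<delta> k = w (m + int k)" if "k < N" for k
        using pq[of k] pq[of "Suc k"] cum_entry[of m x "m + int k" C] xy that
        unfolding s_def w_def \<delta>_def idx by simp_all
      have \<delta>0: "\<delta> 0 = 0" by (simp add: \<delta>_def)
      show ?thesis
      proof -
        let ?P = "flagat R r m f1 (x - 1)"
        have "int (card {U. subsp U \<and> ?P \<subseteq> U \<and> U \<subseteq> f1 x \<and> (\<forall>k\<le>N. int (dm (U \<inter> F k)) = \<delta> k)}) =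
          (if \<forall>k<N. \<delta> (Suc k) - int (dm (?P \<inter> F (Suc k))) - (\<delta> k - int (dm (?P \<inter> F k))) \<ge> 0 then
            (\<Prod>k<N. poly (gb
              (nat (int (dm (f1 x \<inter> F (Suc k))) - int (dm (?P \<inter> F (Suc k))) -
                (int (dm (f1 x \<inter> F k)) - int (dm (?P \<inter> F k)))))
              (nat (\<delta> (Suc k) - int (dm (?P \<inter> F (Suc k))) - (\<delta> k - int (dm (?P \<inter> F k)))))) (int q) *
            int q ^ nat ((\<delta> (Suc k) - int (dm (?P \<inter> F (Suc k))) - (\<delta> k - int (dm (?P \<inter> F k)))) *
              (int (dm (f1 x \<inter> F k)) - \<delta> k))) else 0)"
          by (rule card_subsp_between) (use subP subF monoF F0 FN \<delta>0 in auto)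
        also have "\<dots> = (if \<forall>k<N. s (m + int k) \<ge> 0 then
          (\<Prod>k<N. poly (gb (nat (C x (m + int k))) (nat (s (m + int k)))) (int q) *
          int q ^ nat (s (m + int k) * w (m + int k))) else 0)"
          by (intro if_cong prod.cong refl) (simp_all add: e1 e2 e3)
        finally show ?thesis .
      qed
    qed
    finally have cS2: "int (card ?S) = (if \<forall>k<N. s (m + int k) \<ge> 0 then
      (\<Prod>k<N. poly (gb (nat (C x (m + int k))) (nat (s (m + int k)))) (int q) *
         int q ^ nat (s (m + int k) * w (m + int k))) else 0)" .
    have all_re: "(\<forall>k<N. P (m + int k)) \<longleftrightarrow> (\<forall>u\<in>{m..n}. P u)" for P
    proof
      assume *: "\<forall>k<N. P (m + int k)"
      show "\<forall>u\<in>{m..n}. P u"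
      proof
        fix u assume "u \<in> {m..n}"
        then have "u = m + int (nat (u - m))" "nat (u - m) < N" by (auto simp: N_def)
        then show "P u" using * by metis
      qed
    qed (auto simp: N_def)
    have prod_re: "(\<Prod>k<N. P (m + int k)) = (\<Prod>u\<in>{m..n}. P u)" for P :: "int \<Rightarrow> int"
      by (rule prod.reindex_bij_witness[where i = "\<lambda>u. nat (u - m)" and j = "\<lambda>k. m + int k"])
        (auto simp: N_def)
    have main: "int (card ?S) = (if \<forall>u\<in>{m..n}. s u \<ge> 0 then
      (\<Prod>u\<in>{m..n}. poly (gb (nat (C x u)) (nat (s u))) (int q) * int q ^ nat (s u * w u)) else 0)"
      unfolding cS2 all_re[of "\<lambda>u. s u \<ge> 0"]
        prod_re[of "\<lambda>u. poly (gb (nat (C x u)) (nat (s u))) (int q) * int q ^ nat (s u * w u)"]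
      by (rule refl)
    have rowx: "cum m X x u = cum m X (x - 1) u + (\<Sum>l\<in>{m..u}. X x l)" for X u
      using cum_row_step[of m x X u] xy by simp
    have sw: "(x < y \<and> s u = A x u \<and> w u = (\<Sum>l\<in>{m..u-1}. C x l - A x l)) \<or>
      (y < x \<and> s u = C x u - A x u \<and> w u = (\<Sum>l\<in>{m..u-1}. A x l))" if u: "u \<in> {m..n}" for u
    proof (cases "x < y")
      case True
      then have hx: "?h = x" by simp
      have e: "cum m A (x - 1) u' = cum m C (x - 1) u'" if "u' \<in> {m-1..n}" for u'
        using ag'[of "x - 1" u'] that hx xy by simp
      have "s u = A x u" using e[of u] e[of "u - 1"] u cum_entry[of m x u A] xy hx by (simp add: s_def)
      moreover have "w u = (\<Sum>l\<in>{m..u-1}. C x l - A x l)"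
        using e[of "u - 1"] u rowx[of A "u - 1"] rowx[of C "u - 1"] hx by (simp add: w_def sum_subtractf)
      ultimately show ?thesis using True by simp
    next
      case False
      then have hx: "?h = x - 1" "y < x" using xy by auto
      have e: "cum m A x u' = cum m C x u'" if "u' \<in> {m-1..n}" for u'
        using ag'[of x u'] that hx xy by simp
      have "s u = C x u - A x u"
        using e[of u] e[of "u - 1"] u cum_entry[of m x u A] cum_entry[of m x u C] xy hx by (simp add: s_def)
      moreover have "w u = (\<Sum>l\<in>{m..u-1}. A x l)"
        using e[of "u - 1"] u rowx[of A "u - 1"] rowx[of C "u - 1"] hx by (simp add: w_def)
      ultimately show ?thesis using hx by simp
    qed
    show ?thesis
    proof (cases "\<forall>u\<in>{m..n}. A x u \<le> C x u")
      case le: True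
      have s0: "s u \<ge> 0" if "u \<in> {m..n}" for u using sw[OF that] le nonneg that by auto
      have w0: "w u \<ge> 0" if "u \<in> {m..n}" for u using sw[OF that] le nonneg that by (auto intro!: sum_nonneg)
      have gbs: "gb (nat (C x u)) (nat (s u)) = gb (nat (C x u)) (nat (C x u - A x u))" if u: "u \<in> {m..n}" for u
      proof -
        have "A x u \<le> C x u" using le u by blast
        then have "gb (nat (C x u)) (nat (C x u - A x u)) = gb (nat (C x u)) (nat (A x u))"
          using gb_sym[of "nat (A x u)" "nat (C x u)"] nonneg[of x u] by (simp add: nat_diff_distrib nat_mono)
        then show ?thesis using sw[OF u] by auto
      qed
      have "(\<Sum>u\<in>{m..n}. s u * w u) =
         (\<Sum>u\<in>{m..n}. \<Sum>j\<in>{m..n}. if bef x y u j then (C x u - A x u) * A x j else 0)"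
      proof (cases "x < y")
        case True
        have "(\<Sum>u\<in>{m..n}. s u * w u) = (\<Sum>u\<in>{m..n}. \<Sum>l\<in>{m..n}. if l < u then A x u * (C x l - A x l) else 0)"
        proof (rule sum.cong[OF refl])
          fix u assume u: "u \<in> {m..n}"
          have "(\<Sum>l\<in>{m..n}. if l < u then A x u * (C x l - A x l) else 0) =
            (\<Sum>l\<in>{m..n} \<inter> {l. l < u}. A x u * (C x l - A x l))" by (simp add: sum.inter_restrict)
          also have "{m..n} \<inter> {l. l < u} = {m..u-1}" using u by auto
          finally show "s u * w u = (\<Sum>l\<in>{m..n}. if l < u then A x u * (C x l - A x l) else 0)"
            using sw[OF u] True by (simp add: sum_distrib_left)
        qed
        \<comment> \<open>For \<open>x < y\<close> the moved units \<open>C x l - A x l\<close>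
          carry the inner index; the exchange makes theirs the outer one, and \<open>l < u\<close>
          becomes the relation \<open>bef\<close>.\<close>
        also have "\<dots> = (\<Sum>l\<in>{m..n}. \<Sum>u\<in>{m..n}. if l < u then A x u * (C x l - A x l) else 0)"
          by (rule sum.swap)
        finally show ?thesis using True by (simp add: bef_def mult.commute cong: if_cong)
      next
        case False
        show ?thesis
        proof (rule sum.cong[OF refl])
          fix u assume u: "u \<in> {m..n}"
          have "(\<Sum>l\<in>{m..n}. if bef x y u l then (C x u - A x u) * A x l else 0) =
            (\<Sum>l\<in>{m..n} \<inter> {l. l < u}. (C x u - A x u) * A x l)"
            using False by (simp add: sum.inter_restrict bef_def)
          also have "{m..n} \<inter> {l. l < u} = {m..u-1}" using u by auto
          finally show "s u * w u = (\<Sum>l\<in>{m..n}. if bef x y u l then (C x u - A x u) * A x l else 0)"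
            using sw[OF u] False by (simp add: sum_distrib_left)
        qed
      qed
      moreover have "int (\<Sum>u\<in>{m..n}. nat (s u * w u)) = (\<Sum>u\<in>{m..n}. s u * w u)"
        using s0 w0 by simp
      then have "nat (\<Sum>u\<in>{m..n}. s u * w u) = (\<Sum>u\<in>{m..n}. nat (s u * w u))"
        by (metis nat_int)
      ultimately have val: "(\<Prod>u\<in>{m..n}. poly (gb (nat (C x u)) (nat (s u))) (int q) * int q ^ nat (s u * w u)) = ?val"
        using gbs by (simp add: prod.distrib power_sum)
      have sa: "\<forall>u\<in>{m..n}. s u \<ge> 0" using s0 by blast
      have "int (card ?S) = ?val" unfolding main if_P[OF sa] by (rule val)
      moreover have cond: "?rows \<and> ?sums" using rows sums le by blast
      ultimately show ?thesis by (subst if_P[OF cond])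
    next
      case False
      then obtain u where u: "u \<in> {m..n}" "C x u < A x u" by auto
      \<comment> \<open>An entry of \<open>A\<close> that is too large shows up in two ways: as a
        binomial out of range for \<open>x < y\<close>, and as a negative increment for
        \<open>y < x\<close>.\<close>
      have "int (card ?S) = 0"
      proof (cases "x < y")
        case True
        then have "s u = A x u" using sw[OF u(1)] by simp
        then have "gb (nat (C x u)) (nat (s u)) = 0" using u Cnn[of x u] by (intro gb_eq_0) simp
        then have "(\<Prod>u\<in>{m..n}. poly (gb (nat (C x u)) (nat (s u))) (int q) * int q ^ nat (s u * w u)) = 0"
          using u(1) by (intro prod_zero bexI[of _ u]) simp_all
        then show ?thesis unfolding main by simp
      next
        case False
        then have "s u < 0" using sw[OF u(1)] u by simp
        then have "\<not> (\<forall>u\<in>{m..n}. s u \<ge> 0)" using u(1) by (metis not_le)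
        then show ?thesis unfolding main by (simp only: if_False)
      qed
      moreover have "\<not> (?rows \<and> ?sums)" using False by blast
      ultimately show ?thesis by (simp only: if_False)
    qed
  qed
qed

end

end

section \<open>Normalisation of coefficients\<close>

lemma vv_power: "vv ^ n = Fract (monom 1 n) 1"
proof (induction n)
  case 0
  then show ?case by (simp add: One_fract_def)
next
  case (Suc n)
  then show ?case by (simp add: vv_def monom_Suc)
qed

lemma vv_power_ne_1: "n \<ge> 1 \<Longrightarrow> vv ^ n \<noteq> 1"
proof
  assume "n \<ge> 1" "vv ^ n = 1"
  then have "monom (1::int) n = 1" by (simp add: vv_power One_fract_def eq_fract)
  then have "degree (monom (1::int) n) = 0" by simp
  then show False using \<open>n \<ge> 1\<close> by (simp add: degree_monom_eq)
qed

lemma vv_nonzero [simp]: "vv \<noteq> 0"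
  by (simp add: vv_def Zero_fract_def eq_fract)

text \<open>This is the specialisation that \<open>Kprod\<close> applies to \<open>gpoly\<close>. It
  is a ring homomorphism, so a product of counts can be normalised factor by factor.\<close>

definition phi :: "int poly \<Rightarrow> rf" where
  "phi p = poly (map_poly of_int p) (vv ^ 2)"

lemma phi_pCons: "phi (pCons c p) = of_int c + vv ^ 2 * phi p"
  by (cases "c = 0 \<and> p = 0") (auto simp: phi_def map_poly_pCons)

lemma phi_0 [simp]: "phi 0 = 0"
  by (simp add: phi_def)

lemma phi_1 [simp]: "phi 1 = 1"
  by (simp add: phi_def)

lemma phi_add: "phi (p + p') = phi p + phi p'"
  by (induction p p' rule: poly_induct2) (simp_all add: phi_pCons algebra_simps)

lemma phi_smult: "phi (smult c p) = of_int c * phi p"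
  by (induction p) (simp_all add: phi_pCons algebra_simps)

lemma phi_mult: "phi (p * p') = phi p * phi p'"
  by (induction p) (simp_all add: phi_pCons phi_add phi_smult algebra_simps)

lemma phi_power: "phi (p ^ n) = phi p ^ n"
  by (induction n) (simp_all add: phi_mult)

lemma phi_minus: "phi (- p) = - phi p"
  using phi_add[of p "- p"] by (simp add: eq_neg_iff_add_eq_0 add.commute)

lemma phi_diff: "phi (p - p') = phi p - phi p'"
  using phi_add[of p "- p'"] by (simp add: phi_minus)

lemma phi_X_power: "phi ([:0, 1:] ^ n) = vv powi (2 * int n)"
  by (simp add: phi_power phi_pCons flip: power_mult)
    (metis of_nat_mult of_nat_numeral power_int_of_nat)

lemma phi_qn: "phi (qn n) = vv powi (2 * int n) - 1"
  by (simp add: qn_def phi_diff phi_X_power)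

section \<open>Elements of \<open>Z1\<close>, and Gaussian binomials among them\<close>

lemma Z1_1 [simp, intro]: "1 \<in> Z1"
  using gen_v[of 0] by (simp add: one_pCons)

lemma Z1_0 [simp, intro]: "0 \<in> Z1"
  using Z1.add[OF Z1_1 Z1.uminus[OF Z1_1]] by simp

lemma Z1_of_nat: "of_nat n \<in> Z1"
  by (induction n) (auto intro: Z1.add)

lemma Z1_of_int: "of_int i \<in> Z1"
  by (cases i) (auto intro: Z1_of_nat Z1.uminus simp del: of_nat_Suc)

lemma Z1_phi: "[:phi p:] \<in> Z1"
proof (induction p)
  case (pCons c p)
  have "of_int c + [:vv powi 2:] * [:phi p:] \<in> Z1"
    by (intro Z1.add Z1.mult Z1_of_int gen_v pCons)
  moreover have "of_int c = [:of_int c :: rf:]" by (simp add: of_int_poly)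
  ultimately show ?case by (simp add: phi_pCons mult.commute)
qed simp

text \<open>The generators of \<^const>\<open>Z1\<close>, with the empty product \<open>1\<close> for \<open>t \<le> 0\<close>.\<close>

definition qpoly :: "int \<Rightarrow> int \<Rightarrow> rf poly" where
  "qpoly c t = (\<Prod>i\<in>{1..t}. smult (inverse (vv powi (-2 * i) - 1)) [: -1, 0, vv powi (-2 * (c - i)) :])"

lemma Z1_qpoly: "qpoly c t \<in> Z1"
proof (cases "t \<ge> 1")
  case True
  then show ?thesis unfolding qpoly_def by (rule gen_q)
next
  case False
  then show ?thesis by (simp add: qpoly_def)
qed

text \<open>The factors \<open>(q^(n+1-i) - 1) / (q^i - 1)\<close> are rewritten with negative
  exponents, as they occur in the generators of \<open>Z1\<close>. The factor with index
  \<open>i\<close> releases \<open>v^(2(n+1-2i))\<close>, and these powers multiply to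
  \<open>v^(2k(n-k))\<close>.\<close>

lemma phi_gb:
  assumes "k \<le> n"
  shows "phi (gb n k) = vv powi (2 * int k * (int n - int k)) *
    (\<Prod>i\<in>{1..int k}. inverse (vv powi (-2 * i) - 1) * (vv powi (-2 * (int n + 1 - i)) - 1))"
  using assms
proof (induction k)
  case 0
  then show ?case by simp
next
  case (Suc k)
  have absorb: "qn (Suc k) * gb n (Suc k) = qn (n - k) * gb n k"
  proof -
    have "qfact (n - k) = qfact (n - Suc k) * qn (n - k)"
      using Suc.prems qfact_Suc[of "n - Suc k"] by (simp add: Suc_diff_Suc)
    then have "qn (Suc k) * gb n (Suc k) * (qfact k * qfact (n - Suc k)) =
      qn (n - k) * gb n k * (qfact k * qfact (n - Suc k))"
      using gb_qfact[of k n] gb_qfact[of "Suc k" n] Suc.prems by (simp add: qfact_Suc mult_ac)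
    then show ?thesis by simp
  qed
  let ?j = "int k + 1"
  have nz: "vv powi (2 * ?j) - 1 \<noteq> 0" "vv powi (- 2 * ?j) - 1 \<noteq> 0"
  proof -
    have "vv powi (2 * ?j) = vv ^ (2 * Suc k)"
      by (simp add: power_int_def nat_mult_distrib nat_add_distrib)
    then show *: "vv powi (2 * ?j) - 1 \<noteq> 0" using vv_power_ne_1[of "2 * Suc k"] by simp
    then show "vv powi (- 2 * ?j) - 1 \<noteq> 0"
      using power_int_minus[of vv "2 * ?j"] by (simp only: mult_minus_left) simp
  qed
  have flip: "vv powi c - 1 = - (vv powi c) * (vv powi (- c) - 1)" for c
    by (simp add: algebra_simps power_int_minus)
  have "phi (gb n (Suc k)) = (vv powi (2 * (int n - int k)) - 1) / (vv powi (2 * ?j) - 1) * phi (gb n k)"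
    using arg_cong[OF absorb, of phi] nz(1) Suc.prems
    by (simp add: phi_mult phi_qn field_simps of_nat_diff)
  also have "(vv powi (2 * (int n - int k)) - 1) / (vv powi (2 * ?j) - 1) =
    vv powi (2 * (int n - int k) - 2 * ?j) *
      (inverse (vv powi (-2 * ?j) - 1) * (vv powi (-2 * (int n - int k)) - 1))"
  proof -
    have "(- x * s) / (- y * u) = (x / y) * (inverse u * s)" for x y s u :: rf
      by (simp add: divide_inverse mult_ac)
    then show ?thesis
      unfolding flip[of "2 * (int n - int k)"] flip[of "2 * ?j"]
      by (simp only: power_int_diff vv_nonzero simp_thms mult_minus_left)
  qed
  finally have "phi (gb n (Suc k)) = (vv powi (2 * (int n - int k) - 2 * ?j) * vv powi (2 * int k * (int n - int k))) *
    ((\<Prod>i\<in>{1..int k}. inverse (vv powi (-2 * i) - 1) * (vv powi (-2 * (int n + 1 - i)) - 1)) *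
      (inverse (vv powi (-2 * ?j) - 1) * (vv powi (-2 * (int n - int k)) - 1)))"
    using Suc by (simp add: mult_ac)
  also have "vv powi (2 * (int n - int k) - 2 * ?j) * vv powi (2 * int k * (int n - int k)) =
    vv powi (2 * int (Suc k) * (int n - int (Suc k)))"
    by (simp add: power_int_add[symmetric] algebra_simps)
  also have "{1..int (Suc k)} = insert ?j {1..int k}" by auto
  then have "(\<Prod>i\<in>{1..int k}. inverse (vv powi (-2 * i) - 1) * (vv powi (-2 * (int n + 1 - i)) - 1)) *
      (inverse (vv powi (-2 * ?j) - 1) * (vv powi (-2 * (int n - int k)) - 1)) =
    (\<Prod>i\<in>{1..int (Suc k)}. inverse (vv powi (-2 * i) - 1) * (vv powi (-2 * (int n + 1 - i)) - 1))"
    by (simp add: mult.commute)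
  finally show ?case .
qed

text \<open>With \<open>v' = v^(-a)\<close> the power \<open>v^(-2(c+a+1-i))\<close> is
  \<open>v^(-2(c+1-i)) v'^2\<close>; hence the parameter \<open>c + 1\<close>. The power of
  \<open>v\<close> in front still depends on \<open>a\<close> and has to be cancelled by the
  normalisation.\<close>

lemma phi_gb_qpoly:
  assumes "0 \<le> t" "t \<le> c + a"
  shows "phi (gb (nat (c + a)) (nat t)) = vv powi (2 * t * (c + a - t)) * poly (qpoly (c + 1) t) (vv powi (- a))"
proof -
  have "poly (qpoly (c + 1) t) (vv powi (- a)) =
    (\<Prod>i\<in>{1..t}. inverse (vv powi (-2 * i) - 1) * (vv powi (-2 * (c + a + 1 - i)) - 1))"
    unfolding qpoly_def poly_prod
  proof (rule prod.cong[OF refl])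
    fix i
    have "vv powi (- a) * vv powi (- a) * vv powi (-2 * (c + 1 - i)) = vv powi (-2 * (c + a + 1 - i))"
      by (simp add: power_int_add[symmetric] algebra_simps)
    then show "poly (smult (inverse (vv powi (- 2 * i) - 1)) [:- 1, 0, vv powi (- 2 * (c + 1 - i)):]) (vv powi - a) =
        inverse (vv powi (- 2 * i) - 1) * (vv powi (- 2 * (c + a + 1 - i)) - 1)"
      by (simp add: algebra_simps)
  qed
  then show ?thesis using phi_gb[of "nat t" "nat (c + a)"] assms by simp
qed

text \<open>The coefficient of \<open>a\<close> in \<open>d\<close> of an extended matrix.
  Consequently \<open>dd m0 n0 a X\<close> is \<open>d\<close> of the extension of \<open>X\<close>
  to any larger window (\<open>dA_ext\<close>).\<close>

definition wt :: "int \<Rightarrow> int \<Rightarrow> mat \<Rightarrow> int" where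
  "wt m n X = (\<Sum>i\<in>{m..n}. \<Sum>j\<in>{m..n}. \<bar>i - j\<bar> * X i j)"

definition dd :: "int \<Rightarrow> int \<Rightarrow> int \<Rightarrow> mat \<Rightarrow> int" where
  "dd m0 n0 a X = dA m0 n0 X + a * wt m0 n0 X"

lemma sum_restrict_int:
  fixes h :: "int \<Rightarrow> 'a :: comm_monoid_add"
  assumes "m \<le> m0" "n0 \<le> n" "\<And>i. i \<in> {m..n} \<Longrightarrow> i \<notin> {m0..n0} \<Longrightarrow> h i = 0"
  shows "sum h {m..n} = sum h {m0..n0}"
  using assms by (intro sum.mono_neutral_right) auto

lemma sum2_restrict_int:
  fixes h :: "int \<Rightarrow> int \<Rightarrow> 'a :: comm_monoid_add"
  assumes "m \<le> m0" "n0 \<le> n" "\<And>i j. i \<notin> {m0..n0} \<or> j \<notin> {m0..n0} \<Longrightarrow> h i j = 0"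
  shows "(\<Sum>i\<in>{m..n}. \<Sum>j\<in>{m..n}. h i j) = (\<Sum>i\<in>{m0..n0}. \<Sum>j\<in>{m0..n0}. h i j)"
proof -
  have "(\<Sum>i\<in>{m..n}. \<Sum>j\<in>{m..n}. h i j) = (\<Sum>i\<in>{m0..n0}. \<Sum>j\<in>{m..n}. h i j)"
    using assms by (intro sum_restrict_int) auto
  also have "\<dots> = (\<Sum>i\<in>{m0..n0}. \<Sum>j\<in>{m0..n0}. h i j)"
    by (rule sum.cong[OF refl], rule sum_restrict_int) (use assms in auto)
  finally show ?thesis .
qed

text \<open>\<open>d\<close> is a quadratic form, expanded here at \<open>X\<close> plus
  \<open>a\<close> times the identity. An entry \<open>(i,j)\<close> below the diagonal pairs with
  the \<open>i - j\<close> diagonal units at \<open>k\<close> with \<open>j < k \<le> i\<close>, and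
  symmetrically above the diagonal. Two diagonal units never pair, since \<open>i \<ge> k\<close>
  and \<open>i < k\<close> exclude each other.\<close>

lemma dA_ext:
  assumes X: "X \<in> tXi m0 n0" and mn: "m \<le> m0" "n0 \<le> n"
  shows "dA m n (ext a m n X) = dd m0 n0 a X"
proof -
  define K where "K = {m..n}"
  define c where "c i j k l \<longleftrightarrow> i \<ge> k \<and> j < l" for i j k l :: int
  define \<delta> :: "int \<Rightarrow> int \<Rightarrow> int" where "\<delta> i j = (if i = j then 1 else 0)" for i j
  have X0: "X i j = 0" if "i \<notin> {m0..n0} \<or> j \<notin> {m0..n0}" for i j
    using X that by (auto simp: tXi_def)
  define Q where "Q Y Z = (\<Sum>i\<in>K. \<Sum>j\<in>K. \<Sum>k\<in>K. \<Sum>l\<in>K. if c i j k l then Y i j * Z k l else 0)"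
    for Y Z :: mat
  have restr: "(\<Sum>i\<in>K. \<Sum>j\<in>K. h i j * X i j) = (\<Sum>i\<in>{m0..n0}. \<Sum>j\<in>{m0..n0}. h i j * X i j)" for h
    unfolding K_def by (rule sum2_restrict_int[OF mn]) (auto simp: X0)
  have "dA m n (ext a m n X) = Q (\<lambda>i j. X i j + a * \<delta> i j) (\<lambda>i j. X i j + a * \<delta> i j)"
    unfolding dA_def Q_def K_def c_def by (intro sum.cong refl) (auto simp: ext_def \<delta>_def)
  also have "\<dots> = (\<Sum>i\<in>K. \<Sum>j\<in>K. \<Sum>k\<in>K. \<Sum>l\<in>K.
      (if c i j k l then X i j * X k l else 0) + a * (if c i j k l then X i j * \<delta> k l else 0)
      + a * (if c i j k l then \<delta> i j * X k l else 0) + a * a * (if c i j k l then \<delta> i j * \<delta> k l else 0))"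
    unfolding Q_def by (intro sum.cong refl) (auto simp: algebra_simps)
  also have "\<dots> = Q X X + a * Q X \<delta> + a * Q \<delta> X + a * a * Q \<delta> \<delta>"
    unfolding Q_def by (simp add: sum.distrib sum_distrib_left)
  also have "Q X \<delta> = (\<Sum>i\<in>K. \<Sum>j\<in>K. max 0 (i - j) * X i j)"
    unfolding Q_def
  proof (intro sum.cong refl)
    fix i j assume ij: "i \<in> K" "j \<in> K"
    have "(\<Sum>k\<in>K. \<Sum>l\<in>K. if c i j k l then X i j * \<delta> k l else 0) =
      (\<Sum>k\<in>K. \<Sum>l\<in>K. if k = l then (if j < k \<and> k \<le> i then X i j else 0) else 0)"
      by (intro sum.cong refl) (auto simp: c_def \<delta>_def)
    also have "\<dots> = (\<Sum>k\<in>K. if k \<in> {j+1..i} then X i j else 0)"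
      by (intro sum.cong refl) (auto simp: K_def sum.delta)
    also have "\<dots> = (\<Sum>k\<in>K \<inter> {j+1..i}. X i j)" by (simp only: sum.inter_restrict K_def finite_atLeastAtMost_int)
    also have "K \<inter> {j+1..i} = {j+1..i}" using ij by (auto simp: K_def)
    finally show "(\<Sum>k\<in>K. \<Sum>l\<in>K. if c i j k l then X i j * \<delta> k l else 0) = max 0 (i - j) * X i j"
      by (simp add: max_def)
  qed
  also have "Q \<delta> X = (\<Sum>i\<in>K. \<Sum>k\<in>K. \<Sum>l\<in>K. if k \<le> i \<and> i < l then X k l else 0)"
    unfolding Q_def
  proof (rule sum.cong[OF refl])
    fix i assume i: "i \<in> K"
    have "(\<Sum>j\<in>K. \<Sum>k\<in>K. \<Sum>l\<in>K. if c i j k l then \<delta> i j * X k l else 0) =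
      (\<Sum>j\<in>K. if i = j then (\<Sum>k\<in>K. \<Sum>l\<in>K. if k \<le> i \<and> i < l then X k l else 0) else 0)"
    proof (rule sum.cong[OF refl])
      fix j
      show "(\<Sum>k\<in>K. \<Sum>l\<in>K. if c i j k l then \<delta> i j * X k l else 0) =
        (if i = j then (\<Sum>k\<in>K. \<Sum>l\<in>K. if k \<le> i \<and> i < l then X k l else 0) else 0)"
        by (cases "i = j") (auto simp: c_def \<delta>_def intro!: sum.cong sum.neutral)
    qed
    then show "(\<Sum>j\<in>K. \<Sum>k\<in>K. \<Sum>l\<in>K. if c i j k l then \<delta> i j * X k l else 0) =
       (\<Sum>k\<in>K. \<Sum>l\<in>K. if k \<le> i \<and> i < l then X k l else 0)"
      using i by (simp add: K_def sum.delta)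
  qed
  also have "\<dots> = (\<Sum>k\<in>K. \<Sum>l\<in>K. \<Sum>i\<in>K. if k \<le> i \<and> i < l then X k l else 0)"
    by (subst sum.swap) (intro sum.cong refl sum.swap)
  also have "\<dots> = (\<Sum>k\<in>K. \<Sum>l\<in>K. max 0 (l - k) * X k l)"
  proof (intro sum.cong refl)
    fix k l assume kl: "k \<in> K" "l \<in> K"
    have "(\<Sum>i\<in>K. if k \<le> i \<and> i < l then X k l else 0) = (\<Sum>i\<in>K. if i \<in> {k..l-1} then X k l else 0)"
      by (intro sum.cong refl) auto
    also have "\<dots> = (\<Sum>i\<in>K \<inter> {k..l-1}. X k l)" by (simp only: sum.inter_restrict K_def finite_atLeastAtMost_int)
    also have "K \<inter> {k..l-1} = {k..l-1}" using kl by (auto simp: K_def)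
    finally show "(\<Sum>i\<in>K. if k \<le> i \<and> i < l then X k l else 0) = max 0 (l - k) * X k l"
      by (simp add: max_def)
  qed
  also have "Q \<delta> \<delta> = 0"
    unfolding Q_def by (intro sum.neutral ballI) (auto simp: c_def \<delta>_def)
  also have "Q X X = dA m0 n0 X"
  proof -
    have in2: "(\<Sum>k\<in>K. \<Sum>l\<in>K. if c i j k l then X i j * X k l else 0) =
      (\<Sum>k\<in>{m0..n0}. \<Sum>l\<in>{m0..n0}. if c i j k l then X i j * X k l else 0)" for i j
      unfolding K_def by (rule sum2_restrict_int[OF mn]) (auto simp: X0)
    show ?thesis
      unfolding Q_def in2 unfolding dA_def K_def c_def
      by (rule sum2_restrict_int[OF mn]) (auto simp: X0 intro!: sum.neutral)
  qed
  finally have "dA m n (ext a m n X) = dA m0 n0 X + a * ((\<Sum>i\<in>K. \<Sum>j\<in>K. max 0 (i - j) * X i j) +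
    (\<Sum>i\<in>K. \<Sum>j\<in>K. max 0 (j - i) * X i j))" by (simp add: algebra_simps)
  also have "(\<Sum>i\<in>K. \<Sum>j\<in>K. max 0 (i - j) * X i j) + (\<Sum>i\<in>K. \<Sum>j\<in>K. max 0 (j - i) * X i j) =
    (\<Sum>i\<in>K. \<Sum>j\<in>K. \<bar>i - j\<bar> * X i j)"
    unfolding sum.distrib[symmetric] by (intro sum.cong refl) (auto simp: max_def abs_if)
  also have "\<dots> = wt m0 n0 X" unfolding restr wt_def ..
  finally show ?thesis by (simp add: dd_def)
qed

section \<open>Existence of flags of every type\<close>

text \<open>The condition in \<open>gpoly\<close> quantifies over rings with elements of type
  \<open>nat\<close>, so the prime fields are realised on \<open>{0..<p}\<close>.\<close>

definition Zmod :: "nat \<Rightarrow> nat ring" where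
  "Zmod p = \<lparr>carrier = {0..<p}, monoid.mult = (\<lambda>x y. (x * y) mod p), one = 1, zero = 0, add = (\<lambda>x y. (x + y) mod p)\<rparr>"

lemma field_Zmod:
  assumes "prime p"
  shows "field (Zmod p)"
proof -
  have p2: "p \<ge> 2" using assms prime_ge_2_nat by blast
  have ag: "abelian_group (Zmod p)"
  proof (rule abelian_groupI)
    fix x assume "x \<in> carrier (Zmod p)"
    then show "\<exists>y\<in>carrier (Zmod p). y \<oplus>\<^bsub>Zmod p\<^esub> x = \<zero>\<^bsub>Zmod p\<^esub>"
      using p2 by (intro bexI[of _ "(p - x) mod p"]) (auto simp: Zmod_def mod_add_left_eq)
  qed (use p2 in \<open>auto simp: Zmod_def mod_simps ac_simps\<close>)
  have cm: "comm_monoid (Zmod p)"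
    by (rule comm_monoidI) (use p2 in \<open>auto simp: Zmod_def mod_simps ac_simps\<close>)
  have "cring (Zmod p)"
    by (rule cringI[OF ag cm]) (use p2 in \<open>auto simp: Zmod_def mod_simps algebra_simps\<close>)
  then interpret cring "Zmod p" .
  show ?thesis
  proof (rule cring_fieldI)
    show "Units (Zmod p) = carrier (Zmod p) - {\<zero>\<^bsub>Zmod p\<^esub>}"
    proof
      show "Units (Zmod p) \<subseteq> carrier (Zmod p) - {\<zero>\<^bsub>Zmod p\<^esub>}"
        using p2 by (auto simp: Units_def Zmod_def)
      show "carrier (Zmod p) - {\<zero>\<^bsub>Zmod p\<^esub>} \<subseteq> Units (Zmod p)"
      proof
        fix x assume "x \<in> carrier (Zmod p) - {\<zero>\<^bsub>Zmod p\<^esub>}"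
        then have x: "0 < x" "x < p" by (auto simp: Zmod_def)
        then have "\<not> p dvd x" by (auto dest: dvd_imp_le)
        then have "coprime x p" using assms prime_imp_coprime coprime_commute by blast
        then obtain u v where "u * int x + v * int p = 1"
          using bezout_int[of "int x" "int p"] by auto
        then have "(int x * u) mod int p = 1"
          using p2 by (metis mod_mult_self2 mult.commute mod_pos_pos_trivial of_nat_le_iff
              add.commute numeral_le_iff of_nat_numeral zero_le_one one_less_numeral_iff
              order.strict_trans2 of_nat_less_iff semiring_norm(76) of_nat_1 less_le_trans)
        then have "(int x * (u mod int p)) mod int p = 1" by (simp add: mod_mult_right_eq)
        moreover define y where "y = nat (u mod int p)"
        ultimately have "int ((x * y) mod p) = 1" "y < p"
          using p2 by (auto simp: zmod_int nat_less_iff)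
        then have "(x * y) mod p = 1" "y < p" by simp_all
        then show "x \<in> Units (Zmod p)"
          using x by (auto simp: Units_def Zmod_def mult.commute)
      qed
    qed
  qed
qed

lemma finite_Zmod [simp]: "finite (carrier (Zmod p))" and card_Zmod [simp]: "card (carrier (Zmod p)) = p"
  by (simp_all add: Zmod_def)

section \<open>Coordinate subspaces and coordinate flags\<close>

context coord_space
begin

definition coords :: "nat set \<Rightarrow> nat list set" where
  "coords J = {x \<in> V. \<forall>c<r. c \<notin> J \<longrightarrow> x ! c = \<zero>}"

lemma subsp_coords [simp]: "subsp (coords J)"
  by (rule subspI) (auto simp: coords_def)

lemma coords_mono: "J \<subseteq> J' \<Longrightarrow> coords J \<subseteq> coords J'"
  by (auto simp: coords_def)

lemma coords_Int: "coords J \<inter> coords J' = coords (J \<inter> J')"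
  by (auto simp: coords_def)

lemma dim_coords:
  assumes "J \<subseteq> {..<r}"
  shows "dm (coords J) = card J"
proof (rule sdim_eqI)
  have "bij_betw (\<lambda>x. restrict ((!) x) J) (coords J) (PiE J (\<lambda>_. carrier R))"
  proof (rule bij_betw_byWitness[where f' = "\<lambda>g. map (\<lambda>c. if c \<in> J then g c else \<zero>) [0..<r]"])
    show "\<forall>x\<in>coords J. map (\<lambda>c. if c \<in> J then restrict ((!) x) J c else \<zero>) [0..<r] = x"
      by (auto simp: coords_def mem_V intro!: nth_equalityI)
    show "\<forall>g\<in>PiE J (\<lambda>_. carrier R). restrict ((!) (map (\<lambda>c. if c \<in> J then g c else \<zero>) [0..<r])) J = g"
      using assms by (auto simp: fun_eq_iff restrict_def PiE_def extensional_def subset_iff)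
    show "(\<lambda>x. restrict ((!) x) J) ` coords J \<subseteq> PiE J (\<lambda>_. carrier R)"
      using assms by (auto simp: coords_def subset_iff)
    show "(\<lambda>g. map (\<lambda>c. if c \<in> J then g c else \<zero>) [0..<r]) ` PiE J (\<lambda>_. carrier R) \<subseteq> coords J"
      by (auto simp: coords_def mem_V)
  qed
  then have "card (coords J) = card (PiE J (\<lambda>_. carrier R))" by (rule bij_betw_same_card)
  also have "\<dots> = q ^ card J" using assms finite_subset[OF assms] by (simp add: card_PiE)
  finally show "card (coords J) = q ^ card J" .
qed

text \<open>\<open>\<rho> c\<close> is the index at which the basis vector with number
  \<open>c\<close> enters the flag.\<close>

definition coord_flag :: "int \<Rightarrow> int \<Rightarrow> (nat \<Rightarrow> int) \<Rightarrow> int \<Rightarrow> nat list set" where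
  "coord_flag m n \<rho> i = (if i \<in> {m..n} then coords {c. c < r \<and> \<rho> c \<le> i} else {})"

lemma is_flag_coord_flag:
  assumes "m \<le> n" "\<And>c. c < r \<Longrightarrow> \<rho> c \<le> n"
  shows "is_flag R r m n (coord_flag m n \<rho>)"
proof -
  have "coords {c. c < r \<and> \<rho> c \<le> n} = V" using assms by (auto simp: coords_def)
  moreover have "coords {c. c < r \<and> \<rho> c \<le> i} \<subseteq> coords {c. c < r \<and> \<rho> c \<le> i + 1}" for i
    by (rule coords_mono) auto
  ultimately show ?thesis using assms(1) by (simp add: is_flag_def coord_flag_def)
qed

text \<open>The standard basis is labelled by triples of a row, a column and a counter, with
  \<open>C k l\<close> labels at \<open>(k,l)\<close>. One flag filters the basis by row, the other
  by column; intersections are again coordinate subspaces, and \<open>cum\<close> counts their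
  labels.\<close>

lemma ex_flags_of_type:
  assumes mn: "m \<le> n" and C: "C \<in> Xi m n (int r)"
  shows "\<exists>f1 f2. is_flag R r m n f1 \<and> is_flag R r m n f2 \<and> ftype R r m n f1 f2 = C"
proof -
  have C0: "C i j = 0" if "i \<notin> {m..n} \<or> j \<notin> {m..n}" for i j
    using C that by (auto simp: Xi_def tXi_def)
  have Cnn: "C i j \<ge> 0" for i j using C by (simp add: Xi_def)
  define S where "S i j = Sigma {m..i} (\<lambda>k. Sigma {m..j} (\<lambda>l. {..<nat (C k l)}))" for i j
  have cS: "int (card (S i j)) = cum m C i j" for i j
    using Cnn by (simp add: S_def cum_def)
  have "int (card (S n n)) = int r" using C unfolding cS by (simp add: Xi_def msum_def cum_def)
  then have "card (S n n) = r" by simp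
  moreover have "finite (S n n)" by (simp add: S_def)
  ultimately obtain b where b: "bij_betw b {0..<r} (S n n)" using ex_bij_betw_nat_finite by blast
  define f1 where "f1 = coord_flag m n (\<lambda>c. fst (b c))"
  define f2 where "f2 = coord_flag m n (\<lambda>c. fst (snd (b c)))"
  have bS: "b c \<in> S n n" if "c < r" for c using b that by (auto simp: bij_betw_def)
  have fl: "is_flag R r m n f1" "is_flag R r m n f2"
    unfolding f1_def f2_def using bS by (intro is_flag_coord_flag mn; force simp: S_def)+
  have "pos m f1 f2 i j = cum m C i j" if ij: "i \<in> {m..n}" "j \<in> {m..n}" for i j
  proof -
    let ?J = "{c. c < r \<and> fst (b c) \<le> i \<and> fst (snd (b c)) \<le> j}"
    have "flagat R r m f1 i \<inter> flagat R r m f2 j = coords ({c. c < r \<and> fst (b c) \<le> i} \<inter> {c. c < r \<and> fst (snd (b c)) \<le> j})"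
      using ij by (simp add: f1_def f2_def coord_flag_def coords_Int)
    also have "{c. c < r \<and> fst (b c) \<le> i} \<inter> {c. c < r \<and> fst (snd (b c)) \<le> j} = ?J" by auto
    finally have "pos m f1 f2 i j = int (card ?J)" by (simp add: pos_def dim_coords subset_iff)
    also have "b ` ?J = S i j"
    proof
      show "b ` ?J \<subseteq> S i j" using bS by (force simp: S_def)
      show "S i j \<subseteq> b ` ?J"
      proof
        fix s assume s: "s \<in> S i j"
        then have "s \<in> S n n" using ij by (auto simp: S_def)
        then obtain c where "c < r" "b c = s" using b by (force simp: bij_betw_def)
        then show "s \<in> b ` ?J" using s by (intro image_eqI[of _ _ c]) (auto simp: S_def)
      qed
    qed
    then have "card ?J = card (S i j)"
      using card_image[of b ?J] inj_on_subset[of b "{0..<r}" ?J] b by (auto simp: bij_betw_def subset_iff)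
    finally show ?thesis using cS by simp
  qed
  then have "ftype R r m n f1 f2 = C" using ftype_eq_iff[OF mn fl, of C] C0 by auto
  then show ?thesis using fl by blast
qed

end

text \<open>For uniqueness in the definite description, the counting condition is not vacuous over
  any prime field, so two candidates agree at infinitely many integers.\<close>

lemma gpoly_eqI:
  assumes mn: "m \<le> n" and C: "C \<in> Xi m n s"
    and p: "\<And>R f1 f2. coord_space R \<Longrightarrow> is_flag R (nat s) m n f1 \<Longrightarrow> is_flag R (nat s) m n f2 \<Longrightarrow>
      ftype R (nat s) m n f1 f2 = C \<Longrightarrow>
      int (card {f. is_flag R (nat s) m n f \<and> ftype R (nat s) m n f1 f = A \<and> ftype R (nat s) m n f f2 = B})
        = poly p (int (card (carrier R)))"
  shows "gpoly m n A B C = p"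
proof -
  have s: "msum m n C = s" "s \<ge> 0" using C by (auto simp: Xi_def msum_def intro!: sum_nonneg)
  have cs: "coord_space R" if "field R" "finite (carrier R)" for R
    using that by (simp add: coord_space_def coord_space_axioms_def)
  show ?thesis
    unfolding gpoly_def Let_def s
  proof (rule the_equality)
    show "\<forall>R :: nat ring. field R \<and> finite (carrier R) \<longrightarrow>
        (\<forall>f1 f2. is_flag R (nat s) m n f1 \<and> is_flag R (nat s) m n f2 \<and> ftype R (nat s) m n f1 f2 = C \<longrightarrow>
           int (card {f. is_flag R (nat s) m n f \<and> ftype R (nat s) m n f1 f = A \<and> ftype R (nat s) m n f f2 = B})
             = poly p (int (card (carrier R))))"
      using p cs by blast
  next
    fix p' assume p': "\<forall>R :: nat ring. field R \<and> finite (carrier R) \<longrightarrow>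
        (\<forall>f1 f2. is_flag R (nat s) m n f1 \<and> is_flag R (nat s) m n f2 \<and> ftype R (nat s) m n f1 f2 = C \<longrightarrow>
           int (card {f. is_flag R (nat s) m n f \<and> ftype R (nat s) m n f1 f = A \<and> ftype R (nat s) m n f f2 = B})
             = poly p' (int (card (carrier R))))"
    have "poly (p' - p) (int \<pi>) = 0" if "prime \<pi>" for \<pi> :: nat
    proof -
      interpret coord_space "Zmod \<pi>" "nat s" using cs field_Zmod[OF that] by simp
      obtain f1 f2 where "is_flag (Zmod \<pi>) (nat s) m n f1" "is_flag (Zmod \<pi>) (nat s) m n f2"
        "ftype (Zmod \<pi>) (nat s) m n f1 f2 = C"
      proof -
        have "C \<in> Xi m n (int (nat s))" using C s by simp
        then show ?thesis using ex_flags_of_type[OF mn] that by blast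
      qed
      then show ?thesis
        using p[OF cs[OF field_Zmod[OF that] finite_Zmod]] p' field_Zmod[OF that] by force
    qed
    then have "int ` {\<pi>. prime \<pi>} \<subseteq> {x. poly (p' - p) x = 0}" by auto
    moreover have "infinite (int ` {\<pi> :: nat. prime \<pi>})"
      using primes_infinite by (simp add: finite_image_iff)
    ultimately have "infinite {x. poly (p' - p) x = 0}" using finite_subset by blast
    then have "p' - p = 0" using poly_roots_finite by blast
    then show "p' = p" by simp
  qed
qed

section \<open>Stable kernels\<close>

text \<open>A kernel takes \<open>a\<close>, \<open>m\<close>, \<open>n\<close>, the field, the dimension and two flags; \<open>conv\<close> is the product \<open>e\<^sub>A e\<^sub>B\<close>.\<close>

type_synonym kernel = "int \<Rightarrow> int \<Rightarrow> int \<Rightarrow> nat ring \<Rightarrow> nat \<Rightarrow>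
  (int \<Rightarrow> nat list set) \<Rightarrow> (int \<Rightarrow> nat list set) \<Rightarrow> int"

definition orbit :: "mat \<Rightarrow> kernel" where
  "orbit X a m n R r f1 f2 = (if ftype R r m n f1 f2 = ext a m n X then 1 else 0)"

definition conv :: "kernel \<Rightarrow> kernel \<Rightarrow> kernel" where
  "conv F G a m n R r f1 f2 = (\<Sum>f | is_flag R r m n f. F a m n R r f1 f * G a m n R r f f2)"

text \<open>\<open>k a\<close> is a polynomial in the field size and \<open>e a\<close> the exponent
  that normalises it; for the coefficient of \<open>e_X\<close> in \<open>e_A e_B\<close> this is
  \<open>d_A + d_B - d_X\<close>, taken for the extended matrices. Small \<open>a\<close> are
  excluded because the extended matrices may then have negative entries.\<close>

definition stable :: "(int \<Rightarrow> int) \<Rightarrow> (int \<Rightarrow> int poly) \<Rightarrow> bool" where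
  "stable e k \<longleftrightarrow> (\<exists>p\<in>Z1. \<exists>a0. \<forall>a\<ge>a0. phi (k a) * vv powi (- e a) = poly p (vv powi (- a)))"

lemma stable_0: "stable e (\<lambda>_. 0)"
  unfolding stable_def by (intro bexI[of _ 0]) auto

lemma stable_const:
  assumes "\<And>a. e a = c"
  shows "stable e (\<lambda>_. of_int i)"
proof -
  have "phi (of_int i) = of_int i"
  proof -
    have "of_int i = [:i:]" by (simp add: of_int_poly)
    then show ?thesis by (simp add: phi_pCons)
  qed
  then have "phi (of_int i) * vv powi (- e a) = poly (of_int i * [:vv powi (- c):]) (vv powi (- a))" for a
    using assms by simp
  then show ?thesis unfolding stable_def using Z1.mult[OF Z1_of_int gen_v] by blast
qed

lemma stable_add:
  assumes "stable e k" "stable e k'"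
  shows "stable e (\<lambda>a. k a + k' a)"
proof -
  obtain p a0 where p: "p \<in> Z1" "\<forall>a\<ge>a0. phi (k a) * vv powi (- e a) = poly p (vv powi (- a))"
    using assms(1) unfolding stable_def by blast
  obtain p' a0' where p': "p' \<in> Z1" "\<forall>a\<ge>a0'. phi (k' a) * vv powi (- e a) = poly p' (vv powi (- a))"
    using assms(2) unfolding stable_def by blast
  have "\<forall>a\<ge>max a0 a0'. phi (k a + k' a) * vv powi (- e a) = poly (p + p') (vv powi (- a))"
    using p p' by (simp add: phi_add distrib_right)
  then show ?thesis unfolding stable_def using Z1.add[OF p(1) p'(1)] by blast
qed

lemma stable_mult:
  assumes "stable e k" "stable e' k'" "\<And>a. e'' a = e a + e' a"
  shows "stable e'' (\<lambda>a. k a * k' a)"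
proof -
  obtain p a0 where p: "p \<in> Z1" "\<forall>a\<ge>a0. phi (k a) * vv powi (- e a) = poly p (vv powi (- a))"
    using assms(1) unfolding stable_def by blast
  obtain p' a0' where p': "p' \<in> Z1" "\<forall>a\<ge>a0'. phi (k' a) * vv powi (- e' a) = poly p' (vv powi (- a))"
    using assms(2) unfolding stable_def by blast
  have "phi (k a * k' a) * vv powi (- e'' a) = poly (p * p') (vv powi (- a))" if "a \<ge> max a0 a0'" for a
  proof -
    have "phi (k a * k' a) * vv powi (- e'' a) =
        (phi (k a) * vv powi (- e a)) * (phi (k' a) * vv powi (- e' a))"
      using power_int_add[of vv "- e a" "- e' a"] assms(3) by (simp add: phi_mult mult_ac)
    then show ?thesis using p p' that by simp
  qed
  then show ?thesis unfolding stable_def using Z1.mult[OF p(1) p'(1)] by blast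
qed

section \<open>Expansions with stable coefficients\<close>

locale window =
  fixes m0 n0 :: int
  assumes m0n0: "m0 \<le> n0"
begin

text \<open>The dimension is left arbitrary: a flag type whose entries do not add up to it never occurs.\<close>

definition adm :: "int \<Rightarrow> int \<Rightarrow> int \<Rightarrow> int \<Rightarrow> nat ring \<Rightarrow> nat \<Rightarrow>
    (int \<Rightarrow> nat list set) \<Rightarrow> (int \<Rightarrow> nat list set) \<Rightarrow> bool" where
  "adm a0 a m n R r f1 f2 \<longleftrightarrow> a \<ge> a0 \<and> m \<le> m0 \<and> n0 \<le> n \<and> coord_space R \<and> is_flag R r m n f1 \<and> is_flag R r m n f2"

text \<open>\<open>K\<close> depends on \<open>a\<close> and \<open>X\<close> only, not on
  \<open>m\<close>, \<open>n\<close>, the field or the flags: this is the uniformity to be proved.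
  \<open>e\<close> is the exponent attached to \<open>F\<close>, and the common row sum
  \<open>\<rho>\<close> keeps every term composable with an elementary factor on the left.\<close>

definition expands :: "(int \<Rightarrow> int) \<Rightarrow> (int \<Rightarrow> int) \<Rightarrow> kernel \<Rightarrow> mat set \<Rightarrow> (int \<Rightarrow> mat \<Rightarrow> int poly) \<Rightarrow> int \<Rightarrow> bool" where
  "expands \<rho> e F Xs K a0 \<longleftrightarrow> finite Xs \<and>
    (\<forall>X\<in>Xs. X \<in> tXi m0 n0 \<and> ro m0 n0 X = \<rho> \<and> stable (\<lambda>a. e a - dd m0 n0 a X) (\<lambda>a. K a X)) \<and>
    (\<forall>a m n R r f1 f2. adm a0 a m n R r f1 f2 \<longrightarrow>
      F a m n R r f1 f2 = (\<Sum>X\<in>Xs. poly (K a X) (int (card (carrier R))) * orbit X a m n R r f1 f2))"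

definition stable_kernel :: "(int \<Rightarrow> int) \<Rightarrow> (int \<Rightarrow> int) \<Rightarrow> kernel \<Rightarrow> bool" where
  "stable_kernel \<rho> e F \<longleftrightarrow> (\<exists>Xs K a0. expands \<rho> e F Xs K a0)"

lemma stable_kernel_0:
  assumes "\<And>a m n R r f1 f2. adm a0 a m n R r f1 f2 \<Longrightarrow> F a m n R r f1 f2 = 0"
  shows "stable_kernel \<rho> e F"
  unfolding stable_kernel_def expands_def using assms by (intro exI[of _ "{}"] exI[of _ a0]) auto

text \<open>The exponents \<open>e\<close> and \<open>e'\<close> may differ, as long as the scalar
  \<open>k\<close> is stable for their difference.\<close>

lemma stable_kernel_add:
  assumes F1: "stable_kernel \<rho> e' F1" and k: "stable (\<lambda>a. e a - e' a) k" and F2: "stable_kernel \<rho> e F2"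
    and F: "\<And>a m n R r f1 f2. adm a0 a m n R r f1 f2 \<Longrightarrow> F a m n R r f1 f2 =
      poly (k a) (int (card (carrier R))) * F1 a m n R r f1 f2 + F2 a m n R r f1 f2"
  shows "stable_kernel \<rho> e F"
proof -
  obtain Xs1 K1 a1 where 1: "expands \<rho> e' F1 Xs1 K1 a1" using F1 unfolding stable_kernel_def by blast
  obtain Xs2 K2 a2 where 2: "expands \<rho> e F2 Xs2 K2 a2" using F2 unfolding stable_kernel_def by blast
  have fin: "finite Xs1" "finite Xs2" using 1 2 by (simp_all add: expands_def)
  define K where "K a X = (if X \<in> Xs1 then k a * K1 a X else 0) + (if X \<in> Xs2 then K2 a X else 0)" for a X
  have "expands \<rho> e F (Xs1 \<union> Xs2) K (max a0 (max a1 a2))"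
    unfolding expands_def
  proof (intro conjI ballI allI impI)
    show "finite (Xs1 \<union> Xs2)" using fin by simp
    fix X assume X: "X \<in> Xs1 \<union> Xs2"
    show "X \<in> tXi m0 n0" "ro m0 n0 X = \<rho>" using X 1 2 by (auto simp: expands_def)
    have "stable (\<lambda>a. e a - dd m0 n0 a X) (\<lambda>a. if X \<in> Xs1 then k a * K1 a X else 0)"
    proof (cases "X \<in> Xs1")
      case True
      then have "stable (\<lambda>a. e' a - dd m0 n0 a X) (\<lambda>a. K1 a X)" using 1 by (simp add: expands_def)
      from stable_mult[OF k this] show ?thesis using True by simp
    qed (simp add: stable_0)
    moreover have "stable (\<lambda>a. e a - dd m0 n0 a X) (\<lambda>a. if X \<in> Xs2 then K2 a X else 0)"
      using 2 by (cases "X \<in> Xs2") (simp_all add: stable_0 expands_def)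
    ultimately show "stable (\<lambda>a. e a - dd m0 n0 a X) (\<lambda>a. K a X)"
      unfolding K_def by (rule stable_add)
  next
    fix a m n R r f1 f2 assume adm: "adm (max a0 (max a1 a2)) a m n R r f1 f2"
    let ?q = "int (card (carrier R))" and ?O = "\<lambda>X. orbit X a m n R r f1 f2"
    have a: "adm a0 a m n R r f1 f2" "adm a1 a m n R r f1 f2" "adm a2 a m n R r f1 f2"
      using adm by (auto simp: adm_def)
    have "(\<Sum>X\<in>Xs1 \<union> Xs2. poly (K a X) ?q * ?O X) =
      (\<Sum>X\<in>Xs1 \<union> Xs2. if X \<in> Xs1 then poly (k a) ?q * (poly (K1 a X) ?q * ?O X) else 0) +
      (\<Sum>X\<in>Xs1 \<union> Xs2. if X \<in> Xs2 then poly (K2 a X) ?q * ?O X else 0)"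
      unfolding sum.distrib[symmetric] by (intro sum.cong refl) (simp add: K_def algebra_simps)
    also have "\<dots> = poly (k a) ?q * F1 a m n R r f1 f2 + F2 a m n R r f1 f2"
    proof -
      have "(\<Sum>X\<in>Xs1 \<union> Xs2. if X \<in> Xs1 then h X else 0) = (\<Sum>X\<in>Xs1. h X)"
        "(\<Sum>X\<in>Xs1 \<union> Xs2. if X \<in> Xs2 then h X else 0) = (\<Sum>X\<in>Xs2. h X)" for h :: "mat \<Rightarrow> int"
        using fin by (simp_all add: sum.inter_restrict[symmetric] Int_absorb1 Int_absorb2)
      then show ?thesis using 1 2 a by (simp add: expands_def sum_distrib_left)
    qed
    finally show "F a m n R r f1 f2 = (\<Sum>X\<in>Xs1 \<union> Xs2. poly (K a X) ?q * ?O X)" using F a by simp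
  qed
  then show ?thesis unfolding stable_kernel_def by blast
qed

lemma stable_kernel_sum:
  assumes "finite I"
    and "\<And>i. i \<in> I \<Longrightarrow> stable_kernel \<rho> (e' i) (H i)"
    and "\<And>i. i \<in> I \<Longrightarrow> stable (\<lambda>a. e a - e' i a) (\<lambda>a. K a i)"
    and "\<And>a m n R r f1 f2. adm a0 a m n R r f1 f2 \<Longrightarrow>
      F a m n R r f1 f2 = (\<Sum>i\<in>I. poly (K a i) (int (card (carrier R))) * H i a m n R r f1 f2)"
  shows "stable_kernel \<rho> e F"
  using assms
proof (induction I arbitrary: F rule: finite_induct)
  case empty
  then show ?case by (intro stable_kernel_0[of a0]) auto
next
  case (insert i I)
  let ?F2 = "\<lambda>a m n R r f1 f2. \<Sum>i\<in>I. poly (K a i) (int (card (carrier R))) * H i a m n R r f1 f2"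
  have "stable_kernel \<rho> e ?F2" by (rule insert.IH) (use insert.prems in auto)
  then show ?case
    by (rule stable_kernel_add[OF insert.prems(1)[of i] insert.prems(2)[of i], rotated 2])
      (use insert in auto)
qed

lemma stable_kernel_orbit:
  assumes "A \<in> tXi m0 n0"
  shows "stable_kernel (ro m0 n0 A) (\<lambda>a. dd m0 n0 a A) (orbit A)"
proof -
  have "expands (ro m0 n0 A) (\<lambda>a. dd m0 n0 a A) (orbit A) {A} (\<lambda>_ _. 1) 0"
    using assms stable_const[of "\<lambda>_. 0" 0 1] by (simp add: expands_def)
  then show ?thesis unfolding stable_kernel_def by blast
qed

lemma adm_flags:
  assumes "adm a0 a m n R r f1 f2"
  shows "finite {f. is_flag R r m n f}"
    "is_flag R r m n f \<Longrightarrow> adm a0 a m n R r f1 f" "is_flag R r m n f \<Longrightarrow> adm a0 a m n R r f f2"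
  using assms coord_space.finite_flags by (auto simp: adm_def)

lemma conv_cong_right:
  assumes "adm a0 a m n R r f1 f2"
    and "\<And>f. adm a0 a m n R r f f2 \<Longrightarrow> G a m n R r f f2 = G' a m n R r f f2"
  shows "conv F G a m n R r f1 f2 = conv F G' a m n R r f1 f2"
  unfolding conv_def using adm_flags[OF assms(1)] assms(2) by (intro sum.cong) auto

lemma conv_cong_left:
  assumes "adm a0 a m n R r f1 f2"
    and "\<And>f. adm a0 a m n R r f1 f \<Longrightarrow> F a m n R r f1 f = F' a m n R r f1 f"
  shows "conv F G a m n R r f1 f2 = conv F' G a m n R r f1 f2"
  unfolding conv_def using adm_flags[OF assms(1)] assms(2) by (intro sum.cong) auto

lemma conv_assoc:
  "conv (conv F G) H a m n R r f1 f2 = conv F (conv G H) a m n R r f1 f2"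
proof -
  let ?S = "{f. is_flag R r m n f}"
  have "conv (conv F G) H a m n R r f1 f2 =
      (\<Sum>f\<in>?S. \<Sum>f'\<in>?S. F a m n R r f1 f' * G a m n R r f' f * H a m n R r f f2)"
    by (simp add: conv_def sum_distrib_right)
  also have "\<dots> = (\<Sum>f'\<in>?S. \<Sum>f\<in>?S. F a m n R r f1 f' * G a m n R r f' f * H a m n R r f f2)"
    by (rule sum.swap)
  also have "\<dots> = conv F (conv G H) a m n R r f1 f2"
    by (simp add: conv_def sum_distrib_left mult.assoc)
  finally show ?thesis .
qed

lemma conv_sum_right:
  "conv F (\<lambda>a m n R r f1 f2. \<Sum>i\<in>I. c a R i * H i a m n R r f1 f2) a m n R r f1 f2 =
    (\<Sum>i\<in>I. c a R i * conv F (H i) a m n R r f1 f2)"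
  unfolding conv_def by (simp add: sum_distrib_left mult_ac sum.swap[of _ I])

lemma conv_sum_left:
  "conv (\<lambda>a m n R r f1 f2. \<Sum>i\<in>I. c a R i * H i a m n R r f1 f2) F a m n R r f1 f2 =
    (\<Sum>i\<in>I. c a R i * conv (H i) F a m n R r f1 f2)"
  unfolding conv_def by (simp add: sum_distrib_left sum_distrib_right mult_ac sum.swap[of _ I])

text \<open>By linearity it is enough to multiply single orbits, and an expansion of
  \<open>F\<close> contains only matrices with row sums \<open>\<rho>\<close>, the ones to which
  \<open>E\<close> applies.\<close>

lemma stable_kernel_conv_right:
  assumes F: "stable_kernel \<rho> e F"
    and E: "\<And>X. X \<in> tXi m0 n0 \<Longrightarrow> ro m0 n0 X = \<rho> \<Longrightarrow>
      stable_kernel \<rho>' (\<lambda>a. eE a + dd m0 n0 a X) (conv G (orbit X))"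
  shows "stable_kernel \<rho>' (\<lambda>a. eE a + e a) (conv G F)"
proof -
  obtain Xs K a0 where ex: "expands \<rho> e F Xs K a0" using F unfolding stable_kernel_def by blast
  show ?thesis
  proof (rule stable_kernel_sum[where I = Xs and H = "\<lambda>X. conv G (orbit X)"])
    show "finite Xs" using ex by (simp add: expands_def)
    show "stable_kernel \<rho>' (\<lambda>a. eE a + dd m0 n0 a X) (conv G (orbit X))" if "X \<in> Xs" for X
      using that ex by (intro E) (auto simp: expands_def)
    show "stable (\<lambda>a. eE a + e a - (eE a + dd m0 n0 a X)) (\<lambda>a. K a X)" if "X \<in> Xs" for X
      using that ex by (auto simp: expands_def)
    fix a m n R r f1 f2 assume adm: "adm a0 a m n R r f1 f2"
    have "conv G F a m n R r f1 f2 =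
      conv G (\<lambda>a m n R r f1 f2. \<Sum>X\<in>Xs. poly (K a X) (int (card (carrier R))) * orbit X a m n R r f1 f2) a m n R r f1 f2"
      by (rule conv_cong_right[OF adm]) (use ex in \<open>auto simp: expands_def\<close>)
    then show "conv G F a m n R r f1 f2 =
      (\<Sum>X\<in>Xs. poly (K a X) (int (card (carrier R))) * conv G (orbit X) a m n R r f1 f2)"
      by (simp add: conv_sum_right)
  qed
qed

end

section \<open>The elementary product formula\<close>

lemma tXi_zero: "X \<in> tXi m n \<Longrightarrow> i \<notin> {m..n} \<or> j \<notin> {m..n} \<Longrightarrow> X i j = 0"
  by (auto simp: tXi_def)

lemma tXi_nonneg: "X \<in> tXi m n \<Longrightarrow> i \<noteq> j \<Longrightarrow> X i j \<ge> 0"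
  by (cases "i \<in> {m..n} \<and> j \<in> {m..n}") (auto simp: tXi_def)

lemma ext_apply: "i \<in> {m..n} \<Longrightarrow> j \<in> {m..n} \<Longrightarrow> ext a m n X i j = X i j + (if i = j then a else 0)"
  by (simp add: ext_def)

lemma ext_zero: "i \<notin> {m..n} \<or> j \<notin> {m..n} \<Longrightarrow> ext a m n X i j = 0"
  by (auto simp: ext_def)

lemma row_sum_ext:
  assumes "X \<in> tXi m0 n0" "m \<le> m0" "n0 \<le> n" "k \<in> {m..n}"
  shows "(\<Sum>l\<in>{m..n}. ext a m n X k l) = ro m0 n0 X k + a"
proof -
  have "(\<Sum>l\<in>{m..n}. ext a m n X k l) = (\<Sum>l\<in>{m..n}. X k l) + (\<Sum>l\<in>{m..n}. if k = l then a else 0)"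
    unfolding sum.distrib[symmetric] using assms(4) by (intro sum.cong) (auto simp: ext_apply)
  also have "(\<Sum>l\<in>{m..n}. X k l) = ro m0 n0 X k"
    unfolding ro_def using assms tXi_zero[OF assms(1)] by (intro sum_restrict_int) auto
  finally show ?thesis using assms(4) by (simp add: sum_int_delta)
qed

lemma col_sum_ext:
  assumes "X \<in> tXi m0 n0" "m \<le> m0" "n0 \<le> n" "l \<in> {m..n}"
  shows "(\<Sum>k\<in>{m..n}. ext a m n X k l) = co m0 n0 X l + a"
proof -
  have "(\<Sum>k\<in>{m..n}. ext a m n X k l) = (\<Sum>k\<in>{m..n}. X k l) + (\<Sum>k\<in>{m..n}. if l = k then a else 0)"
    unfolding sum.distrib[symmetric] using assms(4) by (intro sum.cong) (auto simp: ext_apply)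
  also have "(\<Sum>k\<in>{m..n}. X k l) = co m0 n0 X l"
    unfolding co_def using assms tXi_zero[OF assms(1)] by (intro sum_restrict_int) auto
  finally show ?thesis using assms(4) by (simp add: sum_int_delta)
qed

lemma cum_ext_right:
  assumes "X \<in> tXi m0 n0" "m \<le> m0" "n0 \<le> n" "i \<le> n"
  shows "cum m (ext a m n X) i n = (\<Sum>k\<in>{m..i}. ro m0 n0 X k + a)"
  unfolding cum_def using assms row_sum_ext by (intro sum.cong) auto

lemma cum_ext_bottom:
  assumes "X \<in> tXi m0 n0" "m \<le> m0" "n0 \<le> n" "j \<le> n"
  shows "cum m (ext a m n X) n j = (\<Sum>l\<in>{m..j}. co m0 n0 X l + a)"
  unfolding cum_def using assms col_sum_ext by (subst sum.swap, intro sum.cong) auto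

lemma ext_elem:
  assumes "x \<in> {m..n}" "y \<in> {m..n}"
  shows "ext a m n (elem x y t e) = elem x y t (\<lambda>i. if i \<in> {m..n} then e i + a else 0)"
  using assms by (intro ext) (auto simp: ext_def elem_def)

lemma ext_inj:
  assumes "X \<in> tXi m0 n0" "Y \<in> tXi m0 n0" "m \<le> m0" "n0 \<le> n" "ext a m n X = ext a m n Y"
  shows "X = Y"
proof (intro ext)
  fix i j
  show "X i j = Y i j"
  proof (cases "i \<in> {m0..n0} \<and> j \<in> {m0..n0}")
    case True
    then show ?thesis using fun_cong[OF fun_cong[OF assms(5)], of i j] assms(3,4) by (simp add: ext_apply)
  next
    case False
    then show ?thesis using tXi_zero[OF assms(1)] tXi_zero[OF assms(2)] by simp
  qed
qed

section \<open>Multiplication by an elementary orbit on the left\<close>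

context window
begin

text \<open>The matrices that can occur in \<open>e_E e_A\<close>: in column \<open>j\<close>,
  \<open>X x j - A x j\<close> units are moved from row \<open>y\<close> to row \<open>x\<close>,
  and \<open>t\<close> units altogether.\<close>

definition elem_terms :: "int \<Rightarrow> int \<Rightarrow> int \<Rightarrow> mat \<Rightarrow> mat set" where
  "elem_terms x y t A = {X \<in> tXi m0 n0. (\<forall>i j. i \<noteq> x \<longrightarrow> i \<noteq> y \<longrightarrow> X i j = A i j) \<and>
     (\<forall>j. X x j + X y j = A x j + A y j) \<and> (\<forall>j. A x j \<le> X x j) \<and>
     (\<Sum>j\<in>{m0..n0}. X x j - A x j) = t}"

text \<open>The count from \<open>card_conv_elem\<close> for extended matrices, but evaluated on the
  fixed window; \<open>elem_coef_ext\<close> shows that larger windows give the same value.\<close>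

definition elem_coef :: "int \<Rightarrow> int \<Rightarrow> mat \<Rightarrow> int \<Rightarrow> mat \<Rightarrow> int poly" where
  "elem_coef x y A a X = (\<Prod>j\<in>{m0..n0}. gb (nat (ext a m0 n0 X x j)) (nat (X x j - A x j))) *
     [:0, 1:] ^ nat (\<Sum>u\<in>{m0..n0}. \<Sum>j\<in>{m0..n0}.
       if bef x y u j then (X x u - A x u) * ext a m0 n0 A x j else 0)"

lemma finite_elem_terms:
  assumes "A \<in> tXi m0 n0"
  shows "finite (elem_terms x y t A)"
proof -
  let ?B = "\<Union>j\<in>{m0..n0}. {A x j..A x j + t}"
  let ?F = "{g. \<forall>j. (j \<in> {m0..n0} \<longrightarrow> g j \<in> ?B) \<and> (j \<notin> {m0..n0} \<longrightarrow> g j = 0)}"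
  let ?M = "\<lambda>g i j. if i = x then g j else if i = y then A x j + A y j - g j else A i j"
  have "elem_terms x y t A \<subseteq> ?M ` ?F"
  proof
    fix X assume X: "X \<in> elem_terms x y t A"
    have "X = ?M (X x)" using X by (auto simp: elem_terms_def fun_eq_iff algebra_simps)
    moreover have "X x j \<in> ?B" if j: "j \<in> {m0..n0}" for j
    proof -
      have "X x j - A x j \<le> (\<Sum>j\<in>{m0..n0}. X x j - A x j)"
        using X j by (intro member_le_sum) (auto simp: elem_terms_def)
      then have "X x j \<in> {A x j..A x j + t}" using X by (auto simp: elem_terms_def)
      then show ?thesis using j by blast
    qed
    moreover have "X x j = 0" if "j \<notin> {m0..n0}" for j
      using X that tXi_zero[of X m0 n0] by (auto simp: elem_terms_def)
    ultimately show "X \<in> ?M ` ?F" by blast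
  qed
  moreover have "finite ?F" by (rule finite_set_of_finite_funs) auto
  ultimately show ?thesis using finite_surj by blast
qed

text \<open>The row sums of the type determine the dimensions of the first flag. This serves to
  discard flags of wrong dimensions and to recover a row sum from a flag.\<close>

lemma dims_of_ext_type:
  assumes "adm a0 a m n R r f1 f2" "X \<in> tXi m0 n0" "ftype R r m n f1 f2 = ext a m n X" "i \<in> {m..n}"
  shows "int (sdim R (f1 i)) = (\<Sum>k\<in>{m..i}. ro m0 n0 X k + a)"
proof -
  have adm: "m \<le> m0" "n0 \<le> n" "m \<le> n" "is_flag R r m n f1" "is_flag R r m n f2"
    using assms(1) m0n0 by (auto simp: adm_def)
  interpret coord_space R r using assms(1) by (simp add: adm_def)
  have "int (dm (f1 i)) = pos m f1 f2 i n"
    using pos_top(1)[OF adm(3-5), of i] assms(4) by simp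
  also have "\<dots> = cum m (ext a m n X) i n"
    using cum_ftype[OF adm(3-5), of i n] assms(3,4) adm by simp
  finally show ?thesis using cum_ext_right[OF assms(2) adm(1,2)] assms(4) by simp
qed

lemma conv_orbit:
  assumes "adm a0 a m n R r f1 f2"
  shows "conv (orbit E) (orbit B) a m n R r f1 f2 =
    int (card {f. is_flag R r m n f \<and> ftype R r m n f1 f = ext a m n E \<and> ftype R r m n f f2 = ext a m n B})"
proof -
  have "conv (orbit E) (orbit B) a m n R r f1 f2 = (\<Sum>f | is_flag R r m n f.
      if ftype R r m n f1 f = ext a m n E \<and> ftype R r m n f f2 = ext a m n B then 1 else 0)"
    unfolding conv_def orbit_def by (intro sum.cong) auto
  also have "\<dots> = int (card ({f. is_flag R r m n f} \<inter>
      {f. ftype R r m n f1 f = ext a m n E \<and> ftype R r m n f f2 = ext a m n B}))"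
    using adm_flags(1)[OF assms] by (simp add: sum.If_cases)
  also have "{f. is_flag R r m n f} \<inter> {f. ftype R r m n f1 f = ext a m n E \<and> ftype R r m n f f2 = ext a m n B} =
    {f. is_flag R r m n f \<and> ftype R r m n f1 f = ext a m n E \<and> ftype R r m n f f2 = ext a m n B}" by auto
  finally show ?thesis .
qed

context
  fixes x y t e A
  assumes xy: "x \<in> {m0..n0}" "y \<in> {m0..n0}" "y = x + 1 \<or> x = y + 1"
    and t: "t \<ge> 0"
    and e0: "\<And>i. i \<notin> {m0..n0} \<Longrightarrow> e i = 0"
    and A: "A \<in> tXi m0 n0"
    and comp: "co m0 n0 (elem x y t e) = ro m0 n0 A"
begin

lemma x_ne_y: "x \<noteq> y"
  using xy by auto

lemma elem_tXi: "elem x y t e \<in> tXi m0 n0"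
  using xy t e0 by (auto simp: tXi_def elem_def)

lemma ro_elem: "i \<in> {m0..n0} \<Longrightarrow> ro m0 n0 (elem x y t e) i = e i + (if i = x then t else 0)"
proof -
  assume i: "i \<in> {m0..n0}"
  have "ro m0 n0 (elem x y t e) i =
    (\<Sum>j\<in>{m0..n0}. if i = j then e i else 0) + (\<Sum>j\<in>{m0..n0}. if y = j then (if i = x then t else 0) else 0)"
    unfolding ro_def sum.distrib[symmetric] by (intro sum.cong) (auto simp: elem_def)
  then show ?thesis using i xy by (simp add: sum_int_delta)
qed

lemma co_elem: "j \<in> {m0..n0} \<Longrightarrow> co m0 n0 (elem x y t e) j = e j + (if j = y then t else 0)"
proof -
  assume j: "j \<in> {m0..n0}"
  have "co m0 n0 (elem x y t e) j =
    (\<Sum>i\<in>{m0..n0}. if j = i then e j else 0) + (\<Sum>i\<in>{m0..n0}. if x = i then (if j = y then t else 0) else 0)"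
    unfolding co_def sum.distrib[symmetric] by (intro sum.cong) (auto simp: elem_def)
  then show ?thesis using j xy by (simp add: sum_int_delta)
qed

lemma ro_A: "j \<in> {m0..n0} \<Longrightarrow> ro m0 n0 A j = e j + (if j = y then t else 0)"
  using co_elem comp by simp

lemma ro_elem_terms:
  assumes "X \<in> elem_terms x y t A"
  shows "ro m0 n0 X = ro m0 n0 (elem x y t e)"
proof
  fix i
  have X: "X \<in> tXi m0 n0" "\<And>i j. i \<noteq> x \<Longrightarrow> i \<noteq> y \<Longrightarrow> X i j = A i j" "\<And>j. X y j = A x j + A y j - X x j"
    "(\<Sum>j\<in>{m0..n0}. X x j - A x j) = t"
    using assms by (auto simp: elem_terms_def algebra_simps)
  show "ro m0 n0 X i = ro m0 n0 (elem x y t e) i"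
  proof (cases "i \<in> {m0..n0}")
    case True
    have "ro m0 n0 X x - ro m0 n0 A x = t" using X(4) by (simp add: ro_def sum_subtractf)
    moreover have "ro m0 n0 X y = ro m0 n0 A x + ro m0 n0 A y - ro m0 n0 X x"
      unfolding ro_def X(3) by (simp add: sum_subtractf sum.distrib)
    moreover have "ro m0 n0 X i = ro m0 n0 A i" if "i \<noteq> x" "i \<noteq> y"
      using X(2)[OF that] by (simp add: ro_def)
    ultimately show ?thesis using ro_elem[OF True] ro_A[OF True] xy x_ne_y by (cases "i = x"; cases "i = y") auto
  next
    case False
    then show ?thesis using tXi_zero[OF X(1)] tXi_zero[OF elem_tXi] by (simp add: ro_def)
  qed
qed

lemma co_elem_terms:
  assumes "X \<in> elem_terms x y t A"
  shows "co m0 n0 X = co m0 n0 A"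
proof
  fix j
  have X: "\<And>i j. i \<noteq> x \<Longrightarrow> i \<noteq> y \<Longrightarrow> X i j = A i j" "X x j - A x j + (X y j - A y j) = 0"
    using assms by (auto simp: elem_terms_def algebra_simps)
  have "(\<Sum>i\<in>{m0..n0}. X i j - A i j) = (\<Sum>i\<in>{x, y}. X i j - A i j)"
    using xy X by (intro sum.mono_neutral_right) auto
  then show "co m0 n0 X j = co m0 n0 A j" using X x_ne_y by (simp add: co_def sum_subtractf)
qed

lemma wt_elem: "wt m0 n0 (elem x y t e) = t"
proof -
  have "wt m0 n0 (elem x y t e) = (\<Sum>i\<in>{m0..n0}. \<Sum>j\<in>{m0..n0}. if y = j then (if x = i then t else 0) else 0)"
    unfolding wt_def using xy by (intro sum.cong refl) (auto simp: elem_def)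
  then show ?thesis using xy by (simp add: sum_int_delta)
qed

lemma wt_elem_terms:
  assumes "X \<in> elem_terms x y t A"
  shows "wt m0 n0 X - wt m0 n0 A = (\<Sum>j\<in>{m0..n0}. (\<bar>x - j\<bar> - \<bar>y - j\<bar>) * (X x j - A x j))"
proof -
  have X: "\<And>i j. i \<noteq> x \<Longrightarrow> i \<noteq> y \<Longrightarrow> X i j = A i j" "\<And>j. X y j = A x j + A y j - X x j"
    using assms by (auto simp: elem_terms_def algebra_simps)
  have "wt m0 n0 X - wt m0 n0 A = (\<Sum>i\<in>{m0..n0}. \<Sum>j\<in>{m0..n0}. \<bar>i - j\<bar> * (X i j - A i j))"
    by (simp add: wt_def sum_subtractf[symmetric] algebra_simps)
  also have "\<dots> = (\<Sum>i\<in>{x, y}. \<Sum>j\<in>{m0..n0}. \<bar>i - j\<bar> * (X i j - A i j))"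
    using xy X by (intro sum.mono_neutral_right) auto
  also have "\<dots> = (\<Sum>j\<in>{m0..n0}. (\<bar>x - j\<bar> - \<bar>y - j\<bar>) * (X x j - A x j))"
    using x_ne_y by (simp add: sum.distrib[symmetric] X(2) algebra_simps)
  finally show ?thesis .
qed

text \<open>Three powers of \<open>v\<close> with exponents linear in \<open>a\<close> meet: the one
  released by the binomial of the diagonal entry \<open>(x,x)\<close>, the power of \<open>q\<close>
  in the count, and the normalisation. By \<open>key\<close> their total does not depend on
  \<open>a\<close>, so only a constant power and one \<open>qpoly\<close> remain.\<close>

lemma stable_elem_coef:
  assumes X: "X \<in> elem_terms x y t A"
  shows "stable (\<lambda>a. dd m0 n0 a (elem x y t e) + dd m0 n0 a A - dd m0 n0 a X) (\<lambda>a. elem_coef x y A a X)"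
proof -
  let ?E = "elem x y t e" and ?I = "{m0..n0}"
  define u where "u j = X x j - A x j" for j
  have u: "u j \<ge> 0" "(\<Sum>j\<in>?I. u j) = t" for j using X by (auto simp: elem_terms_def u_def)
  \<comment> \<open>The exponent of \<open>q\<close> is affine in \<open>a\<close>. Its slope
    \<open>S1\<close> counts the units moved in those columns beyond which the diagonal entry
    \<open>(x,x)\<close> lies.\<close>
  define S0 where "S0 = (\<Sum>i\<in>?I. \<Sum>j\<in>?I. if bef x y i j then u i * A x j else 0)"
  define S1 where "S1 = (\<Sum>i\<in>?I. if bef x y i x then u i else 0)"
  have S: "(\<Sum>i\<in>?I. \<Sum>j\<in>?I. if bef x y i j then (X x i - A x i) * ext a m0 n0 A x j else 0) = S0 + a * S1" for a
  proof -
    have "(\<Sum>j\<in>?I. if bef x y i j then (X x i - A x i) * ext a m0 n0 A x j else 0) =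
      (\<Sum>j\<in>?I. if bef x y i j then u i * A x j else 0) + a * (if bef x y i x then u i else 0)" if "i \<in> ?I" for i
    proof -
      have "(\<Sum>j\<in>?I. if bef x y i j then (X x i - A x i) * ext a m0 n0 A x j else 0) =
        (\<Sum>j\<in>?I. (if bef x y i j then u i * A x j else 0) + (if x = j then a * (if bef x y i x then u i else 0) else 0))"
        using xy by (intro sum.cong refl) (auto simp: ext_apply u_def algebra_simps)
      then show ?thesis using xy by (simp add: sum.distrib sum_int_delta)
    qed
    then show ?thesis unfolding S0_def S1_def by (simp add: sum.distrib sum_distrib_left)
  qed
  \<comment> \<open>Every moved unit contributes exactly 1. Moved away from the diagonal, it raises
    the weight by 1. Otherwise it lowers the weight by 1 and gets 2 from \<open>S1\<close> or, in
    column \<open>x\<close>, from \<open>2 * u x\<close>.\<close>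
  have key: "2 * S1 + 2 * u x + wt m0 n0 X - wt m0 n0 A = t"
  proof -
    have "2 * u x = (\<Sum>j\<in>?I. if x = j then 2 * u x else 0)" using xy by (simp add: sum_int_delta)
    then have "2 * S1 + 2 * u x + (wt m0 n0 X - wt m0 n0 A) =
      (\<Sum>j\<in>?I. 2 * (if bef x y j x then u j else 0) + (if x = j then 2 * u x else 0) + (\<bar>x - j\<bar> - \<bar>y - j\<bar>) * u j)"
      unfolding wt_elem_terms[OF X] by (simp add: S1_def u_def sum.distrib sum_distrib_left)
    also have "\<dots> = (\<Sum>j\<in>?I. u j)"
    proof (rule sum.cong[OF refl])
      fix j
      show "2 * (if bef x y j x then u j else 0) + (if x = j then 2 * u x else 0) + (\<bar>x - j\<bar> - \<bar>y - j\<bar>) * u j = u j"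
        using xy(3)
      proof
        assume y: "y = x + 1"
        consider "j < x" | "j = x" | "j > x" by linarith
        then show ?thesis by cases (auto simp: y bef_def)
      next
        assume x: "x = y + 1"
        consider "j < y" | "j = y" | "j = x" | "j > x" using x by linarith
        then show ?thesis by cases (auto simp: x bef_def)
      qed
    qed
    finally show ?thesis using u by simp
  qed
  define G where "G = (\<Prod>j\<in>?I - {x}. gb (nat (X x j)) (nat (u j)))"
  define \<epsilon> where "\<epsilon> = 2 * S0 + 2 * u x * (X x x - u x) + dA m0 n0 X - dA m0 n0 ?E - dA m0 n0 A"
  define P where "P = [:phi G:] * [:vv powi \<epsilon>:] * qpoly (X x x + 1) (u x)"
  \<comment> \<open>Large enough for \<open>u x \<le> X x x + a\<close> and
    \<open>A x x + a \<ge> 0\<close>, so that no \<open>nat\<close> in the coefficient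
    truncates.\<close>
  define a0 where "a0 = max (u x + \<bar>X x x\<bar>) (\<Sum>j\<in>?I. \<bar>A x j\<bar>)"
  have "phi (elem_coef x y A a X) * vv powi (- (dd m0 n0 a ?E + dd m0 n0 a A - dd m0 n0 a X)) =
      poly P (vv powi (- a))" if a: "a \<ge> a0" for a
  proof -
    have a1: "a \<ge> 0" "u x \<le> X x x + a" using a u(1)[of x] by (auto simp: a0_def)
    have Axx: "A x x + a \<ge> 0"
    proof -
      have "\<bar>A x x\<bar> \<le> (\<Sum>j\<in>?I. \<bar>A x j\<bar>)" using xy by (intro member_le_sum) auto
      then show ?thesis using a u(1)[of x] by (auto simp: a0_def)
    qed
    have "ext a m0 n0 A x j \<ge> 0" for j
      using Axx tXi_nonneg[OF A, of x j] by (auto simp: ext_def)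
    then have Spos: "S0 + a * S1 \<ge> 0"
      unfolding S[symmetric] u_def[symmetric] using u(1) by (intro sum_nonneg) auto
    have "(\<Prod>j\<in>?I. gb (nat (ext a m0 n0 X x j)) (nat (X x j - A x j))) =
      gb (nat (X x x + a)) (nat (u x)) * G"
    proof -
      have "(\<Prod>j\<in>?I - {x}. gb (nat (ext a m0 n0 X x j)) (nat (X x j - A x j))) = G"
        unfolding G_def using xy by (intro prod.cong refl) (auto simp: ext_apply u_def)
      then show ?thesis
        using prod.remove[OF _ xy(1), of "\<lambda>j. gb (nat (ext a m0 n0 X x j)) (nat (X x j - A x j))"] xy
        by (simp add: ext_apply u_def)
    qed
    then have "phi (elem_coef x y A a X) = phi (gb (nat (X x x + a)) (nat (u x))) * phi G * vv powi (2 * (S0 + a * S1))"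
      unfolding elem_coef_def S using Spos by (simp only: phi_mult phi_X_power nat_0_le)
    also have "phi (gb (nat (X x x + a)) (nat (u x))) =
      vv powi (2 * u x * (X x x + a - u x)) * poly (qpoly (X x x + 1) (u x)) (vv powi (- a))"
      using u a1 by (intro phi_gb_qpoly) auto
    finally have "phi (elem_coef x y A a X) * vv powi (- (dd m0 n0 a ?E + dd m0 n0 a A - dd m0 n0 a X)) =
      phi G * poly (qpoly (X x x + 1) (u x)) (vv powi (- a)) *
      (vv powi (2 * u x * (X x x + a - u x)) * vv powi (2 * (S0 + a * S1)) *
       vv powi (- (dd m0 n0 a ?E + dd m0 n0 a A - dd m0 n0 a X)))"
      by (simp only: mult_ac)
    also have "vv powi (2 * u x * (X x x + a - u x)) * vv powi (2 * (S0 + a * S1)) *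
       vv powi (- (dd m0 n0 a ?E + dd m0 n0 a A - dd m0 n0 a X)) =
      vv powi (2 * u x * (X x x + a - u x) + 2 * (S0 + a * S1) +
       (- (dd m0 n0 a ?E + dd m0 n0 a A - dd m0 n0 a X)))"
      by (simp only: power_int_add vv_nonzero simp_thms)
    also have "2 * u x * (X x x + a - u x) + 2 * (S0 + a * S1) +
       (- (dd m0 n0 a ?E + dd m0 n0 a A - dd m0 n0 a X)) = \<epsilon> + a * (2 * S1 + 2 * u x + wt m0 n0 X - wt m0 n0 A - t)"
      by (simp add: dd_def wt_elem \<epsilon>_def algebra_simps)
    also have "\<dots> = \<epsilon>" unfolding key by simp
    finally show ?thesis by (simp add: P_def mult_ac)
  qed
  moreover have "P \<in> Z1" unfolding P_def by (intro Z1.mult Z1_phi gen_v Z1_qpoly)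
  ultimately show ?thesis unfolding stable_def by blast
qed

text \<open>Row \<open>x\<close> belongs to the window, so its extension is 0 in the outer columns
  and nothing is moved there: the binomials have lower index 0 and the terms of the exponent
  vanish.\<close>

lemma elem_coef_ext:
  assumes X: "X \<in> elem_terms x y t A" and mn: "m \<le> m0" "n0 \<le> n" and C: "C = ext a m n X"
  shows "(\<Prod>j\<in>{m..n}. poly (gb (nat (C x j)) (nat (C x j - ext a m n A x j))) Q) *
    Q ^ nat (\<Sum>u\<in>{m..n}. \<Sum>j\<in>{m..n}. if bef x y u j then (C x u - ext a m n A x u) * ext a m n A x j else 0) =
    poly (elem_coef x y A a X) Q"
proof -
  have in0: "i \<in> {m..n}" if "i \<in> {m0..n0}" for i using that mn by auto
  have u: "C x j - ext a m n A x j = X x j - A x j" if "j \<in> {m..n}" for j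
    using that in0 xy by (simp add: C ext_apply)
  have u0: "X x j - A x j = 0" if "j \<notin> {m0..n0}" for j
    using that tXi_zero[OF A] tXi_zero[of X m0 n0] X by (simp add: elem_terms_def)
  have Cx: "C x j = ext a m0 n0 X x j" "ext a m n A x j = ext a m0 n0 A x j" if "j \<in> {m0..n0}" for j
    using that in0 xy by (simp_all add: C ext_apply)
  have Ax0: "ext a m n A x j = 0" if "j \<notin> {m0..n0}" for j
    using that xy tXi_zero[OF A, of x j] by (auto simp: ext_def)
  have "(\<Prod>j\<in>{m..n}. poly (gb (nat (C x j)) (nat (C x j - ext a m n A x j))) Q) =
    (\<Prod>j\<in>{m..n}. poly (gb (nat (C x j)) (nat (X x j - A x j))) Q)"
    using u by (intro prod.cong refl) simp
  also have "\<dots> = (\<Prod>j\<in>{m0..n0}. poly (gb (nat (C x j)) (nat (X x j - A x j))) Q)"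
    using mn u0 by (intro prod.mono_neutral_right) auto
  also have "\<dots> = (\<Prod>j\<in>{m0..n0}. poly (gb (nat (ext a m0 n0 X x j)) (nat (X x j - A x j))) Q)"
    using Cx by (intro prod.cong refl) simp
  finally have 1: "(\<Prod>j\<in>{m..n}. poly (gb (nat (C x j)) (nat (C x j - ext a m n A x j))) Q) = \<dots>" .
  have "(\<Sum>u\<in>{m..n}. \<Sum>j\<in>{m..n}. if bef x y u j then (C x u - ext a m n A x u) * ext a m n A x j else 0) =
    (\<Sum>u\<in>{m..n}. \<Sum>j\<in>{m..n}. if bef x y u j then (X x u - A x u) * ext a m n A x j else 0)"
    by (intro sum.cong refl) (simp add: u)
  also have "\<dots> = (\<Sum>u\<in>{m0..n0}. \<Sum>j\<in>{m0..n0}. if bef x y u j then (X x u - A x u) * ext a m n A x j else 0)"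
  proof (rule sum2_restrict_int[OF mn])
    fix u j assume "u \<notin> {m0..n0} \<or> j \<notin> {m0..n0}"
    then show "(if bef x y u j then (X x u - A x u) * ext a m n A x j else 0) = 0"
      using u0[of u] Ax0[of j] by (cases "u \<in> {m0..n0}") simp_all
  qed
  also have "\<dots> = (\<Sum>u\<in>{m0..n0}. \<Sum>j\<in>{m0..n0}. if bef x y u j then (X x u - A x u) * ext a m0 n0 A x j else 0)"
    by (intro sum.cong refl) (simp add: Cx)
  finally show ?thesis unfolding 1 by (simp add: elem_coef_def poly_prod poly_power)
qed

text \<open>At most one \<open>X\<close> contributes, the one whose extension is the type of the
  given pair. What has to be shown is that a type satisfying the counting condition comes from the
  window at all, that is, that no unit is moved outside it.\<close>

lemma conv_elem:
  assumes adm: "adm a0 a m n R r f1 f2" and a: "\<And>j. j \<in> {m0..n0} \<Longrightarrow> A j j + a \<ge> 0" "a \<ge> 0"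
  shows "conv (orbit (elem x y t e)) (orbit A) a m n R r f1 f2 =
    (\<Sum>X\<in>elem_terms x y t A. poly (elem_coef x y A a X) (int (card (carrier R))) * orbit X a m n R r f1 f2)"
proof -
  let ?E = "elem x y t e" and ?Xs = "elem_terms x y t A"
  have mn: "m \<le> m0" "n0 \<le> n" "m \<le> n" and f: "is_flag R r m n f1" "is_flag R r m n f2"
    using adm m0n0 by (auto simp: adm_def)
  interpret coord_space R r using adm by (simp add: adm_def)
  define C where "C = ftype R r m n f1 f2"
  let ?e = "\<lambda>i. if i \<in> {m..n} then e i + a else 0"
  have xy': "x \<in> {m..n}" "y \<in> {m..n}" using xy mn by auto
  have extE: "ext a m n ?E = elem x y t ?e" by (rule ext_elem[OF xy'])
  have XsI: "X \<in> tXi m0 n0" if "X \<in> ?Xs" for X using that by (simp add: elem_terms_def)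
  show ?thesis
  \<comment> \<open>All \<open>X\<close> in the sum have the row sums of \<open>E\<close>. If the
    dimensions of \<open>f1\<close> do not fit them, both sides are 0.\<close>
  proof (cases "\<forall>i\<in>{m..n}. int (dm (f1 i)) = (\<Sum>k\<in>{m..i}. ro m0 n0 ?E k + a)")
    case False
    have "orbit X a m n R r f1 f2 = 0" if "X \<in> ?Xs" for X
      using dims_of_ext_type[OF adm XsI[OF that]] ro_elem_terms[OF that] False by (auto simp: orbit_def)
    moreover have none: "{f. is_flag R r m n f \<and> ftype R r m n f1 f = ext a m n ?E \<and> ftype R r m n f f2 = ext a m n A} = {}"
      using dims_of_ext_type[OF adm_flags(2)[OF adm] elem_tXi] False by blast
    ultimately show ?thesis unfolding conv_orbit[OF adm] none by simp
  next
    case True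
    have dims: "int (dm (f1 i)) = cum m (elem x y t ?e) i n" if "i \<in> {m..n}" for i
      using True that cum_ext_right[OF elem_tXi mn(1,2), of i a] by (simp add: extE)
    have top: "cum m (ext a m n A) i n = cum m (elem x y t ?e) n i" if "i \<in> {m..n}" for i
      using that cum_ext_right[OF A mn(1,2), of i a] cum_ext_bottom[OF elem_tXi mn(1,2), of i a] comp
      by (simp add: extE)
    have nonneg: "ext a m n A i j \<ge> 0" for i j
    proof (cases "i = j")
      case True
      then show ?thesis using a tXi_zero[OF A, of i j] by (cases "i \<in> {m0..n0}") (auto simp: ext_def)
    next
      case False
      then show ?thesis using tXi_nonneg[OF A False] by (simp add: ext_def)
    qed
    have Cnn: "C i j \<ge> 0" for i j unfolding C_def by (rule ftype_nonneg[OF mn(3) f])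
    have C0: "C i j = 0" if "i \<notin> {m..n} \<or> j \<notin> {m..n}" for i j
      using that by (auto simp: C_def ftype_def)
    let ?cond = "(\<forall>i\<in>{m..n}. i \<noteq> x \<longrightarrow> i \<noteq> y \<longrightarrow> (\<forall>j\<in>{m..n}. ext a m n A i j = C i j)) \<and>
        (\<forall>j\<in>{m..n}. ext a m n A x j + ext a m n A y j = C x j + C y j \<and> ext a m n A x j \<le> C x j)"
    have count: "conv (orbit ?E) (orbit A) a m n R r f1 f2 = (if ?cond
     then (\<Prod>j\<in>{m..n}. poly (gb (nat (C x j)) (nat (C x j - ext a m n A x j))) (int q)) *
       int q ^ nat (\<Sum>u\<in>{m..n}. \<Sum>j\<in>{m..n}. if bef x y u j then (C x u - ext a m n A x u) * ext a m n A x j else 0)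
     else 0)"
      unfolding conv_orbit[OF adm] extE
      by (rule card_conv_elem[OF xy' xy(3) _ f(1) dims f(2) C_def _ nonneg top]) (auto simp: ext_zero)
    have cond_ext: ?cond if X: "X \<in> ?Xs" "C = ext a m n X" for X
    proof -
      have X': "\<And>i j. i \<noteq> x \<Longrightarrow> i \<noteq> y \<Longrightarrow> X i j = A i j" "\<And>j. X x j + X y j = A x j + A y j" "\<And>j. A x j \<le> X x j"
        using X(1) by (simp_all add: elem_terms_def)
      show ?thesis unfolding X(2) using xy' X'(1) X'(2) X'(3)
        by (auto simp: ext_apply add_ac)
    qed
    show ?thesis
    proof (cases ?cond)
      case False
      then have "orbit X a m n R r f1 f2 = 0" if "X \<in> ?Xs" for X
        using cond_ext[OF that] by (auto simp: orbit_def C_def)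
      then show ?thesis unfolding count if_not_P[OF False] by simp
    next
      case cond: True
      define X where "X i j = (if i \<in> {m0..n0} \<and> j \<in> {m0..n0} then C i j - (if i = j then a else 0) else 0)" for i j
      \<comment> \<open>In the rows \<open>x\<close> and \<open>y\<close> the extension of
        \<open>A\<close> is 0 in an outer column. The two entries of \<open>C\<close> there have sum
        0 and are nonnegative, so both are 0.\<close>
      have Cout: "C i j = (if i = j then a else 0)" if ij: "i \<in> {m..n}" "j \<in> {m..n}" "i \<notin> {m0..n0} \<or> j \<notin> {m0..n0}" for i j
      proof (cases "i = x \<or> i = y")
        case False
        then have "C i j = ext a m n A i j" using cond ij by auto
        then show ?thesis using ij tXi_zero[OF A, of i j] by (auto simp: ext_apply)
      next
        case True
        then have j: "j \<notin> {m0..n0}" "i \<noteq> j" using xy ij by auto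
        then have "ext a m n A x j = 0" "ext a m n A y j = 0"
          using tXi_zero[OF A, of _ j] xy ij xy' by (auto simp: ext_apply)
        moreover have "ext a m n A x j + ext a m n A y j = C x j + C y j" using cond ij(2) by blast
        ultimately have "C x j + C y j = 0" by simp
        then have "C i j = 0" using Cnn[of x j] Cnn[of y j] True by auto
        then show ?thesis using j by simp
      qed
      have CX: "C = ext a m n X"
      proof (intro ext)
        fix i j
        show "C i j = ext a m n X i j"
          using Cout[of i j] C0[of i j] mn by (auto simp: ext_def X_def)
      qed
      have Xt: "X \<in> tXi m0 n0" using Cnn by (auto simp: tXi_def X_def)
      have XA: "X i j = A i j" if "i \<noteq> x" "i \<noteq> y" for i j
      proof (cases "i \<in> {m0..n0} \<and> j \<in> {m0..n0}")
        case True
        then have "C i j = ext a m n A i j" using cond that mn by auto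
        then show ?thesis using True mn by (simp add: X_def ext_apply)
      next
        case False
        then show ?thesis using tXi_zero[OF A] tXi_zero[OF Xt] by simp
      qed
      have Xxy: "X x j + X y j = A x j + A y j \<and> A x j \<le> X x j" for j
      proof (cases "j \<in> {m0..n0}")
        case True
        then have "ext a m n A x j + ext a m n A y j = C x j + C y j \<and> ext a m n A x j \<le> C x j"
          using cond mn by auto
        moreover have "j \<in> {m..n}" using True mn by auto
        ultimately show ?thesis using True xy xy' by (simp add: X_def ext_apply split: if_splits)
      next
        case False
        then show ?thesis using tXi_zero[OF A] tXi_zero[OF Xt] by simp
      qed
      \<comment> \<open>The counting condition does not mention how many units are moved. That there
        are \<open>t\<close> follows from the dimensions of \<open>f1\<close>, which
        \<open>X\<close> and \<open>E\<close> both prescribe.\<close>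
      have "ro m0 n0 X x = ro m0 n0 ?E x"
      proof -
        have d: "(\<Sum>k\<in>{m..i}. ro m0 n0 X k + a) = (\<Sum>k\<in>{m..i}. ro m0 n0 ?E k + a)" if "i \<in> {m..n}" for i
          using dims_of_ext_type[OF adm Xt _ that] CX True that unfolding C_def by simp
        have "(\<Sum>k\<in>{m..x-1}. ro m0 n0 X k + a) = (\<Sum>k\<in>{m..x-1}. ro m0 n0 ?E k + a)"
          using d[of "x - 1"] xy' by (cases "x = m") auto
        then show ?thesis using d[OF xy'(1)] sum_int_last[of m x "\<lambda>k. ro m0 n0 X k + a"]
          sum_int_last[of m x "\<lambda>k. ro m0 n0 ?E k + a"] xy' by simp
      qed
      then have "ro m0 n0 X x - ro m0 n0 A x = t" using ro_elem[OF xy(1)] ro_A[OF xy(1)] x_ne_y by simp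
      then have XXs: "X \<in> ?Xs" using Xt XA Xxy by (simp add: elem_terms_def ro_def sum_subtractf)
      have "orbit Y a m n R r f1 f2 = (if Y = X then 1 else 0)" if "Y \<in> ?Xs" for Y
        using ext_inj[OF Xt XsI[OF that] mn(1,2)] CX unfolding C_def by (auto simp: orbit_def)
      then have "(\<Sum>Y\<in>?Xs. poly (elem_coef x y A a Y) (int q) * orbit Y a m n R r f1 f2) =
        (\<Sum>Y\<in>?Xs. if Y = X then poly (elem_coef x y A a Y) (int q) else 0)"
        by (intro sum.cong refl) simp
      also have "\<dots> = poly (elem_coef x y A a X) (int q)"
        using XXs finite_elem_terms[OF A] by (simp add: sum.delta)
      finally show ?thesis unfolding count if_P[OF cond] elem_coef_ext[OF XXs mn(1,2) CX] by simp
    qed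
  qed
qed

lemma expands_elem:
  "\<exists>a0. expands (ro m0 n0 (elem x y t e)) (\<lambda>a. dd m0 n0 a (elem x y t e) + dd m0 n0 a A)
    (conv (orbit (elem x y t e)) (orbit A)) (elem_terms x y t A) (elem_coef x y A) a0"
proof -
  define a0 where "a0 = (\<Sum>j\<in>{m0..n0}. \<bar>A j j\<bar>)"
  have "a0 \<ge> 0" by (simp add: a0_def sum_nonneg)
  moreover have "A j j + a0 \<ge> 0" if "j \<in> {m0..n0}" for j
  proof -
    have "\<bar>A j j\<bar> \<le> a0" unfolding a0_def using that by (intro member_le_sum) auto
    then show ?thesis by simp
  qed
  ultimately have "conv (orbit (elem x y t e)) (orbit A) a m n R r f1 f2 =
    (\<Sum>X\<in>elem_terms x y t A. poly (elem_coef x y A a X) (int (card (carrier R))) * orbit X a m n R r f1 f2)"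
    if adm: "adm a0 a m n R r f1 f2" for a m n R r f1 f2
  proof (intro conv_elem[OF adm])
    show "A j j + a \<ge> 0" if "j \<in> {m0..n0}" for j
      using \<open>\<And>j. j \<in> {m0..n0} \<Longrightarrow> A j j + a0 \<ge> 0\<close>[OF that] adm by (simp add: adm_def)
    show "a \<ge> 0" using \<open>a0 \<ge> 0\<close> adm by (simp add: adm_def)
  qed
  moreover have "X \<in> tXi m0 n0" if "X \<in> elem_terms x y t A" for X
    using that by (simp add: elem_terms_def)
  ultimately have "expands (ro m0 n0 (elem x y t e)) (\<lambda>a. dd m0 n0 a (elem x y t e) + dd m0 n0 a A)
    (conv (orbit (elem x y t e)) (orbit A)) (elem_terms x y t A) (elem_coef x y A) a0"
    unfolding expands_def using finite_elem_terms[OF A] ro_elem_terms stable_elem_coef by blast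
  then show ?thesis by blast
qed

end

end

section \<open>Stabilisation\<close>

context window
begin

text \<open>Flags in diagonal relative position coincide, so the orbit of \<open>E\<close> acts as
  an identity on the flags whose dimensions match.\<close>

lemma conv_diagonal:
  assumes E: "E \<in> tXi m0 n0" "\<And>i j. i \<noteq> j \<Longrightarrow> E i j = 0" and B: "B \<in> tXi m0 n0"
    and comp: "co m0 n0 E = ro m0 n0 B" and adm: "adm a0 a m n R r f1 f2"
  shows "conv (orbit E) (orbit B) a m n R r f1 f2 = orbit B a m n R r f1 f2"
proof -
  have mn: "m \<le> m0" "n0 \<le> n" "m \<le> n" and f: "is_flag R r m n f1" "is_flag R r m n f2"
    using adm m0n0 by (auto simp: adm_def)
  interpret coord_space R r using adm by (simp add: adm_def)
  define e where "e i = (if i \<in> {m..n} then E i i + a else 0)" for i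
  \<comment> \<open>A diagonal matrix is elementary with \<open>t = 0\<close>; the place
    \<open>(m,m)\<close> is arbitrary and only makes \<open>cum_elem\<close> applicable.\<close>
  have extE: "ext a m n E = elem m m 0 e"
    using E(2) by (intro ext) (auto simp: ext_def elem_def e_def)
  have cumE: "cum m (ext a m n E) i j = (\<Sum>k\<in>{m..min i j}. e k)" for i j
    unfolding extE by (subst cum_elem) auto
  have supp: "ext a m n E i j = 0" if "i \<notin> {m..n} \<or> j \<notin> {m..n}" for i j
    using that by (rule ext_zero)
  have roB: "e k = ro m0 n0 B k + a" if "k \<in> {m..n}" for k
  proof -
    have "co m0 n0 E k = E k k"
    proof (cases "k \<in> {m0..n0}")
      case True
      have "co m0 n0 E k = (\<Sum>i\<in>{m0..n0}. if k = i then E k k else 0)"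
        unfolding co_def using E(2) by (intro sum.cong) auto
      then show ?thesis using True by (simp add: sum_int_delta)
    next
      case False
      then show ?thesis using tXi_zero[OF E(1)] by (simp add: co_def)
    qed
    then show ?thesis using that comp by (simp add: e_def)
  qed
  have eq: "f = f1" if f': "is_flag R r m n f" "ftype R r m n f1 f = ext a m n E" for f
  proof
    fix i
    show "f i = f1 i"
    proof (cases "i \<in> {m..n}")
      case True
      have P: "pos m f1 f i' j' = (\<Sum>k\<in>{m..min i' j'}. e k)" if "i' \<in> {m..n}" "j' \<in> {m..n}" for i' j'
        using that cum_ftype[OF mn(3) f(1) f'(1), of i' j'] f'(2) cumE by simp
      have s: "subsp (f1 i)" "subsp (f i)" using f(1) f'(1) True by (auto simp: is_flag_def)
      have "dm (f1 i \<inter> f i) = dm (f1 i)" "dm (f1 i \<inter> f i) = dm (f i)"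
        using P[of i i] P[of i n] P[of n i] pos_top[OF mn(3) f(1) f'(1), of i] True mn
        by (auto simp: pos_def)
      then have "f1 i \<inter> f i = f1 i" "f1 i \<inter> f i = f i" using s by (intro subsp_dim_eq; simp)+
      then show ?thesis by simp
    next
      case False
      then show ?thesis using f(1) f'(1) by (simp add: is_flag_def)
    qed
  qed
  show ?thesis
  proof (cases "ftype R r m n f1 f2 = ext a m n B")
    case True
    have d: "int (dm (f1 i)) = (\<Sum>k\<in>{m..i}. e k)" if "i \<in> {m..n}" for i
      using dims_of_ext_type[OF adm B True that] roB that by simp
    have "\<forall>i\<in>{m..n}. \<forall>j\<in>{m..n}. pos m f1 f1 i j = cum m (ext a m n E) i j"
      unfolding cumE
    proof (intro ballI)
      fix i j assume ij: "i \<in> {m..n}" "j \<in> {m..n}"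
      have "f1 i \<inter> f1 j = f1 (min i j)"
        using flagat_mono[OF f(1), of i j] flagat_mono[OF f(1), of j i] ij by (auto simp: min_def)
      moreover have "min i j \<in> {m..n}" using ij by auto
      ultimately show "pos m f1 f1 i j = sum e {m..min i j}" using d ij by (simp add: pos_def)
    qed
    then have "ftype R r m n f1 f1 = ext a m n E"
      using ftype_eq_iff[OF mn(3) f(1) f(1), of "ext a m n E", OF supp] by blast
    then have "{f. is_flag R r m n f \<and> ftype R r m n f1 f = ext a m n E \<and> ftype R r m n f f2 = ext a m n B} = {f1}"
      using eq f(1) True by blast
    then show ?thesis unfolding conv_orbit[OF adm] using True by (simp add: orbit_def)
  next
    case False
    then have none: "{f. is_flag R r m n f \<and> ftype R r m n f1 f = ext a m n E \<and> ftype R r m n f f2 = ext a m n B} = {}"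
      using eq by blast
    show ?thesis unfolding conv_orbit[OF adm] none using False by (simp add: orbit_def)
  qed
qed

section \<open>The induction weight and the choice of a corner entry\<close>

definition spread :: "mat \<Rightarrow> int" where
  "spread X = (\<Sum>i\<in>{m0..n0}. \<Sum>j\<in>{m0..n0}. (i - j)^2 * X i j)"

lemma spread_nonneg: "X \<in> tXi m0 n0 \<Longrightarrow> spread X \<ge> 0"
proof -
  assume "X \<in> tXi m0 n0"
  then have "(i - j)^2 * X i j \<ge> 0" for i j using tXi_nonneg[of X m0 n0 i j] by (cases "i = j") auto
  then show ?thesis unfolding spread_def by (intro sum_nonneg)
qed

lemma spread_elem_terms:
  assumes X: "X \<in> elem_terms x y t A" and xy: "x \<in> {m0..n0}" "y \<in> {m0..n0}" "x \<noteq> y"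
  shows "spread X - spread A = (\<Sum>j\<in>{m0..n0}. ((x - j)^2 - (y - j)^2) * (X x j - A x j))"
proof -
  have X': "\<And>i j. i \<noteq> x \<Longrightarrow> i \<noteq> y \<Longrightarrow> X i j = A i j" "\<And>j. X y j = A x j + A y j - X x j"
    using X by (auto simp: elem_terms_def algebra_simps)
  have "spread X - spread A = (\<Sum>i\<in>{m0..n0}. \<Sum>j\<in>{m0..n0}. (i - j)^2 * (X i j - A i j))"
    by (simp add: spread_def sum_subtractf[symmetric] right_diff_distrib)
  also have "\<dots> = (\<Sum>i\<in>{x, y}. \<Sum>j\<in>{m0..n0}. (i - j)^2 * (X i j - A i j))"
    using xy X' by (intro sum.mono_neutral_right) auto
  also have "\<dots> = (\<Sum>j\<in>{m0..n0}. (x - j)^2 * (X x j - A x j) + (y - j)^2 * (X y j - A y j))"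
    using xy(3) by (simp add: sum.distrib)
  also have "\<dots> = (\<Sum>j\<in>{m0..n0}. ((x - j)^2 - (y - j)^2) * (X x j - A x j))"
    unfolding X'(2) by (intro sum.cong refl) (simp add: algebra_simps)
  finally show ?thesis .
qed

text \<open>The outermost row and column make the coefficient of \<open>e\<^sub>A\<close> in the elementary product equal to 1.\<close>

lemma ex_corner:
  assumes A: "A \<in> tXi m0 n0" and "i \<noteq> j" "A i j \<noteq> 0"
  obtains x y u where "x \<in> {m0..n0}" "y \<in> {m0..n0}" "u \<in> {m0..n0}" "A x u > 0"
    "(y = x + 1 \<and> y \<le> u) \<or> (x = y + 1 \<and> u \<le> y)"
    "\<And>j. bef x y u j \<Longrightarrow> A x j = 0 \<and> A y j = 0"
proof -
  have inA: "k \<in> {m0..n0} \<and> l \<in> {m0..n0}" if "A k l \<noteq> 0" for k l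
    using tXi_zero[OF A, of k l] that by blast
  have posA: "A k l > 0" if "A k l \<noteq> 0" "k \<noteq> l" for k l
    using tXi_nonneg[OF A that(2)] that(1) by simp
  show ?thesis
  proof (cases "\<exists>k l. k < l \<and> A k l \<noteq> 0")
    case True
    define S where "S = {k. \<exists>l. k < l \<and> A k l \<noteq> 0}"
    have S: "finite S" "S \<noteq> {}"
      using True inA by (auto simp: S_def intro: finite_subset[of _ "{m0..n0}"])
    \<comment> \<open>The last row with an entry above the diagonal; \<open>u\<close> will be its
      last such column. Row \<open>x + 1\<close> then has no entry above the diagonal, and every
      column after \<open>u\<close> is above the diagonal in that row.\<close>
    define x where "x = Max S"
    have xS: "x \<in> S" unfolding x_def using Max_in S by blast
    have xmax: "A k l = 0" if "x < k" "k < l" for k l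
      using Max_ge[OF S(1), of k] that unfolding x_def S_def by force
    define T where "T = {l. x < l \<and> A x l \<noteq> 0}"
    have T: "finite T" "T \<noteq> {}"
      using xS inA by (auto simp: T_def S_def intro: finite_subset[of _ "{m0..n0}"])
    define u where "u = Max T"
    have uT: "x < u" "A x u \<noteq> 0" using Max_in[OF T] by (auto simp: T_def u_def)
    have umax: "A x l = 0" if "u < l" for l
      using Max_ge[OF T(1), of l] that uT(1) unfolding u_def T_def by force
    show ?thesis
      by (rule that[of x "x + 1" u]) (use uT inA[OF uT(2)] posA[of x u] umax xmax[of "x + 1"] in \<open>auto simp: bef_def\<close>)
  next
    \<comment> \<open>Without entries above the diagonal the mirror image works: the first row with
      an entry below it, and the first column in that row.\<close>
    case False
    then have "j < i" using assms(2,3) by (metis linorder_neqE)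
    define S where "S = {k. \<exists>l. l < k \<and> A k l \<noteq> 0}"
    have S: "finite S" "S \<noteq> {}"
      using \<open>j < i\<close> assms(3) inA by (auto simp: S_def intro: finite_subset[of _ "{m0..n0}"])
    define x where "x = Min S"
    have xS: "x \<in> S" unfolding x_def using Min_in S by blast
    have xmin: "A k l = 0" if "k < x" "l < k" for k l
      using Min_le[OF S(1), of k] that unfolding x_def S_def by force
    define T where "T = {l. l < x \<and> A x l \<noteq> 0}"
    have T: "finite T" "T \<noteq> {}"
      using xS inA by (auto simp: T_def S_def intro: finite_subset[of _ "{m0..n0}"])
    define u where "u = Min T"
    have uT: "u < x" "A x u \<noteq> 0" using Min_in[OF T] by (auto simp: T_def u_def)
    have umin: "A x l = 0" if "l < u" for l
      using Min_le[OF T(1), of l] that uT(1) unfolding u_def T_def by force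
    show ?thesis
      by (rule that[of x "x - 1" u]) (use uT inA[OF uT(2)] posA[of x u] umin xmin[of "x - 1"] in \<open>auto simp: bef_def\<close>)
  qed
qed

text \<open>The elementary product gives \<open>e_A\<close> as \<open>e_E e_A1\<close> minus the
  terms with \<open>X \<noteq> A\<close>, and this is multiplied by \<open>e_B\<close> on the right.
  Column sums are unchanged in an elementary product, so \<open>A1\<close> and every
  \<open>X\<close> may again be multiplied by \<open>B\<close>.\<close>

theorem stable_product:
  assumes "A \<in> tXi m0 n0" "B \<in> tXi m0 n0" "co m0 n0 A = ro m0 n0 B"
  shows "stable_kernel (ro m0 n0 A) (\<lambda>a. dd m0 n0 a A + dd m0 n0 a B) (conv (orbit A) (orbit B))"
  using assms
proof (induction "nat (spread A)" arbitrary: A rule: less_induct)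
  case less
  note A = less.prems(1) and B = less.prems(2) and comp = less.prems(3)
  show ?case
  proof (cases "\<forall>i j. i \<noteq> j \<longrightarrow> A i j = 0")
    case True
    have row: "ro m0 n0 A = ro m0 n0 B"
    proof -
      have "ro m0 n0 A i = co m0 n0 A i" for i
      proof -
        have "A i j = A j i" for j using True by (cases "i = j") auto
        then show ?thesis by (simp add: ro_def co_def)
      qed
      then show ?thesis using comp by auto
    qed
    have sA: "dd m0 n0 a A = dA m0 n0 A" for a
    proof -
      have "wt m0 n0 A = 0" unfolding wt_def using True by (intro sum.neutral ballI) auto
      then show ?thesis by (simp add: dd_def)
    qed
    have "conv (orbit A) (orbit B) a m n R r f1 f2 = orbit B a m n R r f1 f2"
      if "adm 0 a m n R r f1 f2" for a m n R r f1 f2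
      using True by (intro conv_diagonal[OF A _ B comp that]) auto
    moreover from sA have "stable (\<lambda>a. dd m0 n0 a A + dd m0 n0 a B - dd m0 n0 a B) (\<lambda>_. 1)"
      using stable_const[of "\<lambda>a. dd m0 n0 a A + dd m0 n0 a B - dd m0 n0 a B" "dA m0 n0 A" 1] by simp
    ultimately show ?thesis
      unfolding row
      by - (rule stable_kernel_sum[of "{()}", where H = "\<lambda>_. orbit B" and K = "\<lambda>_ _. 1"
            and e' = "\<lambda>_ a. dd m0 n0 a B" and ?a0.0 = 0], simp_all only: stable_kernel_orbit[OF B] finite.intros, simp)
  next
    case False
    then obtain x y u where xy: "x \<in> {m0..n0}" "y \<in> {m0..n0}" and u: "u \<in> {m0..n0}" "A x u > 0"
      and adj: "(y = x + 1 \<and> y \<le> u) \<or> (x = y + 1 \<and> u \<le> y)"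
      and corner: "\<And>j. bef x y u j \<Longrightarrow> A x j = 0 \<and> A y j = 0"
      using ex_corner[OF A] by metis
    define t where "t = A x u"
    have t0: "t > 0" using u by (simp add: t_def)
    have xny: "x \<noteq> y" "x \<noteq> u" and adj': "y = x + 1 \<or> x = y + 1" using adj by auto
    \<comment> \<open>The whole entry \<open>t\<close> at \<open>(x,u)\<close> is moved to
      \<open>(y,u)\<close>. The diagonal \<open>e\<close> of \<open>E\<close> is then forced by the
      two conditions \<open>ro E = ro A\<close> and \<open>co E = ro A1\<close>.\<close>
    define A1 where "A1 i j = (if j = u then A i j - (if i = x then t else 0) + (if i = y then t else 0) else A i j)" for i j
    define e where "e i = ro m0 n0 A i - (if i = x then t else 0)" for i
    have A1: "A1 \<in> tXi m0 n0"
      using A xy u tXi_nonneg[OF A] t0 by (auto simp: tXi_def A1_def t_def)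
    have e0: "e i = 0" if "i \<notin> {m0..n0}" for i
      using that tXi_zero[OF A] xy by (auto simp: e_def ro_def)
    have ro1: "ro m0 n0 A1 i = ro m0 n0 A i - (if i = x then t else 0) + (if i = y then t else 0)" for i
    proof -
      have "ro m0 n0 A1 i = (\<Sum>j\<in>{m0..n0}. A i j + (if u = j then (if i = y then t else 0) - (if i = x then t else 0) else 0))"
        unfolding ro_def by (intro sum.cong) (auto simp: A1_def)
      then show ?thesis using u by (simp add: ro_def sum.distrib sum_int_delta)
    qed
    let ?E = "elem x y t e"
    have compE: "co m0 n0 ?E = ro m0 n0 A1"
    proof
      fix j
      show "co m0 n0 ?E j = ro m0 n0 A1 j"
      proof (cases "j \<in> {m0..n0}")
        case True
        have "co m0 n0 ?E j =
          (\<Sum>i\<in>{m0..n0}. if j = i then e j else 0) + (\<Sum>i\<in>{m0..n0}. if x = i then (if j = y then t else 0) else 0)"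
          unfolding co_def sum.distrib[symmetric] by (intro sum.cong) (auto simp: elem_def)
        then show ?thesis using True xy ro1 by (simp add: sum_int_delta e_def)
      next
        case False
        then have "co m0 n0 ?E j = 0" using e0 xy by (auto simp: co_def elem_def)
        moreover have "ro m0 n0 A1 j = 0" using False tXi_zero[OF A1] by (simp add: ro_def)
        ultimately show ?thesis by simp
      qed
    qed
    note el = xy adj' less_imp_le[OF t0] e0
    let ?Xs = "elem_terms x y t A1"
    have sumt: "(\<Sum>j\<in>{m0..n0}. A x j - A1 x j) = t"
    proof -
      have "(\<Sum>j\<in>{m0..n0}. A x j - A1 x j) = (\<Sum>j\<in>{m0..n0}. if u = j then t else 0)"
        using xny by (intro sum.cong) (auto simp: A1_def)
      then show ?thesis using u by (simp add: sum_int_delta)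
    qed
    have AXs: "A \<in> ?Xs"
      using A sumt t0 xny by (auto simp: elem_terms_def A1_def)
    have roE: "ro m0 n0 ?E = ro m0 n0 A" using ro_elem_terms[OF el A1 compE AXs] by simp
    \<comment> \<open>Only column \<open>u\<close> changes, where the binomial of \<open>t\<close>
      over \<open>t\<close> is 1. The exponent is 0 because row \<open>x\<close> of the extended
      \<open>A1\<close> vanishes beyond \<open>u\<close>, where its diagonal place does not lie
      either.\<close>
    have coef1: "elem_coef x y A1 a A = 1" for a
    proof -
      have "(\<Prod>j\<in>{m0..n0}. gb (nat (ext a m0 n0 A x j)) (nat (A x j - A1 x j))) = 1"
        using xy u xny by (intro prod.neutral ballI) (auto simp: A1_def ext_apply t_def)
      moreover have "(if bef x y i j then (A x i - A1 x i) * ext a m0 n0 A1 x j else 0) = 0"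
        if "j \<in> {m0..n0}" for i j
      proof (cases "i = u \<and> bef x y i j")
        case True
        then have "j \<noteq> u" "j \<noteq> x" using adj by (auto simp: bef_def split: if_splits)
        then show ?thesis using corner[of j] True xy that by (simp add: ext_apply A1_def)
      next
        case False
        then show ?thesis by (auto simp: A1_def)
      qed
      ultimately show ?thesis by (simp add: elem_coef_def)
    qed
    \<comment> \<open>The gain in \<open>spread\<close> from moving one unit from
      \<open>(y,j)\<close> to \<open>(x,j)\<close>; it increases strictly in the direction from
      \<open>x\<close> to \<open>y\<close>.\<close>
    define inc where "inc j = (x - j)^2 - (y - j)^2" for j
    have inc: "inc j = (if x < y then 2 * (j - x) - 1 else 2 * (x - j) - 1)" for j
    proof -
      have "inc j = (x - y) * (x + y - 2 * j)"
        by (simp add: inc_def power2_eq_square algebra_simps)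
      then show ?thesis using adj' by auto
    qed
    have spA: "spread A = spread A1 + inc u * t"
    proof -
      have "(\<Sum>j\<in>{m0..n0}. inc j * (A x j - A1 x j)) = (\<Sum>j\<in>{m0..n0}. if u = j then inc u * t else 0)"
        using xny by (intro sum.cong) (auto simp: A1_def)
      then show ?thesis using spread_elem_terms[OF AXs xy xny(1)] u by (simp add: inc_def sum_int_delta)
    qed
    have "inc u > 0" using adj by (auto simp: inc)
    then have lt1: "nat (spread A1) < nat (spread A)"
      using spA mult_pos_pos[of "inc u" t] t0 spread_nonneg[OF A1] by linarith
    \<comment> \<open>No unit can come from a column beyond \<open>u\<close>, where row
      \<open>y\<close> of \<open>A1\<close> is 0. Each unit thus gains at most \<open>inc u\<close>,
      and if \<open>X \<noteq> A\<close>, some unit is moved in another column and gains strictly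
      less.\<close>
    have ltX: "nat (spread X) < nat (spread A)" if X: "X \<in> ?Xs" "X \<noteq> A" for X
    proof -
      have X': "X \<in> tXi m0 n0" "\<And>i j. i \<noteq> x \<Longrightarrow> i \<noteq> y \<Longrightarrow> X i j = A1 i j"
        "\<And>j. X x j + X y j = A1 x j + A1 y j" "\<And>j. A1 x j \<le> X x j" "(\<Sum>j\<in>{m0..n0}. X x j - A1 x j) = t"
        using X(1) by (auto simp: elem_terms_def)
      define w where "w j = X x j - A1 x j" for j
      have w0: "w j \<ge> 0" for j using X'(4)[of j] by (simp add: w_def)
      have wbef: "w j = 0" if "bef x y u j" for j
      proof -
        have "j \<noteq> u" "j \<noteq> y" using that adj by (auto simp: bef_def split: if_splits)
        then have "A1 y j = 0" "X y j \<ge> 0" using corner[OF that] tXi_nonneg[OF X'(1)] by (auto simp: A1_def)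
        then show ?thesis using X'(3)[of j] w0[of j] by (simp add: w_def)
      qed
      have gap: "(inc u - inc j) * w j \<ge> 0" for j
        using wbef[of j] w0[of j] by (cases "bef x y u j") (auto simp: inc bef_def split: if_splits)
      have ex: "\<exists>j\<in>{m0..n0}. j \<noteq> u \<and> w j \<noteq> 0"
      proof (rule ccontr)
        assume "\<not> ?thesis"
        then have 0: "w j = 0" if "j \<in> {m0..n0}" "j \<noteq> u" for j using that by blast
        have "(\<Sum>j\<in>{m0..n0}. w j) = w u"
          using sum.remove[OF _ u(1), of w] 0 by simp
        then have "w u = t" using X'(5) by (simp add: w_def)
        have Xx: "X x j = A x j" for j
        proof (cases "j \<in> {m0..n0}")
          case True
          then show ?thesis using 0[of j] \<open>w u = t\<close> xny by (cases "j = u") (auto simp: w_def A1_def)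
        next
          case False
          then show ?thesis using tXi_zero[OF X'(1)] tXi_zero[OF A] by simp
        qed
        moreover have "X y j = A y j" for j
          using X'(3)[of j] Xx[of j] xny by (auto simp: A1_def split: if_splits)
        moreover have "X i j = A i j" if "i \<noteq> x" "i \<noteq> y" for i j
          using X'(2)[OF that] that by (simp add: A1_def)
        ultimately have "X = A" by (intro ext) metis
        then show False using X(2) by simp
      qed
      then obtain j where j: "j \<in> {m0..n0}" "j \<noteq> u" "w j \<noteq> 0" by blast
      have "\<not> bef x y u j" using wbef j by blast
      then have "inc u - inc j > 0" using j(2) xny(1) by (auto simp: inc bef_def split: if_splits)
      then have "(inc u - inc j) * w j > 0" using w0[of j] j(3) by simp
      then have "(\<Sum>j\<in>{m0..n0}. (inc u - inc j) * w j) > 0"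
        using gap j(1) by (intro sum_pos2[of _ j]) auto
      also have "(\<Sum>j\<in>{m0..n0}. (inc u - inc j) * w j) = inc u * t - (\<Sum>j\<in>{m0..n0}. inc j * w j)"
        using X'(5) by (simp add: w_def[symmetric] left_diff_distrib sum_subtractf flip: sum_distrib_left)
      also have "(\<Sum>j\<in>{m0..n0}. inc j * w j) = spread X - spread A1"
        using spread_elem_terms[OF X(1) xy xny(1)] by (simp add: inc_def w_def)
      finally show ?thesis using spA spread_nonneg[OF X'(1)] by (simp add: nat_less_iff)
    qed
    have coX: "co m0 n0 X = ro m0 n0 B" if "X \<in> ?Xs" for X
      using co_elem_terms[OF el A1 compE that] co_elem_terms[OF el A1 compE AXs] comp by simp
    have co1: "co m0 n0 A1 = ro m0 n0 B"
      using co_elem_terms[OF el A1 compE AXs] comp by simp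
    obtain a0 where ex: "expands (ro m0 n0 ?E) (\<lambda>a. dd m0 n0 a ?E + dd m0 n0 a A1)
        (conv (orbit ?E) (orbit A1)) ?Xs (elem_coef x y A1) a0"
      using expands_elem[OF el A1 compE] by blast
    have fin: "finite ?Xs" by (rule finite_elem_terms[OF A1])
    let ?F1 = "conv (orbit ?E) (conv (orbit A1) (orbit B))"
    let ?F2 = "\<lambda>a m n R r f1 f2. \<Sum>X\<in>?Xs - {A}. poly (- elem_coef x y A1 a X) (int (card (carrier R))) *
        conv (orbit X) (orbit B) a m n R r f1 f2"
    \<comment> \<open>All \<open>t\<close> units are moved away from the diagonal, so
      \<open>wt A = wt A1 + t\<close>, while \<open>wt E = t\<close>. The exponents of
      \<open>A\<close> and of the product \<open>e_E e_A1\<close> therefore differ by a constant,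
      and the coefficients 1 and -1 are stable.\<close>
    have const: "dd m0 n0 a A - dd m0 n0 a ?E - dd m0 n0 a A1 = dA m0 n0 A - dA m0 n0 ?E - dA m0 n0 A1" for a
    proof -
      have "wt m0 n0 A - wt m0 n0 A1 = (\<Sum>j\<in>{m0..n0}. (\<bar>x - j\<bar> - \<bar>y - j\<bar>) * (A x j - A1 x j))"
        by (rule wt_elem_terms[OF el A1 compE AXs])
      also have "\<dots> = (\<Sum>j\<in>{m0..n0}. if u = j then (\<bar>x - u\<bar> - \<bar>y - u\<bar>) * t else 0)"
        using xny by (intro sum.cong refl) (auto simp: A1_def)
      also have "\<dots> = t" using u adj by (auto simp: sum_int_delta)
      finally have "a * wt m0 n0 A = a * wt m0 n0 A1 + a * t" by (simp add: algebra_simps flip: distrib_left)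
      moreover have "wt m0 n0 ?E = t" by (rule wt_elem[OF el A1 compE])
      ultimately show ?thesis by (simp add: dd_def)
    qed
    \<comment> \<open>Here the recorded row sums are used: every term \<open>X\<close> of the
      expansion of \<open>e_A1 e_B\<close> has the row sums of \<open>A1\<close>, which are the
      column sums of \<open>E\<close>.\<close>
    have F1: "stable_kernel (ro m0 n0 A) (\<lambda>a. dd m0 n0 a ?E + (dd m0 n0 a A1 + dd m0 n0 a B)) ?F1"
    proof (rule stable_kernel_conv_right[OF less.hyps[OF lt1 A1 B co1]])
      fix X assume X: "X \<in> tXi m0 n0" "ro m0 n0 X = ro m0 n0 A1"
      then have "co m0 n0 ?E = ro m0 n0 X" using compE by simp
      from expands_elem[OF el X(1) this]
      show "stable_kernel (ro m0 n0 A) (\<lambda>a. dd m0 n0 a ?E + dd m0 n0 a X) (conv (orbit ?E) (orbit X))"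
        unfolding stable_kernel_def roE by blast
    qed
    have F2: "stable_kernel (ro m0 n0 A) (\<lambda>a. dd m0 n0 a A + dd m0 n0 a B) ?F2"
    proof (rule stable_kernel_sum[where I = "?Xs - {A}" and H = "\<lambda>X. conv (orbit X) (orbit B)"
          and K = "\<lambda>a X. - elem_coef x y A1 a X" and e' = "\<lambda>X a. dd m0 n0 a X + dd m0 n0 a B" and ?a0.0 = 0])
      show "finite (?Xs - {A})" using fin by simp
      fix X assume X: "X \<in> ?Xs - {A}"
      have "stable_kernel (ro m0 n0 X) (\<lambda>a. dd m0 n0 a X + dd m0 n0 a B) (conv (orbit X) (orbit B))"
        using X by (intro less.hyps[OF ltX _ B coX]) (auto simp: elem_terms_def)
      then show "stable_kernel (ro m0 n0 A) (\<lambda>a. dd m0 n0 a X + dd m0 n0 a B) (conv (orbit X) (orbit B))"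
        using ro_elem_terms[OF el A1 compE, of X] roE X by simp
      have 1: "stable (\<lambda>a. dd m0 n0 a ?E + dd m0 n0 a A1 - dd m0 n0 a X) (\<lambda>a. elem_coef x y A1 a X)"
        using X by (intro stable_elem_coef[OF el A1 compE]) auto
      have 2: "stable (\<lambda>a. dd m0 n0 a A - dd m0 n0 a ?E - dd m0 n0 a A1) (\<lambda>_. of_int (- 1))"
        by (rule stable_const[OF const])
      have "stable (\<lambda>a. dd m0 n0 a A + dd m0 n0 a B - (dd m0 n0 a X + dd m0 n0 a B))
          (\<lambda>a. of_int (- 1) * elem_coef x y A1 a X)"
        by (rule stable_mult[OF 2 1]) simp
      then show "stable (\<lambda>a. dd m0 n0 a A + dd m0 n0 a B - (dd m0 n0 a X + dd m0 n0 a B)) (\<lambda>a. - elem_coef x y A1 a X)"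
        by simp
    qed simp
    show ?thesis
    proof (rule stable_kernel_add[OF F1 _ F2])
      have "dd m0 n0 a A + dd m0 n0 a B - (dd m0 n0 a ?E + (dd m0 n0 a A1 + dd m0 n0 a B)) =
          dA m0 n0 A - dA m0 n0 ?E - dA m0 n0 A1" for a
        using const[of a] by simp
      then have "stable (\<lambda>a. dd m0 n0 a A + dd m0 n0 a B - (dd m0 n0 a ?E + (dd m0 n0 a A1 + dd m0 n0 a B))) (\<lambda>_. of_int 1)"
        by (rule stable_const)
      then show "stable (\<lambda>a. dd m0 n0 a A + dd m0 n0 a B - (dd m0 n0 a ?E + (dd m0 n0 a A1 + dd m0 n0 a B))) (\<lambda>_. 1)"
        by simp
      fix a m n R r f1 f2 assume adm: "adm a0 a m n R r f1 f2"
      have "?F1 a m n R r f1 f2 = conv (conv (orbit ?E) (orbit A1)) (orbit B) a m n R r f1 f2"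
        by (simp add: conv_assoc)
      also have "\<dots> = conv (\<lambda>a m n R r f1 f2. \<Sum>X\<in>?Xs. poly (elem_coef x y A1 a X) (int (card (carrier R))) *
          orbit X a m n R r f1 f2) (orbit B) a m n R r f1 f2"
        by (rule conv_cong_left[OF adm]) (use ex in \<open>auto simp: expands_def\<close>)
      also have "\<dots> = (\<Sum>X\<in>?Xs. poly (elem_coef x y A1 a X) (int (card (carrier R))) *
          conv (orbit X) (orbit B) a m n R r f1 f2)"
        by (rule conv_sum_left)
      also have "\<dots> = conv (orbit A) (orbit B) a m n R r f1 f2 - ?F2 a m n R r f1 f2"
        using sum.remove[OF fin AXs, of "\<lambda>X. poly (elem_coef x y A1 a X) (int (card (carrier R))) *
          conv (orbit X) (orbit B) a m n R r f1 f2"] by (simp add: coef1 sum_negf)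
      finally show "conv (orbit A) (orbit B) a m n R r f1 f2 =
          poly 1 (int (card (carrier R))) * ?F1 a m n R r f1 f2 + ?F2 a m n R r f1 f2"
        by simp
    qed
  qed
qed

end

section \<open>From convolution kernels back to structure constants\<close>

lemma ext_Xi:
  assumes X: "X \<in> tXi m0 n0" and mn: "m \<le> m0" "n0 \<le> n" "m0 \<le> n0"
    and a: "a \<ge> 0" "\<And>j. j \<in> {m0..n0} \<Longrightarrow> X j j + a \<ge> 0"
  shows "ext a m n X \<in> Xi m n (msum m0 n0 X + a * (n - m + 1))"
proof -
  have nonneg: "ext a m n X i j \<ge> 0" for i j
  proof (cases "i = j")
    case True
    then show ?thesis using a tXi_zero[OF X, of i j] by (cases "i \<in> {m0..n0}") (auto simp: ext_def)
  next
    case False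
    then show ?thesis using tXi_nonneg[OF X False] by (simp add: ext_def)
  qed
  have "msum m n (ext a m n X) = (\<Sum>k\<in>{m..n}. ro m0 n0 X k) + a * (n - m + 1)"
    unfolding msum_def using row_sum_ext[OF X mn(1,2)] mn by (simp add: sum.distrib mult.commute)
  also have "(\<Sum>k\<in>{m..n}. ro m0 n0 X k) = (\<Sum>k\<in>{m0..n0}. ro m0 n0 X k)"
    using mn tXi_zero[OF X] by (intro sum_restrict_int) (auto simp: ro_def)
  also have "\<dots> = msum m0 n0 X" by (simp add: msum_def ro_def)
  finally show ?thesis using nonneg ext_zero[of _ m n _ a X] by (auto simp: Xi_def tXi_def)
qed

theorem theorem3p4:
  fixes m0 n0 :: int and A B :: mat
  assumes "m0 \<le> n0" and "A \<in> tXi m0 n0" and "B \<in> tXi m0 n0"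
    and "co m0 n0 A = ro m0 n0 B"
  shows "\<exists>(s::nat) (X :: nat \<Rightarrow> mat) (P :: nat \<Rightarrow> rf poly) (a0::int).
           (\<forall>i<s. X i \<in> tXi m0 n0 \<and> P i \<in> Z1) \<and> a0 \<ge> 0 \<and>
           (\<forall>a m n. a \<ge> a0 \<and> m \<le> m0 \<and> n \<ge> n0 \<longrightarrow>
              (let r = msum m0 n0 A + a * (n - m + 1) in
                ext a m n A \<in> Xi m n r \<and> ext a m n B \<in> Xi m n r \<and>
                (\<forall>i<s. ext a m n (X i) \<in> Xi m n r) \<and>
                Kprod m n (ext a m n A) (ext a m n B) =
                  (\<lambda>C. \<Sum>i<s. poly (P i) (vv powi (- a)) * Kbasis (ext a m n (X i)) C)))"
proof -
  interpret window m0 n0 by unfold_locales (rule assms(1))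
  note A = assms(2) and B = assms(3) and comp = assms(4)
  obtain Xs K b0 where "expands (ro m0 n0 A) (\<lambda>a. dd m0 n0 a A + dd m0 n0 a B) (conv (orbit A) (orbit B)) Xs K b0"
    using stable_product[OF A B comp] unfolding stable_kernel_def by blast
  then have fin: "finite Xs" and Xs: "\<And>X. X \<in> Xs \<Longrightarrow> X \<in> tXi m0 n0" "\<And>X. X \<in> Xs \<Longrightarrow> ro m0 n0 X = ro m0 n0 A"
    and stab: "\<And>X. X \<in> Xs \<Longrightarrow> stable (\<lambda>a. dd m0 n0 a A + dd m0 n0 a B - dd m0 n0 a X) (\<lambda>a. K a X)"
    and K: "\<And>a m n R r f1 f2. adm b0 a m n R r f1 f2 \<Longrightarrow> conv (orbit A) (orbit B) a m n R r f1 f2 =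
      (\<Sum>X\<in>Xs. poly (K a X) (int (card (carrier R))) * orbit X a m n R r f1 f2)"
    unfolding expands_def by blast+
  have "\<forall>X\<in>Xs. \<exists>p c. p \<in> Z1 \<and> (\<forall>a\<ge>c. phi (K a X) * vv powi (- (dd m0 n0 a A + dd m0 n0 a B - dd m0 n0 a X)) =
      poly p (vv powi (- a)))"
    using stab unfolding stable_def by blast
  then obtain p c where p: "\<And>X. X \<in> Xs \<Longrightarrow> p X \<in> Z1" and
    pK: "\<And>X a. X \<in> Xs \<Longrightarrow> a \<ge> c X \<Longrightarrow>
      phi (K a X) * vv powi (- (dd m0 n0 a A + dd m0 n0 a B - dd m0 n0 a X)) = poly (p X) (vv powi (- a))"
    by metis
  obtain h where h: "bij_betw h {0..<card Xs} Xs" using ex_bij_betw_nat_finite[OF fin] by blast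
  define s where "s = card Xs"
  have hX: "h i \<in> Xs" if "i < s" for i using h that by (auto simp: bij_betw_def s_def)
  define diag where "diag X = (\<Sum>j\<in>{m0..n0}. \<bar>X j j\<bar>)" for X :: mat
  have diag: "X j j + diag X \<ge> 0" "diag X \<ge> 0" if "j \<in> {m0..n0}" for X j
  proof -
    have "\<bar>X j j\<bar> \<le> diag X" unfolding diag_def using that by (intro member_le_sum) auto
    then show "X j j + diag X \<ge> 0" "diag X \<ge> 0" by auto
  qed
  \<comment> \<open>\<open>b0\<close> is the threshold of the expansion, \<open>c X\<close> that of
    the polynomial for \<open>X\<close>, and the terms \<open>diag\<close> make the diagonals of all
    extended matrices nonnegative.\<close>
  define a0 where "a0 = \<bar>b0\<bar> + (\<Sum>X\<in>Xs. \<bar>c X\<bar> + diag X) + diag A + diag B"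
  have dpos: "diag X \<ge> 0" for X by (simp add: diag_def sum_nonneg)
  have spos: "(\<Sum>X\<in>Xs. \<bar>c X\<bar> + diag X) \<ge> 0" using dpos by (intro sum_nonneg) auto
  have a0: "a0 \<ge> 0" "a0 \<ge> b0" "a0 \<ge> diag A" "a0 \<ge> diag B"
    using spos dpos[of A] dpos[of B] by (auto simp: a0_def)
  have a0X: "a0 \<ge> c X" "a0 \<ge> diag X" if "X \<in> Xs" for X
  proof -
    have "\<bar>c X\<bar> + diag X \<le> (\<Sum>X\<in>Xs. \<bar>c X\<bar> + diag X)"
      using that fin dpos by (intro member_le_sum) auto
    then show "a0 \<ge> c X" "a0 \<ge> diag X" using dpos[of A] dpos[of B] dpos[of X] by (auto simp: a0_def)
  qed
  have msum_ro: "msum m0 n0 X = (\<Sum>k\<in>{m0..n0}. ro m0 n0 X k)" for X by (simp add: msum_def ro_def)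
  \<comment> \<open>Adding up \<open>A\<close> by columns and \<open>B\<close> by rows gives the
    same total.\<close>
  have msB: "msum m0 n0 B = msum m0 n0 A"
    unfolding msum_ro[of B] comp[symmetric] unfolding co_def msum_def by (rule sum.swap)
  have main: "ext a m n A \<in> Xi m n r \<and> ext a m n B \<in> Xi m n r \<and> (\<forall>i<s. ext a m n (h i) \<in> Xi m n r) \<and>
      Kprod m n (ext a m n A) (ext a m n B) =
        (\<lambda>C. \<Sum>i<s. poly (p (h i)) (vv powi (- a)) * Kbasis (ext a m n (h i)) C)"
    if a: "a \<ge> a0" and mn: "m \<le> m0" "n0 \<le> n" and r: "r = msum m0 n0 A + a * (n - m + 1)" for a m n r
  proof -
    have mn': "m \<le> n" using mn m0n0 by simp
    have ext: "ext a m n X \<in> Xi m n r" if X: "X \<in> tXi m0 n0" "a \<ge> diag X" "msum m0 n0 X = msum m0 n0 A" for X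
    proof -
      have "X j j + a \<ge> 0" if "j \<in> {m0..n0}" for j using diag(1)[OF that, of X] X(2) by simp
      then show ?thesis using ext_Xi[OF X(1) mn m0n0, of a] X(3) a a0 r by simp
    qed
    have eA: "ext a m n A \<in> Xi m n r" and eB: "ext a m n B \<in> Xi m n r"
      using ext[OF A] ext[OF B] msB a a0 by auto
    have eX: "ext a m n X \<in> Xi m n r" if "X \<in> Xs" for X
      using that Xs[OF that] a0X[OF that] a by (intro ext) (auto simp: msum_ro)
    have "Kprod m n (ext a m n A) (ext a m n B) C =
      (\<Sum>i<s. poly (p (h i)) (vv powi (- a)) * Kbasis (ext a m n (h i)) C)" for C
    proof (cases "C \<in> Xi m n r")
      case False
      then have "Kbasis (ext a m n (h i)) C = 0" if "i < s" for i
        using eX[OF hX[OF that]] by (auto simp: Kbasis_def)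
      moreover have "msum m n (ext a m n A) = r" using eA by (simp add: Xi_def)
      ultimately show ?thesis using False by (simp add: Kprod_def)
    next
      case C: True
      have sum_h: "(\<Sum>i<s. g (h i)) = (\<Sum>X\<in>Xs. g X)" for g :: "mat \<Rightarrow> rf"
        using sum.reindex_bij_betw[OF h, of g] by (simp add: s_def atLeast0LessThan)
      \<comment> \<open>The candidate for \<open>gpoly\<close>: since extension is injective, it is
        \<open>K a X\<close> if \<open>C\<close> is the extension of some \<open>X\<close> in
        \<open>Xs\<close>, and 0 otherwise.\<close>
      define k where "k = (\<Sum>X\<in>Xs. if C = ext a m n X then K a X else 0)"
      have "gpoly m n (ext a m n A) (ext a m n B) C = k"
      proof (rule gpoly_eqI[OF mn' C])
        fix R f1 f2
        assume R: "coord_space R" "is_flag R (nat r) m n f1" "is_flag R (nat r) m n f2"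
          "ftype R (nat r) m n f1 f2 = C"
        have adm: "adm b0 a m n R (nat r) f1 f2" using R mn a a0 by (simp add: adm_def)
        show "int (card {f. is_flag R (nat r) m n f \<and> ftype R (nat r) m n f1 f = ext a m n A \<and>
            ftype R (nat r) m n f f2 = ext a m n B}) = poly k (int (card (carrier R)))"
          unfolding conv_orbit[OF adm, symmetric] K[OF adm] k_def poly_sum
          by (intro sum.cong refl) (simp add: orbit_def R(4))
      qed
      then have "Kprod m n (ext a m n A) (ext a m n B) C =
        vv powi (dA m n C - dA m n (ext a m n A) - dA m n (ext a m n B)) * phi k"
        using C eA by (simp add: Kprod_def Xi_def phi_def)
      also have "\<dots> = (\<Sum>X\<in>Xs. poly (p X) (vv powi (- a)) * Kbasis (ext a m n X) C)"
      proof (cases "\<exists>X\<in>Xs. C = ext a m n X")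
        case False
        then have "k = 0" unfolding k_def by (intro sum.neutral) auto
        moreover have "(\<Sum>X\<in>Xs. poly (p X) (vv powi (- a)) * Kbasis (ext a m n X) C) = 0"
          using False by (intro sum.neutral ballI) (auto simp: Kbasis_def)
        ultimately show ?thesis by simp
      next
        case True
        then obtain X where X: "X \<in> Xs" "C = ext a m n X" by blast
        have eq: "C = ext a m n Y \<longleftrightarrow> Y = X" if "Y \<in> Xs" for Y
        proof
          assume "C = ext a m n Y"
          then have "ext a m n Y = ext a m n X" using X(2) by (rule trans[OF sym])
          then show "Y = X" by (rule ext_inj[OF Xs(1)[OF that] Xs(1)[OF X(1)] mn])
        qed (use X(2) in blast)
        have "k = (\<Sum>Y\<in>Xs. if Y = X then K a Y else 0)"
          unfolding k_def by (intro sum.cong refl) (simp add: eq)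
        then have k: "k = K a X" using X(1) fin by (simp add: sum.delta)
        have "(\<Sum>Y\<in>Xs. poly (p Y) (vv powi (- a)) * Kbasis (ext a m n Y) C) =
          (\<Sum>Y\<in>Xs. if Y = X then poly (p Y) (vv powi (- a)) else 0)"
          by (intro sum.cong refl) (simp add: Kbasis_def eq)
        also have "\<dots> = poly (p X) (vv powi (- a))" using X(1) fin by (simp add: sum.delta)
        also have "\<dots> = phi (K a X) * vv powi (- (dd m0 n0 a A + dd m0 n0 a B - dd m0 n0 a X))"
          using pK[OF X(1)] a0X[OF X(1)] a by simp
        finally show ?thesis
          unfolding k X(2) dA_ext[OF A mn] dA_ext[OF B mn] dA_ext[OF Xs(1)[OF X(1)] mn]
          by (simp add: algebra_simps)
      qed
      finally show ?thesis unfolding sum_h[of "\<lambda>X. poly (p X) (vv powi (- a)) * Kbasis (ext a m n X) C"] .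
    qed
    then show ?thesis using eA eB eX hX by auto
  qed
  show ?thesis
  proof (intro exI conjI allI impI)
    show "i < s \<Longrightarrow> h i \<in> tXi m0 n0" "i < s \<Longrightarrow> p (h i) \<in> Z1" for i using Xs hX p by auto
    show "a0 \<ge> 0" by (rule a0(1))
    fix a m n assume "a \<ge> a0 \<and> m \<le> m0 \<and> n \<ge> n0"
    then show "let r = msum m0 n0 A + a * (n - m + 1) in
        ext a m n A \<in> Xi m n r \<and> ext a m n B \<in> Xi m n r \<and> (\<forall>i<s. ext a m n (h i) \<in> Xi m n r) \<and>
        Kprod m n (ext a m n A) (ext a m n B) =
          (\<lambda>C. \<Sum>i<s. poly (p (h i)) (vv powi (- a)) * Kbasis (ext a m n (h i)) C)"
      unfolding Let_def using main[OF _ _ _ refl] by blast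
  qed
qed

end
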